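(* Given $\epsilon>0$, integers $r,c$, and an $r\times c$ zero-sum game $M$ (row player minimizes, column player maximizes the payoff $M_{ij}$) presented as a polynomial-time oracle that computes $M_{ij}$ from $i$ and $j$, the problem of computing, for each player, a mixed strategy that guarantees an expected payoff within $\epsilon(M_{\max}-M_{\min})$ of $\mathrm{val}(M)$ is in $\Sigma_2^{P(M)}$, where $P(M)$ denotes polynomial in $r+c+\log(rc)/\epsilon$.
   Context: $M_{\min}=\min_{i,j}M_{ij}$, $M_{\max}=\max_{i,j}M_{ij}$, and $\mathrm{val}(M)=\min_p\max_j\sum_ip(i)M_{ij}$ is the value of the game, $p$ ranging over probability distributions on rows. $\Sigma_2^{P(M)}$ denotes the second level of the polynomial hierarchy where "polynomial time" means polynomial in the stated quantity, with access to the payoff oracle. *)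

theory Defs
  imports Complex_Main "HOL-Computational_Algebra.Polynomial"
begin

section \<open>Oracle machines\<close>

type_synonym word = "bool list"
type_synonym oracle_fun = "word \<Rightarrow> word"

text \<open>
  Structured programs over finitely many stacks of bits.  A stack is half a tape, so, up to
  constant factors in time, these are the deterministic multi-tape oracle Turing machines.
  \<open>Query a b\<close> replaces the contents of stack \<open>b\<close> by the answer of the oracle to the query
  on stack \<open>a\<close>, in one step.
\<close>

datatype prog =
    Skip
  | Push nat bool
  | Pop nat
  | Query nat nat
  | Seq prog prog
  | IfTop nat prog prog prog
  | WhileNonempty nat prog

inductive exec :: "oracle_fun \<Rightarrow> prog \<Rightarrow> (nat \<Rightarrow> word) \<Rightarrow> nat \<Rightarrow> (nat \<Rightarrow> word) \<Rightarrow> bool"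
  for Or :: oracle_fun where
  Skip: "exec Or Skip s 1 s"
| Push: "exec Or (Push k b) s 1 (s(k := b # s k))"
| Pop: "exec Or (Pop k) s 1 (s(k := tl (s k)))"
| Query: "exec Or (Query a b) s 1 (s(b := Or (s a)))"
| Seq: "exec Or P s t s' \<Longrightarrow> exec Or Q s' t' s'' \<Longrightarrow> exec Or (Seq P Q) s (t + t') s''"
| IfEmpty: "s k = [] \<Longrightarrow> exec Or P s t s' \<Longrightarrow> exec Or (IfTop k P Q R) s (Suc t) s'"
| IfFalse: "s k = False # w \<Longrightarrow> exec Or Q s t s' \<Longrightarrow> exec Or (IfTop k P Q R) s (Suc t) s'"
| IfTrue: "s k = True # w \<Longrightarrow> exec Or R s t s' \<Longrightarrow> exec Or (IfTop k P Q R) s (Suc t) s'"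
| WhileEnd: "s k = [] \<Longrightarrow> exec Or (WhileNonempty k P) s 1 s"
| WhileStep: "s k \<noteq> [] \<Longrightarrow> exec Or P s t s' \<Longrightarrow> exec Or (WhileNonempty k P) s' t' s'' \<Longrightarrow>
    exec Or (WhileNonempty k P) s (Suc (t + t')) s''"

text \<open>The input words are on stacks \<open>0, 1, \<dots>\<close>, first letter on top; the output is left on stack \<open>0\<close>.\<close>

definition runs :: "oracle_fun \<Rightarrow> prog \<Rightarrow> word list \<Rightarrow> nat \<Rightarrow> word \<Rightarrow> bool" where
  "runs Or P ws t out \<longleftrightarrow>
     (\<exists>s. exec Or P (\<lambda>k. if k < length ws then ws ! k else []) t s \<and> s 0 = out)"

definition accepts :: "oracle_fun \<Rightarrow> prog \<Rightarrow> word list \<Rightarrow> bool" where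
  "accepts Or P ws \<longleftrightarrow> (\<exists>t. runs Or P ws t [True])"

section \<open>The second level of the polynomial hierarchy with a prescribed size parameter\<close>

definition polybound :: "nat poly \<Rightarrow> real \<Rightarrow> real" where
  "polybound T x = poly (map_poly real T) x"

text \<open>
  \<open>Sigma2 orc inp \<kappa> I L\<close>: the decision problem \<open>L\<close> on the set \<open>I\<close> of (promised) instances is of
  the form \<open>\<exists>u. \<forall>v. V(x, u, v)\<close>, where the lengths of \<open>u\<close> and \<open>v\<close> and the running time of \<open>V\<close>
  are polynomial in \<open>\<kappa> x\<close>.  The machine \<open>V\<close> gets the words \<open>inp x\<close> as input and has access
  to the oracle \<open>orc x\<close>.
\<close>

definition Sigma2 ::
    "('i \<Rightarrow> oracle_fun) \<Rightarrow> ('i \<Rightarrow> word list) \<Rightarrow> ('i \<Rightarrow> real) \<Rightarrow> 'i set \<Rightarrow> 'i set \<Rightarrow> bool" where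
  "Sigma2 orc inp \<kappa> I L \<longleftrightarrow>
     (\<exists>V T. \<forall>x\<in>I. let B = {w :: word. real (length w) \<le> polybound T (\<kappa> x)} in
        (\<forall>u\<in>B. \<forall>v\<in>B. \<exists>t out. runs (orc x) V (inp x @ [u, v]) t out \<and>
           real t \<le> polybound T (\<kappa> x)) \<and>
        (x \<in> L \<longleftrightarrow> (\<exists>u\<in>B. \<forall>v\<in>B. accepts (orc x) V (inp x @ [u, v]))))"

text \<open>
  A search problem \<open>R\<close> is in the class if its outputs can be taken from a relation \<open>S\<close> contained
  in \<open>R\<close> that is total, polynomially bounded in length, and in \<open>Sigma2\<close> as a decision problem:
  an existential guess yields the output, which is then confirmed by a \<open>\<Sigma>\<^sub>2\<close> computation.
\<close>

definition search_Sigma2 ::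
    "('i \<Rightarrow> oracle_fun) \<Rightarrow> ('i \<Rightarrow> word list) \<Rightarrow> ('i \<Rightarrow> real) \<Rightarrow> 'i set \<Rightarrow>
     ('i \<Rightarrow> word \<Rightarrow> bool) \<Rightarrow> bool" where
  "search_Sigma2 orc inp \<kappa> I R \<longleftrightarrow>
     (\<exists>S T.
        (\<forall>x\<in>I. (\<exists>y. S x y) \<and>
           (\<forall>y. S x y \<longrightarrow> real (length y) \<le> polybound T (\<kappa> x) \<and> R x y)) \<and>
        Sigma2 (\<lambda>(x, y). orc x) (\<lambda>(x, y). inp x @ [y]) (\<lambda>(x, y). \<kappa> x)
          {(x, y). x \<in> I \<and> real (length y) \<le> polybound T (\<kappa> x)}
          {(x, y). S x y})"

section \<open>Zero-sum games\<close>

text \<open>Rows are \<open>0, \<dots>, r - 1\<close> and columns \<open>0, \<dots>, c - 1\<close>.\<close>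

definition mixed :: "nat \<Rightarrow> (nat \<Rightarrow> real) \<Rightarrow> bool" where
  "mixed n p \<longleftrightarrow> (\<forall>i<n. 0 \<le> p i) \<and> (\<Sum>i<n. p i) = 1"

definition game_max :: "nat \<Rightarrow> nat \<Rightarrow> (nat \<Rightarrow> nat \<Rightarrow> real) \<Rightarrow> real" where
  "game_max r c M = Max {M i j | i j. i < r \<and> j < c}"

definition game_min :: "nat \<Rightarrow> nat \<Rightarrow> (nat \<Rightarrow> nat \<Rightarrow> real) \<Rightarrow> real" where
  "game_min r c M = Min {M i j | i j. i < r \<and> j < c}"

definition game_val :: "nat \<Rightarrow> nat \<Rightarrow> (nat \<Rightarrow> nat \<Rightarrow> real) \<Rightarrow> real" where
  "game_val r c M = (INF p\<in>{p. mixed r p}. Max ((\<lambda>j. \<Sum>i<r. p i * M i j) ` {..<c}))"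

definition expected_payoff ::
    "nat \<Rightarrow> nat \<Rightarrow> (nat \<Rightarrow> nat \<Rightarrow> real) \<Rightarrow> (nat \<Rightarrow> real) \<Rightarrow> (nat \<Rightarrow> real) \<Rightarrow> real" where
  "expected_payoff r c M p q = (\<Sum>i<r. \<Sum>j<c. p i * q j * M i j)"

definition row_guarantees ::
    "nat \<Rightarrow> nat \<Rightarrow> (nat \<Rightarrow> nat \<Rightarrow> real) \<Rightarrow> (nat \<Rightarrow> real) \<Rightarrow> real \<Rightarrow> bool" where
  "row_guarantees r c M p v \<longleftrightarrow>
     mixed r p \<and> (\<forall>q. mixed c q \<longrightarrow> expected_payoff r c M p q \<le> v)"

definition col_guarantees ::
    "nat \<Rightarrow> nat \<Rightarrow> (nat \<Rightarrow> nat \<Rightarrow> real) \<Rightarrow> (nat \<Rightarrow> real) \<Rightarrow> real \<Rightarrow> bool" where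
  "col_guarantees r c M q v \<longleftrightarrow>
     mixed c q \<and> (\<forall>p. mixed r p \<longrightarrow> v \<le> expected_payoff r c M p q)"

section \<open>Encodings\<close>

text \<open>Binary digits, least significant first, without leading zeros.\<close>

fun bits :: "nat \<Rightarrow> word" where
  "bits n = (if n = 0 then [] else odd n # bits (n div 2))"

declare bits.simps [simp del]

text \<open>A self-delimiting code: every digit is preceded by \<open>True\<close>, and \<open>False\<close> marks the end.\<close>

definition nat_code :: "nat \<Rightarrow> word" where
  "nat_code n = concat (map (\<lambda>b. [True, b]) (bits n)) @ [False]"

text \<open>
  A rational is coded by its sign followed by the digits of numerator and denominator (in lowest
  terms), most significant first, aligned and interleaved.  Because of the alignment, the order of
  magnitude of a small rational \<open>\<epsilon>\<close> can be read off a prefix of length \<open>O(log (1/\<epsilon>))\<close>, so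
  time bounds in terms of \<open>1/\<epsilon>\<close> make sense even if \<open>\<epsilon>\<close> has a much longer code.
\<close>

definition rat_code :: "rat \<Rightarrow> word" where
  "rat_code x =
     (let a = bits (nat \<bar>fst (quotient_of x)\<bar>); b = bits (nat (snd (quotient_of x)));
          l = max (length a) (length b);
          pad = (\<lambda>w. replicate (l - length w) False @ rev w)
      in (x < 0) # concat (map2 (\<lambda>d e. [d, e]) (pad a) (pad b)))"

section \<open>Approximate solution of games given by an oracle\<close>

record game_instance =
  eps :: rat
  rows :: nat
  cols :: nat
  payoff :: "nat \<Rightarrow> nat \<Rightarrow> rat"
  payoff_oracle :: oracle_fun

definition game_input :: "game_instance \<Rightarrow> word list" where
  "game_input g = [nat_code (rows g), nat_code (cols g), rat_code (eps g)]"

text \<open>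
  The oracle maps the code of a pair \<open>(i, j)\<close> to the code of the payoff, and it is computed by a
  machine (with no oracle of its own: the trivial oracle gives no information) in time \<open>q\<close> of the
  length of its input.
\<close>

definition valid_instance :: "nat poly \<Rightarrow> game_instance \<Rightarrow> bool" where
  "valid_instance q g \<longleftrightarrow>
     0 < eps g \<and> 0 < rows g \<and> 0 < cols g \<and>
     (\<forall>i<rows g. \<forall>j<cols g.
        payoff_oracle g (nat_code i @ nat_code j) = rat_code (payoff g i j)) \<and>
     (\<exists>G. \<forall>i<rows g. \<forall>j<cols g. let w = nat_code i @ nat_code j in
        \<exists>t \<le> poly q (length w). runs (\<lambda>_. []) G [w] t (payoff_oracle g w))"

text \<open>Mixed strategies with rational probabilities are written as lists of integer weights.\<close>

definition strategy :: "nat list \<Rightarrow> nat \<Rightarrow> real" where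
  "strategy a i = real (a ! i) / real (sum_list a)"

definition near_optimal_pair :: "game_instance \<Rightarrow> word \<Rightarrow> bool" where
  "near_optimal_pair g y \<longleftrightarrow>
     (let r = rows g; c = cols g; M = (\<lambda>i j. real_of_rat (payoff g i j));
          \<delta> = real_of_rat (eps g) * (game_max r c M - game_min r c M)
      in \<exists>a b. length a = r \<and> length b = c \<and> y = concat (map nat_code (a @ b)) \<and>
           row_guarantees r c M (strategy a) (game_val r c M + \<delta>) \<and>
           col_guarantees r c M (strategy b) (game_val r c M - \<delta>))"

end

theory Submission
  imports Defs
begin

text \<open>
  An output is a pair of integer weight vectors \<open>a\<close>, \<open>b\<close> with a common sum \<open>K\<close>.  If all column
  averages against \<open>a\<close> are at most \<open>\<alpha>\<close>, all row averages against \<open>b\<close> are at least \<open>\<beta>\<close>, and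
  \<open>\<alpha> - \<beta> \<le> \<epsilon> (M\<^sub>m\<^sub>a\<^sub>x - M\<^sub>m\<^sub>i\<^sub>n)\<close>, then weak duality makes both strategies near-optimal, so the gap
  is an easily checked certificate.  The existential word supplies a common denominator \<open>D\<close>, integers
  \<open>N\<^sub>i\<^sub>j\<close> with \<open>M\<^sub>i\<^sub>j = (N\<^sub>i\<^sub>j - C) / D\<close>, the bounds \<open>\<alpha>\<close>, \<open>\<beta>\<close>, and a number \<open>E \<ge> 1 / \<epsilon>\<close>; the
  verifier then only needs addition, multiplication and comparison of binary numbers.  The universal
  word is not needed.  Conversely, regret matching yields strategies with an arbitrarily small gap,
  which are rounded to multiples of \<open>1 / K\<close>.

  In the definition of \<open>Sigma2\<close> one polynomial bounds both the guessed words and the running time, so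
  the verifier cannot afford to read all of the existential word.  It reads only a prefix of length
  \<open>4 |y|\<close>, where \<open>y\<close> is the output; \<open>K\<close> is chosen so large that this prefix suffices.
\<close>

section \<open>Words as numbers\<close>

text \<open>The size parameter controls \<open>1 / \<epsilon>\<close> only if the matrix has at
  least two entries: for a single entry the logarithm vanishes and \<open>\<epsilon>\<close> may be
  arbitrarily small. A one-entry game, however, has gap 0, so the final test can fall back on the
  exact inequality \<open>\<alpha> \<le> \<beta>\<close>. In all other cases a prefix of logarithmic
  length of the code of \<open>\<epsilon>\<close> reveals that \<open>1 / \<epsilon>\<close> is at
  most a power of two. The range of the payoffs is not computed either: two guessed thresholds bound
  it from below.

  The number of rounds of regret matching is left uncontrolled, since only the existence of good
  strategies is taken from it; rounding then replaces them by weights with polynomially many digits.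
  The payoffs have polynomially many digits because the machine that computes the oracle writes at
  most one letter per step.

  Costs are treated in two layers. Arithmetic on stacks is proved digit by digit and wrapped into
  register instructions of one common quadratic price; above that layer only instructions are
  counted.\<close>

lemma bits_0 [simp]: "bits 0 = []"
  by (simp add: bits.simps)

lemma bits_pos: "0 < n \<Longrightarrow> bits n = odd n # bits (n div 2)"
  by (subst bits.simps) simp

lemma bits_eq_Nil_iff [simp]: "bits n = [] \<longleftrightarrow> n = 0"
  by (cases "n = 0") (simp_all add: bits_pos)

text \<open>One Horner step \<open>2 * n + b\<close> on words: a zero in front of the empty word is
  dropped, which keeps the word free of leading zeros.\<close>

definition cons_bit :: "bool \<Rightarrow> word \<Rightarrow> word" where
  "cons_bit b w = (if w = [] \<and> \<not> b then [] else b # w)"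

lemma cons_bit_bits: "cons_bit b (bits n) = bits (2 * n + of_bool b)"
  by (cases "n = 0"; cases b) (simp_all add: cons_bit_def bits_pos)

lemma length_bits_le: "n < 2 ^ k \<Longrightarrow> length (bits n) \<le> k"
proof (induction k arbitrary: n)
  case 0
  then show ?case by simp
next
  case (Suc k)
  show ?case
  proof (cases "n = 0")
    case False
    have "n div 2 < 2 ^ k" using Suc.prems by auto
    then show ?thesis using Suc.IH False by (simp add: bits_pos)
  qed simp
qed

lemma less_power_length_bits: "n < 2 ^ length (bits n)"
proof (induction n rule: less_induct)
  case (less n)
  show ?case
  proof (cases "n = 0")
    case False
    then have "n div 2 < 2 ^ length (bits (n div 2))" using less by simp
    then show ?thesis using False by (simp add: bits_pos)
  qed simp
qed

lemma power_length_bits_le: "0 < n \<Longrightarrow> 2 ^ (length (bits n) - 1) \<le> n"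
proof (induction n rule: less_induct)
  case (less n)
  show ?case
  proof (cases "n div 2 = 0")
    case True
    then show ?thesis using less.prems by (simp add: bits_pos)
  next
    case False
    then have "2 ^ (length (bits (n div 2)) - 1) \<le> n div 2" using less by simp
    moreover have "length (bits n) - 1 = Suc (length (bits (n div 2)) - 1)"
      using less.prems False by (simp add: bits_pos)
    ultimately show ?thesis by simp
  qed
qed

lemma last_bits: "0 < n \<Longrightarrow> last (bits n)"
proof (induction n rule: less_induct)
  case (less n)
  show ?case
  proof (cases "n div 2 = 0")
    case True
    then have "n = 1" using less.prems by linarith
    then show ?thesis by (simp add: bits_pos)
  next
    case False
    then show ?thesis using less by (simp add: bits_pos[of n])
  qed
qed

text \<open>Together with \<open>last_bits\<close>: whether a digit string taken from a guess is the
  code of a number can be seen from its last letter alone.\<close>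

lemma canonical_is_bits: "w = [] \<or> last w \<Longrightarrow> \<exists>n. w = bits n"
proof (induction w)
  case (Cons b w)
  show ?case
  proof (cases "w = []")
    case True
    then have "b # w = bits 1" using Cons.prems by (simp add: bits_pos)
    then show ?thesis by blast
  next
    case False
    then obtain n where n: "w = bits n" using Cons by auto
    have "b # w = bits (2 * n + of_bool b)"
      using False n cons_bit_bits[of b n] by (simp add: cons_bit_def)
    then show ?thesis by blast
  qed
qed (auto intro: exI[of _ 0])

lemma bits_inject [simp]: "bits m = bits n \<longleftrightarrow> m = n"
proof
  show "bits m = bits n \<Longrightarrow> m = n"
  proof (induction m arbitrary: n rule: less_induct)
    case (less m)
    show ?case
    proof (cases "m = 0")
      case True
      then show ?thesis using less.prems by (metis bits_0 bits_eq_Nil_iff)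
    next
      case False
      then have "0 < n" using less.prems by (metis bits_eq_Nil_iff neq0_conv)
      then have "odd m = odd n" "bits (m div 2) = bits (n div 2)"
        using less.prems False by (simp_all add: bits_pos)
      moreover have "m div 2 = n div 2"
        using less.IH[of "m div 2" "n div 2"] False calculation(2) by simp
      ultimately show ?thesis by (metis even_two_times_div_two odd_two_times_div_two_succ)
    qed
  qed
qed simp

section \<open>Digitwise addition and comparison of binary words\<close>

fun inc_word :: "bool \<Rightarrow> word \<Rightarrow> word" where
  "inc_word False x = x"
| "inc_word True [] = [True]"
| "inc_word True (False # x) = True # x"
| "inc_word True (True # x) = False # inc_word True x"

text \<open>Functional picture of the program \<open>add_to\<close>: \<open>c\<close> is the carry,
  the last argument is consumed to its end, and from there on only the carry runs through what is
  left of the first word.\<close>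

fun add_word :: "bool \<Rightarrow> word \<Rightarrow> word \<Rightarrow> word" where
  "add_word c x [] = inc_word c x"
| "add_word c [] (b # y) = (b \<noteq> c) # add_word (b \<and> c) [] y"
| "add_word c (a # x) (b # y) = ((a \<noteq> b) \<noteq> c) # add_word (a \<and> b \<or> a \<and> c \<or> b \<and> c) x y"

lemma inc_word_bits: "inc_word c (bits n) = bits (n + of_bool c)"
proof (cases c)
  case True
  have "inc_word True (bits n) = bits (Suc n)"
  proof (induction n rule: less_induct)
    case (less n)
    show ?case
    proof (cases "n = 0")
      case False
      then have *: "inc_word True (bits (n div 2)) = bits (Suc (n div 2))" using less by simp
      show ?thesis
      proof (cases "odd n")
        case True
        then show ?thesis using False * by (simp add: bits_pos[of n] bits_pos[of "Suc n"])
      next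
        case even: False
        then have "Suc n div 2 = n div 2" by presburger
        then show ?thesis using False even by (simp add: bits_pos[of n] bits_pos[of "Suc n"])
      qed
    qed (simp add: bits_pos)
  qed
  then show ?thesis using True by simp
qed simp

lemma add_word_bits: "add_word c (bits m) (bits n) = bits (m + n + of_bool c)"
proof (induction n arbitrary: m c rule: less_induct)
  case (less n)
  show ?case
  proof (cases "n = 0")
    case False
    then have IH: "add_word d (bits k) (bits (n div 2)) = bits (k + n div 2 + of_bool d)" for d k
      using less by simp
    show ?thesis
    proof (cases "m = 0")
      case True
      have "(n + of_bool c) div 2 = n div 2 + of_bool (odd n \<and> c)" by (cases c; cases "odd n") (auto elim!: oddE evenE)
      then show ?thesis using False True IH[of "odd n \<and> c" 0]
        by (simp add: bits_pos[of n] bits_pos[of "n + of_bool c"])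
    next
      case m: False
      define d where "d = (odd m \<and> odd n \<or> odd m \<and> c \<or> odd n \<and> c)"
      have "(m + n + of_bool c) div 2 = m div 2 + n div 2 + of_bool d"
        unfolding d_def by (cases c; cases "odd m"; cases "odd n") (simp; presburger)+
      moreover have "odd (m + n + of_bool c) = ((odd m \<noteq> odd n) \<noteq> c)" by auto
      ultimately show ?thesis using False m IH[of d "m div 2"]
        by (simp add: bits_pos[of n] bits_pos[of m] bits_pos[of "m + n + of_bool c"] d_def[symmetric])
    qed
  qed (simp add: inc_word_bits)
qed

text \<open>Comparison from the least significant digit upwards: \<open>g\<close> is the verdict on
  the digits already seen and is overruled by every later pair of different digits. A nonempty rest
  of the second word decides against the first one, because canonical words have no leading
  zeros.\<close>

fun greater_word :: "bool \<Rightarrow> word \<Rightarrow> word \<Rightarrow> bool" where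
  "greater_word g [] y = (g \<and> y = [])"
| "greater_word g (a # x) [] = greater_word (a \<or> g) x []"
| "greater_word g (a # x) (b # y) = greater_word (if a = b then g else a) x y"

lemma less_double_bit_iff:
  "n < m \<or> n = m \<and> (if a = b then g else a) \<longleftrightarrow>
    2 * n + of_bool b < 2 * m + of_bool a \<or> 2 * n + of_bool b = 2 * m + of_bool a \<and> g" for m n :: nat
  by (cases a; cases b; cases g) auto

lemma greater_word_bits: "greater_word g (bits m) (bits n) \<longleftrightarrow> n < m \<or> n = m \<and> g"
proof (induction m arbitrary: n g rule: less_induct)
  case (less m)
  show ?case
  proof (cases "m = 0")
    case False
    then have IH: "greater_word d (bits (m div 2)) (bits k) \<longleftrightarrow> k < m div 2 \<or> k = m div 2 \<and> d" for d k
      using less by simp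
    show ?thesis
    proof (cases "n = 0")
      case True
      then show ?thesis using False IH[of "odd m \<or> g" 0]
        by (cases "m = 1") (auto simp: bits_pos[of m] bits_pos[of "Suc 0"])
    next
      case n: False
      define d where "d = (if odd m = odd n then g else odd m)"
      have "(n div 2 < m div 2 \<or> n div 2 = m div 2 \<and> d) \<longleftrightarrow> n < m \<or> n = m \<and> g"
        using less_double_bit_iff[of "n div 2" "m div 2" "odd m" "odd n" g] unfolding d_def by simp
      then show ?thesis using False n IH[of d "n div 2"]
        by (simp add: bits_pos[of m] bits_pos[of n] d_def del: if_split)
    qed
  qed auto
qed

section \<open>Stack programs\<close>

inductive_cases exec_SkipE: "exec Or Skip s t s'"
inductive_cases exec_PushE: "exec Or (Push k b) s t s'"
inductive_cases exec_PopE: "exec Or (Pop k) s t s'"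
inductive_cases exec_QueryE: "exec Or (Query a b) s t s'"
inductive_cases exec_SeqE: "exec Or (Seq P Q) s t s'"
inductive_cases exec_IfTopE: "exec Or (IfTop k P Q R) s t s'"
inductive_cases exec_WhileE: "exec Or (WhileNonempty k P) s t s'"

text \<open>\<open>accepts\<close> asks for some accepting run. Determinism identifies it with the
  run whose time and output are established below, so that rejection can be concluded as
  well.\<close>

lemma exec_deterministic:
  "exec Or P s t s' \<Longrightarrow> exec Or P s t2 s2 \<Longrightarrow> t = t2 \<and> s' = s2"
proof (induction arbitrary: t2 s2 rule: exec.induct)
  case (Seq P s t s' Q t' s'')
  from Seq.prems obtain t1 s1 t3 where "exec Or P s t1 s1" "exec Or Q s1 t3 s2" "t2 = t1 + t3"
    by (rule exec_SeqE)
  then show ?case using Seq.IH by metis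
next
  case (WhileStep s k P t s' t' s'')
  from WhileStep.prems show ?case
  proof (rule exec_WhileE)
    fix t1 s1 t3
    assume "t2 = Suc (t1 + t3)" "exec Or P s t1 s1" "exec Or (WhileNonempty k P) s1 t3 s2"
    then show ?thesis using WhileStep.IH by metis
  qed (use WhileStep.hyps in simp)
next
  case (IfEmpty s k P t s' Q R)
  from IfEmpty.prems show ?case using IfEmpty.hyps(1) by (auto elim!: exec_IfTopE dest: IfEmpty.IH)
next
  case (IfFalse s k w Q t s' P R)
  from IfFalse.prems show ?case using IfFalse.hyps(1) by (auto elim!: exec_IfTopE dest: IfFalse.IH)
next
  case (IfTrue s k w R t s' P Q)
  from IfTrue.prems show ?case using IfTrue.hyps(1) by (auto elim!: exec_IfTopE dest: IfTrue.IH)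
next
  case (WhileEnd s k P)
  from WhileEnd.prems show ?case by (rule exec_WhileE) (use WhileEnd in auto)
qed (auto elim: exec_SkipE exec_PushE exec_PopE exec_QueryE)

text \<open>Only an upper bound on the time is kept, so costs can be rounded up at every step
  instead of being computed exactly.\<close>

definition ex :: "oracle_fun \<Rightarrow> prog \<Rightarrow> (nat \<Rightarrow> word) \<Rightarrow> nat \<Rightarrow> (nat \<Rightarrow> word) \<Rightarrow> bool" where
  "ex Or P s T s' \<longleftrightarrow> (\<exists>t\<le>T. exec Or P s t s')"

abbreviation seq_prog (infixr ";;" 60) where "P ;; Q \<equiv> Seq P Q"

lemma ex_mono: "ex Or P s T s' \<Longrightarrow> T \<le> T' \<Longrightarrow> ex Or P s T' s'"
  unfolding ex_def by (meson le_trans)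

lemma ex_Skip: "1 \<le> T \<Longrightarrow> s' = s \<Longrightarrow> ex Or Skip s T s'"
  unfolding ex_def using exec.Skip by blast

lemma ex_Push: "1 \<le> T \<Longrightarrow> s' = s(k := b # s k) \<Longrightarrow> ex Or (Push k b) s T s'"
  unfolding ex_def using exec.Push by blast

lemma ex_Pop: "1 \<le> T \<Longrightarrow> s' = s(k := tl (s k)) \<Longrightarrow> ex Or (Pop k) s T s'"
  unfolding ex_def using exec.Pop by blast

lemma ex_Query: "1 \<le> T \<Longrightarrow> s' = s(b := Or (s a)) \<Longrightarrow> ex Or (Query a b) s T s'"
  unfolding ex_def using exec.Query by blast

lemma ex_Seq: "ex Or P s T s1 \<Longrightarrow> ex Or Q s1 T' s2 \<Longrightarrow> T + T' \<le> T'' \<Longrightarrow> ex Or (P ;; Q) s T'' s2"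
  unfolding ex_def by (meson add_mono exec.Seq le_trans)

lemma ex_IfTop:
  assumes "ex Or (case s k of [] \<Rightarrow> P | b # w \<Rightarrow> if b then R else Q) s T s'" "Suc T \<le> T'"
  shows "ex Or (IfTop k P Q R) s T' s'"
proof -
  from assms(1) obtain t where t: "t \<le> T"
    "exec Or (case s k of [] \<Rightarrow> P | b # w \<Rightarrow> if b then R else Q) s t s'"
    unfolding ex_def by blast
  then have "exec Or (IfTop k P Q R) s (Suc t) s'"
    by (auto split: list.splits if_splits intro: exec.intros)
  then show ?thesis unfolding ex_def using t assms(2) by (meson Suc_le_mono le_trans)
qed

lemma ex_While_end: "s k = [] \<Longrightarrow> 1 \<le> T \<Longrightarrow> ex Or (WhileNonempty k P) s T s"
  unfolding ex_def using exec.WhileEnd by blast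

lemma ex_While_step:
  assumes "s k \<noteq> []" "ex Or P s T s1" "ex Or (WhileNonempty k P) s1 T' s2" "Suc (T + T') \<le> T''"
  shows "ex Or (WhileNonempty k P) s T'' s2"
proof -
  obtain t t' where "t \<le> T" "exec Or P s t s1" "t' \<le> T'" "exec Or (WhileNonempty k P) s1 t' s2"
    using assms(2,3) unfolding ex_def by blast
  moreover from this have "exec Or (WhileNonempty k P) s (Suc (t + t')) s2"
    using assms(1) by (auto intro: exec.WhileStep)
  ultimately show ?thesis unfolding ex_def using assms(4)
    by (meson Suc_le_mono add_mono le_trans)
qed

definition drain :: "nat \<Rightarrow> prog \<Rightarrow> prog \<Rightarrow> prog" where
  "drain k P Q = WhileNonempty k (IfTop k Skip (Pop k ;; P) (Pop k ;; Q))"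

text \<open>The invariant is indexed by the word still to be consumed. Each letter costs
  \<open>T\<close> for the body and 3 more for the loop test, the branch and the pop.\<close>

lemma ex_drain:
  assumes "s k = w" "I w s"
    and step: "\<And>b w s. s k = b # w \<Longrightarrow> I (b # w) s \<Longrightarrow>
      \<exists>s'. ex Or (if b then Q else P) (s(k := w)) T s' \<and> s' k = w \<and> I w s'"
  shows "\<exists>s'. ex Or (drain k P Q) s (length w * (T + 3) + 1) s' \<and> s' k = [] \<and> I [] s'"
  using assms(1,2)
proof (induction w arbitrary: s)
  case Nil
  have "ex Or (drain k P Q) s (length [] * (T + 3) + 1) s"
    unfolding drain_def by (rule ex_While_end) (use Nil in auto)
  then show ?case using Nil by blast
next
  case (Cons b w)
  from step[OF Cons.prems] obtain s1 where
    s1: "ex Or (if b then Q else P) (s(k := w)) T s1" "s1 k = w" "I w s1" by blast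
  from Cons.IH[OF s1(2,3)] obtain s2 where
    s2: "ex Or (drain k P Q) s1 (length w * (T + 3) + 1) s2" "s2 k = []" "I [] s2" by blast
  have "ex Or (IfTop k Skip (Pop k ;; P) (Pop k ;; Q)) s (T + 2) s1"
    by (rule ex_IfTop[where T = "T + 1"])
       (use Cons.prems(1) s1(1) in \<open>auto intro!: ex_Seq[OF ex_Pop[OF order.refl refl]]\<close>)
  then have "ex Or (drain k P Q) s (length (b # w) * (T + 3) + 1) s2"
    using s2(1) Cons.prems(1) unfolding drain_def by (auto intro: ex_While_step)
  then show ?case using s2 by blast
qed

definition clear :: "nat \<Rightarrow> prog" where
  "clear k = WhileNonempty k (Pop k)"

lemma ex_clear: "ex Or (clear k) s (2 * length (s k) + 1) (s(k := []))"
proof (induction "s k" arbitrary: s)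
  case Nil
  then have "s(k := []) = s" by auto
  then show ?case using Nil unfolding clear_def by (auto intro: ex_While_end)
next
  case (Cons b w)
  let ?s = "s(k := tl (s k))"
  have "w = ?s k" using Cons(2)[symmetric] by simp
  from Cons(1)[of ?s, OF this] have "ex Or (WhileNonempty k (Pop k)) ?s (2 * length w + 1) (s(k := []))"
    using Cons(2)[symmetric] unfolding clear_def by simp
  moreover have "ex Or (Pop k) s 1 ?s" by (simp add: ex_Pop)
  ultimately show ?case using Cons(2)[symmetric] unfolding clear_def
    by (auto intro: ex_While_step)
qed

definition move :: "nat \<Rightarrow> nat \<Rightarrow> prog" where
  "move k a = drain k (Push a False) (Push a True)"

lemma ex_move:
  assumes "k \<noteq> a"
  shows "ex Or (move k a) s (4 * length (s k) + 1) (s(k := [], a := rev (s k) @ s a))"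
proof -
  have "\<exists>s'. ex Or (move k a) s (length (s k) * (1 + 3) + 1) s' \<and> s' k = [] \<and>
     (rev [] @ s' a = rev (s k) @ s a \<and> (\<forall>j. j \<noteq> k \<and> j \<noteq> a \<longrightarrow> s' j = s j))"
    unfolding move_def
    by (rule ex_drain[where I = "\<lambda>w s'. rev w @ s' a = rev (s k) @ s a \<and>
            (\<forall>j. j \<noteq> k \<and> j \<noteq> a \<longrightarrow> s' j = s j)"])
       (use assms in \<open>auto intro!: exI ex_Push\<close>)
  then obtain s' where s': "ex Or (move k a) s (length (s k) * (1 + 3) + 1) s'" "s' k = []"
    "s' a = rev (s k) @ s a" "\<forall>j. j \<noteq> k \<and> j \<noteq> a \<longrightarrow> s' j = s j" by auto
  have "s' = s(k := [], a := rev (s k) @ s a)" using s' assms by auto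
  then show ?thesis using s'(1) by (simp add: mult.commute)
qed

definition move2 :: "nat \<Rightarrow> nat \<Rightarrow> nat \<Rightarrow> prog" where
  "move2 k a b = drain k (Push a False ;; Push b False) (Push a True ;; Push b True)"

lemma ex_move2:
  assumes "k \<noteq> a" "k \<noteq> b" "a \<noteq> b"
  shows "ex Or (move2 k a b) s (5 * length (s k) + 1)
           (s(k := [], a := rev (s k) @ s a, b := rev (s k) @ s b))"
proof -
  have "\<exists>s'. ex Or (move2 k a b) s (length (s k) * (2 + 3) + 1) s' \<and> s' k = [] \<and>
     (rev [] @ s' a = rev (s k) @ s a \<and> rev [] @ s' b = rev (s k) @ s b \<and>
      (\<forall>j. j \<noteq> k \<and> j \<noteq> a \<and> j \<noteq> b \<longrightarrow> s' j = s j))"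
    unfolding move2_def
    by (rule ex_drain[where I = "\<lambda>w s'. rev w @ s' a = rev (s k) @ s a \<and>
          rev w @ s' b = rev (s k) @ s b \<and> (\<forall>j. j \<noteq> k \<and> j \<noteq> a \<and> j \<noteq> b \<longrightarrow> s' j = s j)"])
       (use assms in \<open>auto intro!: exI ex_Seq[OF ex_Push[OF order.refl refl]
          ex_Push[OF order.refl refl]]\<close>)
  then obtain s' where s': "ex Or (move2 k a b) s (length (s k) * (2 + 3) + 1) s'" "s' k = []"
    "s' a = rev (s k) @ s a" "s' b = rev (s k) @ s b"
    "\<forall>j. j \<noteq> k \<and> j \<noteq> a \<and> j \<noteq> b \<longrightarrow> s' j = s j" by auto
  have "s' = s(k := [], a := rev (s k) @ s a, b := rev (s k) @ s b)" using s' assms by auto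
  then show ?thesis using s'(1) by (simp add: mult.commute)
qed

text \<open>A move reverses the word; the second pass, from scratch stack 10, reverses it back while
  filling both the source and the target.\<close>

definition copy :: "nat \<Rightarrow> nat \<Rightarrow> prog" where
  "copy a b = move a 10 ;; move2 10 a b"

lemma ex_copy:
  assumes "s 10 = []" "a \<noteq> b" "a \<noteq> 10" "b \<noteq> 10"
  shows "ex Or (copy a b) s (9 * length (s a) + 2) (s(b := s a @ s b))"
proof -
  let ?s = "s(a := [], 10 := rev (s a) @ s 10)"
  have "ex Or (move2 10 a b) ?s (5 * length (?s 10) + 1)
           (?s(10 := [], a := rev (?s 10) @ ?s a, b := rev (?s 10) @ ?s b))"
    by (rule ex_move2) (use assms in auto)
  moreover have "?s(10 := [], a := rev (?s 10) @ ?s a, b := rev (?s 10) @ ?s b) = s(b := s a @ s b)"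
    using assms by (auto simp: fun_eq_iff)
  ultimately have "ex Or (move2 10 a b) ?s (5 * length (?s 10) + 1) (s(b := s a @ s b))" by simp
  then show ?thesis unfolding copy_def
    using assms by (auto intro: ex_Seq[OF ex_move])
qed

definition double :: "nat \<Rightarrow> prog" where
  "double k = IfTop k Skip (Push k False) (Push k False)"

lemma ex_double: "ex Or (double k) s 2 (s(k := cons_bit False (s k)))"
  unfolding double_def
  by (rule ex_IfTop[where T = 1])
     (auto simp: cons_bit_def split: list.splits intro!: ex_Skip ex_Push)

lemma ex_clearI: "s' = s(k := []) \<Longrightarrow> 2 * length (s k) + 1 \<le> T \<Longrightarrow> ex Or (clear k) s T s'"
  using ex_clear ex_mono by blast

lemma ex_moveI:
  "k \<noteq> a \<Longrightarrow> s' = s(k := [], a := rev (s k) @ s a) \<Longrightarrow> 4 * length (s k) + 1 \<le> T \<Longrightarrow>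
    ex Or (move k a) s T s'"
  using ex_move ex_mono by blast

lemma ex_copyI:
  "s 10 = [] \<Longrightarrow> a \<noteq> b \<Longrightarrow> a \<noteq> 10 \<Longrightarrow> b \<noteq> 10 \<Longrightarrow> s' = s(b := s a @ s b) \<Longrightarrow>
    9 * length (s a) + 2 \<le> T \<Longrightarrow> ex Or (copy a b) s T s'"
  using ex_copy ex_mono by blast

lemma ex_doubleI: "s' = s(k := cons_bit False (s k)) \<Longrightarrow> 2 \<le> T \<Longrightarrow> ex Or (double k) s T s'"
  using ex_double ex_mono by blast

text \<open>Without loops and oracle calls the final state is an explicit function of the initial
  one: \<open>effect\<close> is evaluated by rewriting, and \<open>cost\<close> bounds the time over
  all branches.\<close>

fun loop_free :: "prog \<Rightarrow> bool" where
  "loop_free (Seq P Q) = (loop_free P \<and> loop_free Q)"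
| "loop_free (IfTop k P Q R) = (loop_free P \<and> loop_free Q \<and> loop_free R)"
| "loop_free (WhileNonempty k P) = False"
| "loop_free (Query a b) = False"
| "loop_free _ = True"

fun cost :: "prog \<Rightarrow> nat" where
  "cost (Seq P Q) = cost P + cost Q"
| "cost (IfTop k P Q R) = Suc (max (cost P) (max (cost Q) (cost R)))"
| "cost _ = 1"

fun effect :: "prog \<Rightarrow> (nat \<Rightarrow> word) \<Rightarrow> (nat \<Rightarrow> word)" where
  "effect (Push k b) s = s(k := b # s k)"
| "effect (Pop k) s = s(k := tl (s k))"
| "effect (Seq P Q) s = effect Q (effect P s)"
| "effect (IfTop k P Q R) s = (case s k of [] \<Rightarrow> effect P s | b # w \<Rightarrow> if b then effect R s else effect Q s)"
| "effect _ s = s"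

lemma ex_effect: "loop_free P \<Longrightarrow> ex Or P s (cost P) (effect P s)"
proof (induction P arbitrary: s)
  case (Seq P Q)
  then show ?case by (auto intro: ex_Seq)
next
  case (IfTop k P Q R)
  show ?case
  proof (rule ex_IfTop)
    show "ex Or (case s k of [] \<Rightarrow> P | b # w \<Rightarrow> if b then R else Q) s
       (max (cost P) (max (cost Q) (cost R))) (effect (IfTop k P Q R) s)"
      using IfTop.prems by (auto split: list.splits intro!: IfTop.IH[THEN ex_mono])
  qed simp
qed (auto intro: ex_Skip ex_Push ex_Pop)

lemma ex_loop_free:
  "loop_free P \<Longrightarrow> cost P \<le> T \<Longrightarrow> effect P s = s' \<Longrightarrow> ex Or P s T s'"
  using ex_effect ex_mono by blast

text \<open>A flag is \<open>[True]\<close> or empty and never has \<open>False\<close> on top. Thus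
  one stack serves as loop condition and as test, and the middle branch of a test on a flag is
  unreachable.\<close>

definition flag_word :: "bool \<Rightarrow> word" where
  "flag_word b = (if b then [True] else [])"

lemma flag_word_simps [simp]: "flag_word True = [True]" "flag_word False = []"
  "flag_word b = [] \<longleftrightarrow> \<not> b" "length (flag_word b) \<le> Suc 0"
  by (auto simp: flag_word_def)

subsection \<open>Addition\<close>

text \<open>A full adder: stack 12 holds the carry as a flag, and stack 11 collects the digits of
  the sum with the most significant one on top, so that a final move restores their order.\<close>

definition bit_add :: "bool \<Rightarrow> bool \<Rightarrow> prog" where
  "bit_add a b = IfTop 12 (Push 11 (a \<noteq> b) ;; (if a \<and> b then Push 12 True else Skip)) Skip
     (Push 11 (a = b) ;; (if a \<or> b then Skip else Pop 12))"

definition digit_add :: "nat \<Rightarrow> bool \<Rightarrow> prog" where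
  "digit_add x b = IfTop x (bit_add False b) (Pop x ;; bit_add False b) (Pop x ;; bit_add True b)"

definition add_carry :: "nat \<Rightarrow> prog" where
  "add_carry x = WhileNonempty 12 (IfTop x (Push 11 True ;; Pop 12)
     (Pop x ;; Push 11 True ;; Pop 12) (Pop x ;; Push 11 False))"

definition add_to :: "nat \<Rightarrow> nat \<Rightarrow> prog" where
  "add_to x y = drain y (digit_add x False) (digit_add x True) ;; add_carry x ;; move 11 x"

lemma loop_free_digit_add [simp]: "loop_free (digit_add x b)" "cost (digit_add x b) \<le> 5"
  by (auto simp: digit_add_def bit_add_def)

lemma ex_add_carry:
  assumes "s 12 = flag_word c" "x \<noteq> 11" "x \<noteq> 12"
  shows "\<exists>s'. ex Or (add_carry x) s (5 * length (s x) + 6) s' \<and> s' 12 = [] \<and>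
     rev (s' 11) @ s' x = rev (s 11) @ inc_word c (s x) \<and> (\<forall>j. j \<notin> {x, 11, 12} \<longrightarrow> s' j = s j)"
  using assms(1)
proof (induction "s x" arbitrary: s c)
  case Nil
  show ?case
  proof (cases c)
    case True
    let ?s = "s(11 := True # s 11, 12 := [])"
    have "ex Or (add_carry x) s (5 * length (s x) + 6) ?s" unfolding add_carry_def
      by (rule ex_While_step[where T = 4 and T' = 1 and ?s1.0 = ?s, OF _ ex_loop_free ex_While_end])
         (use Nil assms True in auto)
    then show ?thesis
      by (rule exI[of _ ?s, OF conjI]) (use Nil.hyps[symmetric] True assms in auto)
  next
    case False
    have "ex Or (add_carry x) s (5 * length (s x) + 6) s" unfolding add_carry_def
      by (rule ex_While_end) (use Nil False in auto)
    then show ?thesis using Nil False by auto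
  qed
next
  case (Cons a w)
  show ?case
  proof (cases c)
    case True
    show ?thesis
    proof (cases a)
      case False
      let ?s = "s(x := w, 11 := True # s 11, 12 := [])"
      have "ex Or (add_carry x) s (5 * length (s x) + 6) ?s" unfolding add_carry_def
        by (rule ex_While_step[where T = 4 and T' = 1 and ?s1.0 = ?s, OF _ ex_loop_free ex_While_end])
           (use Cons.prems Cons.hyps(2)[symmetric] assms True False in auto)
      then show ?thesis using Cons.hyps(2)[symmetric] True False assms
        by (intro exI[of _ ?s]) auto
    next
      case a: True
      let ?s = "s(x := w, 11 := False # s 11)"
      have "w = ?s x" "?s 12 = flag_word True" using assms Cons.prems True by auto
      from Cons.hyps(1)[of ?s, OF this] obtain s' where
        s': "ex Or (add_carry x) ?s (5 * length (?s x) + 6) s'" "s' 12 = []"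
          "rev (s' 11) @ s' x = rev (?s 11) @ inc_word True (?s x)"
          "\<forall>j. j \<notin> {x, 11, 12} \<longrightarrow> s' j = ?s j" by blast
      have "ex Or (add_carry x) s (5 * length (s x) + 6) s'" unfolding add_carry_def
        by (rule ex_While_step[where T = 4 and ?s1.0 = ?s, OF _ ex_loop_free
              s'(1)[unfolded add_carry_def]])
           (use Cons.prems Cons.hyps(2)[symmetric] assms True a in auto)
      then show ?thesis using s' Cons.hyps(2)[symmetric] assms True a
        by (intro exI[of _ s']) auto
    qed
  next
    case False
    have "ex Or (add_carry x) s (5 * length (s x) + 6) s" unfolding add_carry_def
      by (rule ex_While_end) (use Cons.prems False in auto)
    then show ?thesis using Cons.prems False by auto
  qed
qed

lemma length_inc_word: "length x \<le> length (inc_word c x)"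
  by (induction c x rule: inc_word.induct) auto

lemma ex_add_to:
  assumes "s x = bits m" "s y = bits n" "s 11 = []" "s 12 = []" "x \<notin> {11, 12}" "y \<notin> {11, 12}"
    "x \<noteq> y" "m + n < 2 ^ B"
  shows "ex Or (add_to x y) s (17 * B + 8) (s(x := bits (m + n), y := []))"
proof -
  let ?res = "bits (m + n)"
  \<comment> \<open>The digits already produced, followed by the sum of what is left, always form
    the final result.\<close>
  let ?I = "\<lambda>w s'. \<exists>c. s' 12 = flag_word c \<and> rev (s' 11) @ add_word c (s' x) w = ?res \<and>
     (\<forall>j. j \<notin> {x, y, 11, 12} \<longrightarrow> s' j = s j)"
  have "\<exists>s'. ex Or (drain y (digit_add x False) (digit_add x True)) s (length (s y) * (5 + 3) + 1) s'
    \<and> s' y = [] \<and> ?I [] s'"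
  proof (rule ex_drain[where I = ?I])
    show "?I (s y) s" using assms add_word_bits[of False m n]
      by (intro exI[of _ False]) auto
  next
    fix b w s1
    assume s1: "s1 y = b # w" and "?I (b # w) s1"
    then obtain c where c: "s1 12 = flag_word c" "rev (s1 11) @ add_word c (s1 x) (b # w) = ?res"
      "\<forall>j. j \<notin> {x, y, 11, 12} \<longrightarrow> s1 j = s j" by blast
    let ?s = "effect (digit_add x b) (s1(y := w))"
    let ?a = "s1 x \<noteq> [] \<and> hd (s1 x)"
    let ?c = "?a \<and> b \<or> ?a \<and> c \<or> b \<and> c"
    have s: "?s = s1(y := w, x := tl (s1 x), 11 := ((?a \<noteq> b) \<noteq> c) # s1 11, 12 := flag_word ?c)"
      using assms c(1) by (cases c; cases b; cases "s1 x")
        (auto simp: digit_add_def bit_add_def fun_eq_iff)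
    have "?I w ?s"
    proof (intro exI[of _ ?c] conjI)
      show "rev (?s 11) @ add_word ?c (?s x) w = ?res"
        using c(2) assms unfolding s by (cases "s1 x") auto
    qed (use c assms in \<open>auto simp: s\<close>)
    moreover have "?s y = w" unfolding s using assms(6,7) by auto
    moreover have "ex Or (if b then digit_add x True else digit_add x False) (s1(y := w)) 5 ?s"
      by (rule ex_loop_free) auto
    ultimately show "\<exists>s'. ex Or (if b then digit_add x True else digit_add x False) (s1(y := w)) 5 s' \<and>
        s' y = w \<and> ?I w s'" by blast
  qed simp
  then obtain s1 c where s1:
    "ex Or (drain y (digit_add x False) (digit_add x True)) s (length (s y) * (5 + 3) + 1) s1"
    "s1 y = []" "s1 12 = flag_word c" "rev (s1 11) @ inc_word c (s1 x) = ?res"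
    "\<forall>j. j \<notin> {x, y, 11, 12} \<longrightarrow> s1 j = s j" unfolding add_word.simps by blast
  obtain s2 where s2: "ex Or (add_carry x) s1 (5 * length (s1 x) + 6) s2" "s2 12 = []"
     "rev (s2 11) @ s2 x = ?res" "\<forall>j. j \<notin> {x, 11, 12} \<longrightarrow> s2 j = s1 j"
    using ex_add_carry[of s1 c x Or] s1(3,4) assms(5) by auto
  \<comment> \<open>Both intermediate words are contained in the final result, up to
    \<open>inc_word\<close>, which never shortens; so the length of the result bounds the remaining
    costs.\<close>
  have "length (rev (s1 11) @ inc_word c (s1 x)) \<le> B" "length (rev (s2 11) @ s2 x) \<le> B"
    unfolding s1(4) s2(3) by (rule length_bits_le[OF assms(8)])+
  then have len: "length (s1 x) \<le> B" "length (s2 11) \<le> B"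
    using length_inc_word[of "s1 x" c] by auto
  have ly: "length (s y) \<le> B" using length_bits_le[of n B] assms by simp
  have eq: "s(x := ?res, y := []) = s2(11 := [], x := rev (s2 11) @ s2 x)"
  proof
    fix j
    have "s2 y = []" using s2(4) s1(2) assms(6,7) by simp
    moreover have "j \<notin> {x, y, 11, 12} \<Longrightarrow> s2 j = s j" using s2(4) s1(5) by simp
    ultimately show "(s(x := ?res, y := [])) j = (s2(11 := [], x := rev (s2 11) @ s2 x)) j"
      using s2(2,3) assms(3-7) by (cases "j \<in> {x, y, 11, 12}") auto
  qed
  have m: "ex Or (move 11 x) s2 (4 * length (s2 11) + 1) (s(x := ?res, y := []))"
    by (rule ex_moveI[where s = s2 and k = 11 and a = x, OF _ eq]) (use assms(5) in auto)
  show ?thesis unfolding add_to_def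
    by (rule ex_Seq[OF s1(1) ex_Seq[OF s2(1) m order.refl]]) (use len ly in simp)
qed

subsection \<open>Multiplication\<close>

text \<open>Shift and add: the multiplier on stack 14 is consumed while the multiplicand on stack 13
  is doubled. Accumulating into \<open>a\<close> makes one instruction sufficient: with a factor 1
  it adds, and into a cleared register it copies.\<close>

definition mul_add :: "nat \<Rightarrow> nat \<Rightarrow> nat \<Rightarrow> prog" where
  "mul_add a x w = copy x 13 ;; copy w 14 ;;
     drain 14 (double 13) (copy 13 15 ;; add_to a 15 ;; double 13) ;; clear 13"

lemma ex_mul_add:
  assumes "s a = bits m" "s x = bits n" "s w = bits k" "\<forall>j\<in>{10..<20}. s j = []"
    "a \<ge> 20" "x \<ge> 20" "w \<ge> 20" "a \<noteq> x" "a \<noteq> w" "m + n * k < 2 ^ B" "n < 2 ^ B" "k < 2 ^ B"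
  shows "ex Or (mul_add a x w) s (100 * (B + 1) ^ 2) (s(a := bits (m + n * k)))"
proof -
  have temps: "s 10 = []" "s 11 = []" "s 12 = []" "s 13 = []" "s 14 = []" "s 15 = []"
    using assms(4) by auto
  have lens: "length (bits n) \<le> B" "length (bits k) \<le> B"
    using assms length_bits_le by auto
  let ?s1 = "s(13 := bits n)"
  have e1: "ex Or (copy x 13) s (9 * B + 2) ?s1"
    by (rule ex_copyI) (use assms(2,6) temps lens in auto)
  let ?s2 = "?s1(14 := bits k)"
  have e2: "ex Or (copy w 14) ?s1 (9 * B + 2) ?s2"
    by (rule ex_copyI) (use assms(3,7) temps lens in auto)
  \<comment> \<open>The doubled multiplicand may outgrow \<open>B\<close> digits. But a doubling
    adds at most one digit while one digit of the multiplier disappears, so the two lengths together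
    stay at most \<open>2 * B\<close>.\<close>
  let ?I = "\<lambda>v s'. \<exists>m' n' k'. v = bits k' \<and> s' 13 = bits n' \<and> s' a = bits m' \<and>
    m' + n' * k' = m + n * k \<and> length (bits n') + length v \<le> 2 * B \<and>
    (\<forall>j. j \<notin> {13, 14, a} \<longrightarrow> s' j = s j)"
  have "\<exists>s'. ex Or (drain 14 (double 13) (copy 13 15 ;; add_to a 15 ;; double 13)) ?s2
      (length (bits k) * ((26 * B + 12) + 3) + 1) s' \<and> s' 14 = [] \<and> ?I [] s'"
  proof (rule ex_drain[where I = ?I])
    show "?I (bits k) ?s2"
      by (rule exI[of _ m], rule exI[of _ n], rule exI[of _ k]) (use assms lens in auto)
  next
    fix b v s1
    assume s1: "s1 14 = b # v" and "?I (b # v) s1"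
    then obtain m' n' k' where I: "b # v = bits k'" "s1 13 = bits n'" "s1 a = bits m'"
      "m' + n' * k' = m + n * k" "length (bits n') + length (b # v) \<le> 2 * B"
      "\<forall>j. j \<notin> {13, 14, a} \<longrightarrow> s1 j = s j" by blast
    have "k' \<noteq> 0" using I(1) by (cases "k' = 0") auto
    then have k': "b = odd k'" "v = bits (k' div 2)" using I(1) by (simp_all add: bits_pos)
    have dbl: "cons_bit False (bits n') = bits (2 * n')" using cons_bit_bits[of False n'] by simp
    have ln: "length (bits (2 * n')) \<le> Suc (length (bits n'))"
      unfolding dbl[symmetric] by (simp add: cons_bit_def)
    define m'' where "m'' = (if b then m' + n' else m')"
    let ?s = "s1(14 := v, a := bits m'', 13 := bits (2 * n'))"
    have "ex Or (if b then copy 13 15 ;; add_to a 15 ;; double 13 else double 13) (s1(14 := v)) (26 * B + 12) ?s"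
    proof (cases b)
      case False
      have "?s = (s1(14 := v))(13 := cons_bit False ((s1(14 := v)) 13))"
        using I(2,3) dbl assms(5) False by (intro ext) (simp add: m''_def)
      then have "ex Or (double 13) (s1(14 := v)) (26 * B + 12) ?s"
        by (rule ex_doubleI[where s = "s1(14 := v)" and k = 13]) simp
      then show ?thesis using False by simp
    next
      case True
      \<comment> \<open>The rest \<open>k'\<close> of the multiplier is positive, so the invariant
        bounds \<open>m' + n'\<close> by the final value and the addition stays within
        \<open>B\<close> digits.\<close>
      have small: "m' + n' < 2 ^ B"
      proof -
        have "n' \<le> n' * k'" using \<open>k' \<noteq> 0\<close> by simp
        then show ?thesis using I(4) assms(10) by linarith
      qed
      then have ln': "length (bits n') \<le> B" by (intro length_bits_le) simp
      let ?t = "s1(14 := v)"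
      let ?t1 = "?t(15 := bits n')"
      let ?t2 = "s1(14 := v, a := bits (m' + n'))"
      have c1: "ex Or (copy 13 15) ?t (9 * B + 2) ?t1"
        by (rule ex_copyI) (use I(2,6) assms(5) temps ln' in auto)
      have t2: "?t1(a := bits (m' + n'), 15 := []) = ?t2"
        using I(6) temps assms(5) by (intro ext) simp
      have c2: "ex Or (add_to a 15) ?t1 (17 * B + 8) ?t2"
        unfolding t2[symmetric] by (rule ex_add_to) (use I(3,6) assms(5) temps small in auto)
      have c3: "ex Or (double 13) ?t2 2 ?s"
        by (rule ex_doubleI) (use I(2) dbl True assms(5) in \<open>auto simp: m''_def\<close>)
      have "ex Or (copy 13 15 ;; add_to a 15 ;; double 13) ?t (26 * B + 12) ?s"
        by (rule ex_Seq[OF c1 ex_Seq[OF c2 c3 order.refl]]) simp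
      then show ?thesis using True by simp
    qed
    moreover have "?I v ?s"
    proof (rule exI[of _ m''], rule exI[of _ "2 * n'"], rule exI[of _ "k' div 2"], intro conjI)
      show "m'' + 2 * n' * (k' div 2) = m + n * k"
      proof (cases b)
        case True
        then have "2 * n' * (k' div 2) + n' = n' * k'"
          using k' by (metis add_mult_distrib2 mult.assoc mult.commute mult_1_right odd_two_times_div_two_succ)
        moreover have "m'' = m' + n'" using True by (simp add: m''_def)
        ultimately show ?thesis using I(4) by linarith
      next
        case False
        then have "2 * n' * (k' div 2) = n' * k'"
          using k' by (metis mult.assoc mult.commute even_two_times_div_two)
        moreover have "m'' = m'" using False by (simp add: m''_def)
        ultimately show ?thesis using I(4) by linarith
      qed
      show "length (bits (2 * n')) + length v \<le> 2 * B" using I(5) ln by simp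
    qed (use I k' assms(5) in auto)
    moreover have "?s 14 = v" using assms by auto
    ultimately show "\<exists>s'. ex Or (if b then copy 13 15 ;; add_to a 15 ;; double 13 else double 13)
      (s1(14 := v)) (26 * B + 12) s' \<and> s' 14 = v \<and> ?I v s'" by blast
  qed simp
  then obtain s3 m' n' where s3: "ex Or (drain 14 (double 13) (copy 13 15 ;; add_to a 15 ;; double 13)) ?s2
      (length (bits k) * ((26 * B + 12) + 3) + 1) s3" "s3 14 = []" "s3 13 = bits n'"
      "s3 a = bits (m + n * k)" "length (bits n') \<le> 2 * B" "\<forall>j. j \<notin> {13, 14, a} \<longrightarrow> s3 j = s j"
    by (metis (no_types, lifting) add_leD1 add.right_neutral bits_eq_Nil_iff mult_0_right)
  have eq: "s(a := bits (m + n * k)) = s3(13 := [])"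
  proof
    fix j
    show "(s(a := bits (m + n * k))) j = (s3(13 := [])) j"
      using s3(2,4,6) temps assms(5) by (cases "j = 14") auto
  qed
  have e4: "ex Or (clear 13) s3 (4 * B + 1) (s(a := bits (m + n * k)))"
    by (rule ex_clearI[where s = s3 and k = 13, OF eq]) (use s3(3,5) in auto)
  have "length (bits k) * (26 * B + 12 + 3) \<le> B * (26 * B + 12 + 3)"
    using lens(2) by (rule mult_right_mono) simp
  then have "9 * B + 2 + (9 * B + 2 + (length (bits k) * (26 * B + 12 + 3) + 1 + (4 * B + 1)))
      \<le> B * (26 * B + 12 + 3) + 22 * B + 6" by linarith
  also have "\<dots> \<le> 100 * (B + 1) ^ 2" by (simp add: power2_eq_square algebra_simps)
  finally show ?thesis unfolding mul_add_def
    by (rule ex_Seq[OF e1 ex_Seq[OF e2 ex_Seq[OF s3(1) e4 order.refl] order.refl]])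
qed

subsection \<open>Comparison\<close>

definition set_flag :: "nat \<Rightarrow> prog" where
  "set_flag f = IfTop f (Push f True) Skip Skip"

lemma set_flag_simps [simp]:
  "loop_free (set_flag f)" "cost (set_flag f) = 2"
  "s f = flag_word c \<Longrightarrow> effect (set_flag f) s = s(f := [True])"
  by (cases c; auto simp: set_flag_def fun_eq_iff)+

definition compare_bits :: "bool \<Rightarrow> bool \<Rightarrow> prog" where
  "compare_bits a b = (if a = b then Skip else if a then set_flag 12 else Pop 12)"

definition compare_digit :: "bool \<Rightarrow> prog" where
  "compare_digit a = IfTop 14 (compare_bits a False) (Pop 14 ;; compare_bits a False)
     (Pop 14 ;; compare_bits a True)"

text \<open>Letters left on stack 14 mean that the second number is longer, which cancels a verdict
  \<open>greater\<close> on stack 12. The flag \<open>f\<close> is only ever raised, so a sequence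
  of tests collects the disjunction of their outcomes and a single flag can record every
  failure.\<close>

definition compare :: "nat \<Rightarrow> nat \<Rightarrow> nat \<Rightarrow> prog" where
  "compare x y f = copy x 13 ;; copy y 14 ;; drain 13 (compare_digit False) (compare_digit True) ;;
     IfTop 14 Skip (Pop 12) (Pop 12) ;; clear 14 ;; IfTop 12 Skip Skip (Pop 12 ;; set_flag f)"

lemma compare_digit_simps [simp]: "loop_free (compare_digit a)" "cost (compare_digit a) \<le> 4"
  by (auto simp: compare_digit_def compare_bits_def)

lemma effect_compare_digit:
  assumes "s 12 = flag_word g"
  shows "effect (compare_digit a) s = s(14 := tl (s 14), 12 := flag_word
     (if a = (s 14 \<noteq> [] \<and> hd (s 14)) then g else a))"
  using assms by (cases g; cases a; cases "s 14")
    (auto simp: compare_digit_def compare_bits_def set_flag_def fun_eq_iff)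

lemma ex_compare:
  assumes "s x = bits m" "s y = bits n" "s f = flag_word c" "\<forall>j\<in>{10..<20}. s j = []"
    "x \<ge> 20" "y \<ge> 20" "f \<ge> 20" "m < 2 ^ B" "n < 2 ^ B"
  shows "ex Or (compare x y f) s (100 * (B + 1) ^ 2) (s(f := flag_word (c \<or> n < m)))"
proof -
  have temps: "s 10 = []" "s 12 = []" "s 13 = []" "s 14 = []"
    using assms(4) by auto
  have lens: "length (bits m) \<le> B" "length (bits n) \<le> B"
    using assms length_bits_le by auto
  let ?s1 = "s(13 := bits m)"
  have e1: "ex Or (copy x 13) s (9 * B + 2) ?s1"
    by (rule ex_copyI) (use assms(1,5) temps lens in auto)
  let ?s2 = "?s1(14 := bits n)"
  have e2: "ex Or (copy y 14) ?s1 (9 * B + 2) ?s2"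
    by (rule ex_copyI) (use assms(2,6) temps lens in auto)
  let ?I = "\<lambda>w s'. \<exists>g. s' 12 = flag_word g \<and> greater_word g w (s' 14) = (n < m) \<and>
     length (s' 14) \<le> B \<and> (\<forall>j. j \<notin> {12, 13, 14} \<longrightarrow> s' j = s j)"
  have "\<exists>s'. ex Or (drain 13 (compare_digit False) (compare_digit True)) ?s2
      (length (bits m) * (4 + 3) + 1) s' \<and> s' 13 = [] \<and> ?I [] s'"
  proof (rule ex_drain[where I = ?I])
    show "?I (bits m) ?s2"
      by (rule exI[of _ False]) (use temps lens greater_word_bits[of False m n] in auto)
  next
    fix b w s1
    assume s1: "s1 13 = b # w" and "?I (b # w) s1"
    then obtain g where g: "s1 12 = flag_word g" "greater_word g (b # w) (s1 14) = (n < m)"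
      "length (s1 14) \<le> B" "\<forall>j. j \<notin> {12, 13, 14} \<longrightarrow> s1 j = s j" by blast
    let ?g = "if b = (s1 14 \<noteq> [] \<and> hd (s1 14)) then g else b"
    let ?s = "s1(13 := w, 14 := tl (s1 14), 12 := flag_word ?g)"
    have "ex Or (if b then compare_digit True else compare_digit False) (s1(13 := w)) 4 ?s"
      by (rule ex_loop_free) (use g(1) in \<open>auto simp: effect_compare_digit[of _ g]\<close>)
    moreover have "?I w ?s"
    proof (rule exI[of _ ?g], intro conjI)
      show "greater_word ?g w (?s 14) = (n < m)"
        using g(2) by (cases "s1 14"; cases b) auto
    qed (use g in auto)
    ultimately show "\<exists>s'. ex Or (if b then compare_digit True else compare_digit False) (s1(13 := w)) 4 s' \<and>
        s' 13 = w \<and> ?I w s'" by (intro exI[of _ ?s]) simp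
  qed simp
  then obtain s3 g where s3: "ex Or (drain 13 (compare_digit False) (compare_digit True)) ?s2
      (length (bits m) * (4 + 3) + 1) s3" "s3 13 = []" "s3 12 = flag_word g"
      "(g \<and> s3 14 = []) = (n < m)" "length (s3 14) \<le> B" "\<forall>j. j \<notin> {12, 13, 14} \<longrightarrow> s3 j = s j"
    unfolding greater_word.simps by blast
  let ?s4 = "s3(12 := flag_word (n < m))"
  have e4: "ex Or (IfTop 14 Skip (Pop 12) (Pop 12)) s3 2 ?s4"
    by (rule ex_loop_free) (use s3(3,4) in \<open>auto split: list.splits simp: fun_eq_iff flag_word_def\<close>)
  let ?s5 = "?s4(14 := [])"
  have e5: "ex Or (clear 14) ?s4 (2 * B + 1) ?s5"
    by (rule ex_clearI) (use s3(5) in auto)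
  have s3f: "s3 f = flag_word c" using s3(6) assms(3,7) by simp
  have eq: "s(f := flag_word (c \<or> n < m)) = ?s5(12 := [], f := flag_word (c \<or> n < m))"
  proof
    fix j
    show "(s(f := flag_word (c \<or> n < m))) j = (?s5(12 := [], f := flag_word (c \<or> n < m))) j"
      using temps s3(2,6) assms(7) by (cases "j \<in> {12, 13, 14}") auto
  qed
  have e6: "ex Or (IfTop 12 Skip Skip (Pop 12 ;; set_flag f)) ?s5 4 (s(f := flag_word (c \<or> n < m)))"
    unfolding eq by (rule ex_loop_free, simp, simp, cases "n < m")
      (use s3f assms(7) in \<open>auto simp: fun_eq_iff\<close>)
  have "9 * B + 2 + (9 * B + 2 + (length (bits m) * (4 + 3) + 1 + (2 + (2 * B + 1 + 4))))
     \<le> 27 * B + 12" using lens(1) by simp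
  also have "\<dots> \<le> 100 * (B + 1) ^ 2" by (simp add: power2_eq_square)
  finally show ?thesis unfolding compare_def
    by (rule ex_Seq[OF e1 ex_Seq[OF e2 ex_Seq[OF s3(1) ex_Seq[OF e4 ex_Seq[OF e5 e6 order.refl] order.refl] order.refl] order.refl]])
qed

subsection \<open>Reading self-delimiting numbers\<close>

text \<open>Outputs and certificates are arbitrary guessed words, so reading is total: a malformed
  word still yields digits and a rest, and \<open>rd_end\<close> tells whether the end marker was
  found.\<close>

fun rd_digits :: "word \<Rightarrow> word" where
  "rd_digits (True # b # w) = b # rd_digits w"
| "rd_digits (False # w) = []"
| "rd_digits [] = []"
| "rd_digits [True] = []"

fun rd_rest :: "word \<Rightarrow> word" where
  "rd_rest (True # b # w) = rd_rest w"
| "rd_rest (False # w) = w"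
| "rd_rest _ = []"

fun rd_end :: "word \<Rightarrow> bool" where
  "rd_end (True # b # w) = rd_end w"
| "rd_end (False # w) = True"
| "rd_end _ = False"

definition rd_ok :: "word \<Rightarrow> bool" where
  "rd_ok w \<longleftrightarrow> rd_end w \<and> (rd_digits w = [] \<or> last (rd_digits w))"

text \<open>A digit string with a leading zero is replaced by 0, so that number registers contain
  canonical words even after a failed read.\<close>

definition rd_nat :: "word \<Rightarrow> nat" where
  "rd_nat w = (if rd_digits w = [] \<or> last (rd_digits w) then THE n. rd_digits w = bits n else 0)"

lemma bits_rd_nat:
  "bits (rd_nat w) = (if rd_digits w = [] \<or> last (rd_digits w) then rd_digits w else [])"
proof (cases "rd_digits w = [] \<or> last (rd_digits w)")
  case True
  then obtain n where "rd_digits w = bits n" using canonical_is_bits by blast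
  then show ?thesis using True by (simp add: rd_nat_def)
qed (simp add: rd_nat_def)

lemma length_rd_digits: "length (rd_digits w) \<le> length w"
  by (induction w rule: rd_digits.induct) auto

lemma length_rd_rest: "length (rd_rest w) \<le> length w"
  by (induction w rule: rd_rest.induct) auto

lemma rd_nat_less: "rd_nat w < 2 ^ length w"
proof -
  have "length (bits (rd_nat w)) \<le> length w"
    using length_rd_digits[of w] by (simp add: bits_rd_nat)
  then have "(2::nat) ^ length (bits (rd_nat w)) \<le> 2 ^ length w" by simp
  then show ?thesis using less_power_length_bits[of "rd_nat w"] by linarith
qed

lemma rd_code_aux: "rd_digits (concat (map (\<lambda>b. [True, b]) v) @ False # w) = v"
  "rd_rest (concat (map (\<lambda>b. [True, b]) v) @ False # w) = w"
  "rd_end (concat (map (\<lambda>b. [True, b]) v) @ False # w)"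
  by (induction v) auto

lemma rd_nat_code [simp]: "rd_nat (nat_code n @ w) = n" "rd_rest (nat_code n @ w) = w"
  "rd_ok (nat_code n @ w)"
proof -
  have *: "rd_digits (nat_code n @ w) = bits n" "rd_end (nat_code n @ w)"
    "rd_rest (nat_code n @ w) = w"
    by (simp_all add: nat_code_def rd_code_aux)
  have l: "bits n = [] \<or> last (bits n)" using last_bits by (cases "n = 0") auto
  have "bits (rd_nat (nat_code n @ w)) = bits n" using l by (simp add: bits_rd_nat *)
  then show "rd_nat (nat_code n @ w) = n" by simp
  show "rd_rest (nat_code n @ w) = w" "rd_ok (nat_code n @ w)" using * l by (auto simp: rd_ok_def)
qed

text \<open>The converse of reading back a code: a successful read fixes the letters consumed. This
  forces an accepted output into the prescribed format.\<close>

lemma rd_ok_decomp: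
  assumes "rd_ok w"
  shows "w = nat_code (rd_nat w) @ rd_rest w"
proof -
  have "rd_end w \<Longrightarrow> w = concat (map (\<lambda>b. [True, b]) (rd_digits w)) @ False # rd_rest w"
    by (induction w rule: rd_end.induct) auto
  then show ?thesis using assms by (simp add: nat_code_def bits_rd_nat rd_ok_def)
qed

text \<open>Stack 12 is the loop flag: it is cleared on entry and raised again only after a complete
  pair of marker and digit.\<close>

definition read_body :: "nat \<Rightarrow> nat \<Rightarrow> prog" where
  "read_body st f = Pop 12 ;; IfTop st (set_flag f) (Pop st)
     (Pop st ;; IfTop st (set_flag f) (Pop st ;; Push 11 False ;; Push 12 True)
        (Pop st ;; Push 11 True ;; Push 12 True))"

text \<open>After the loop the most significant digit is on top of stack 11, so a
  \<open>False\<close> there betrays a leading zero: the flag is raised and the digits are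
  discarded.\<close>

definition read_nat :: "nat \<Rightarrow> nat \<Rightarrow> nat \<Rightarrow> prog" where
  "read_nat st x f = clear x ;; Push 12 True ;; WhileNonempty 12 (read_body st f) ;;
     IfTop 11 Skip (set_flag f) Skip ;; IfTop 11 Skip (clear 11) Skip ;; move 11 x"

lemma ex_read_loop:
  assumes "s 12 = [True]" "s f = flag_word c" "st < 8" "f \<ge> 20"
  shows "ex Or (WhileNonempty 12 (read_body st f)) s (8 * length (s st) + 10)
    (s(12 := [], 11 := rev (rd_digits (s st)) @ s 11, st := rd_rest (s st), f := flag_word (c \<or> \<not> rd_end (s st))))"
  using assms(1,2)
proof (induction "s st" arbitrary: s rule: rd_digits.induct)
  case (1 b w)
  let ?s = "s(st := w, 11 := b # s 11)"
  have st: "s st = True # b # w" using 1(2) by simp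
  have "ex Or (WhileNonempty 12 (read_body st f)) ?s (8 * length (?s st) + 10)
    (?s(12 := [], 11 := rev (rd_digits (?s st)) @ ?s 11, st := rd_rest (?s st), f := flag_word (c \<or> \<not> rd_end (?s st))))"
    by (rule 1(1)) (use 1(3,4) assms(3,4) in auto)
  also have "?s(12 := [], 11 := rev (rd_digits (?s st)) @ ?s 11, st := rd_rest (?s st), f := flag_word (c \<or> \<not> rd_end (?s st)))
     = s(12 := [], 11 := rev (rd_digits (s st)) @ s 11, st := rd_rest (s st), f := flag_word (c \<or> \<not> rd_end (s st)))"
    using assms(3,4) st by (intro ext) simp
  finally have w: "ex Or (WhileNonempty 12 (read_body st f)) ?s (8 * length w + 10)
    (s(12 := [], 11 := rev (rd_digits (s st)) @ s 11, st := rd_rest (s st), f := flag_word (c \<or> \<not> rd_end (s st))))"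
    by (rule ex_mono) (use assms(3) in simp)
  have b: "ex Or (read_body st f) s 8 ?s"
    by (rule ex_loop_free) (use 1(3,4) assms(3,4) st in \<open>auto simp: read_body_def fun_eq_iff\<close>)
  show ?case
    by (rule ex_While_step[OF _ b w]) (use 1(3) st in auto)
next
  case ("2" w s)
  let ?s = "s(12 := [], st := w)"
  have st: "s st = False # w" using "2"(1) by simp
  have b: "ex Or (read_body st f) s 8 ?s"
    by (rule ex_loop_free) (use "2"(2,3) st assms(3,4) in \<open>auto simp: read_body_def\<close>)
  have w: "ex Or (WhileNonempty 12 (read_body st f)) ?s 1 ?s"
    by (rule ex_While_end) (use assms in auto)
  have eq: "(s(12 := [], 11 := rev (rd_digits (s st)) @ s 11, st := rd_rest (s st), f := flag_word (c \<or> \<not> rd_end (s st)))) = ?s"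
    unfolding st using "2"(2,3) st assms(3,4) by (intro ext) simp
  show ?case unfolding eq by (rule ex_While_step[OF _ b w]) (use "2"(2) in auto)
next
  case ("3" s)
  let ?s = "s(12 := [], f := [True])"
  have st: "s st = []" using "3"(1) by simp
  have b: "ex Or (read_body st f) s 8 ?s"
    by (rule ex_loop_free) (use "3"(2,3) st assms(3,4) in \<open>auto simp: read_body_def\<close>)
  have w: "ex Or (WhileNonempty 12 (read_body st f)) ?s 1 ?s"
    by (rule ex_While_end) (use assms in auto)
  have eq: "(s(12 := [], 11 := rev (rd_digits (s st)) @ s 11, st := rd_rest (s st), f := flag_word (c \<or> \<not> rd_end (s st)))) = ?s"
    unfolding st using st assms(3,4) by (intro ext) simp
  show ?case unfolding eq by (rule ex_While_step[OF _ b w]) (use "3"(2) in auto)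
next
  case ("4" s)
  let ?s = "s(12 := [], st := [], f := [True])"
  have st: "s st = [True]" using "4"(1) by simp
  have b: "ex Or (read_body st f) s 8 ?s"
    by (rule ex_loop_free) (use "4"(2,3) st assms(3,4) in \<open>auto simp: read_body_def\<close>)
  have w: "ex Or (WhileNonempty 12 (read_body st f)) ?s 1 ?s"
    by (rule ex_While_end) (use assms in auto)
  have eq: "(s(12 := [], 11 := rev (rd_digits (s st)) @ s 11, st := rd_rest (s st), f := flag_word (c \<or> \<not> rd_end (s st)))) = ?s"
    unfolding st using "4"(2,3) st assms(3,4) by (intro ext) simp
  show ?case unfolding eq by (rule ex_While_step[OF _ b w]) (use "4"(2) in auto)
qed

lemma ex_read_nat:
  assumes "s f = flag_word c" "\<forall>j\<in>{10..<20}. s j = []"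
    "st < 8" "x \<ge> 20" "f \<ge> 20" "x \<noteq> f" "length (s x) \<le> B" "length (s st) \<le> B"
  shows "ex Or (read_nat st x f) s (100 * (B + 1) ^ 2)
    (s(x := bits (rd_nat (s st)), st := rd_rest (s st), f := flag_word (c \<or> \<not> rd_ok (s st))))"
proof -
  define w where "w = s st"
  have temps: "s 11 = []" "s 12 = []" using assms(2) by auto
  let ?s1 = "s(x := [])"
  have e1: "ex Or (clear x) s (2 * B + 1) ?s1"
    by (rule ex_clearI) (use assms(7) in auto)
  let ?s2 = "?s1(12 := [True])"
  have e2: "ex Or (Push 12 True) ?s1 1 ?s2"
    by (rule ex_loop_free) (use temps assms(4) in auto)
  let ?s3 = "s(x := [], 11 := rev (rd_digits w), st := rd_rest w, f := flag_word (c \<or> \<not> rd_end w))"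
  have "ex Or (WhileNonempty 12 (read_body st f)) ?s2 (8 * length (?s2 st) + 10)
    (?s2(12 := [], 11 := rev (rd_digits (?s2 st)) @ ?s2 11, st := rd_rest (?s2 st), f := flag_word (c \<or> \<not> rd_end (?s2 st))))"
    by (rule ex_read_loop) (use assms in auto)
  also have "?s2(12 := [], 11 := rev (rd_digits (?s2 st)) @ ?s2 11, st := rd_rest (?s2 st), f := flag_word (c \<or> \<not> rd_end (?s2 st))) = ?s3"
    using temps assms(3-6) by (intro ext) (simp add: w_def)
  finally have e3: "ex Or (WhileNonempty 12 (read_body st f)) ?s2 (8 * B + 10) ?s3"
    by (rule ex_mono) (use assms(3,4,8) in auto)
  let ?can = "rd_digits w = [] \<or> last (rd_digits w)"
  let ?s4 = "?s3(f := flag_word (c \<or> \<not> rd_ok w))"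
  have e4: "ex Or (IfTop 11 Skip (set_flag f) Skip) ?s3 3 ?s4"
  proof (rule ex_loop_free)
    show "effect (IfTop 11 Skip (set_flag f) Skip) ?s3 = ?s4"
    proof (cases ?can)
      case True
      then have "?s4 = ?s3" by (simp add: rd_ok_def)
      moreover have "effect (IfTop 11 Skip (set_flag f) Skip) ?s3 = ?s3"
        using True assms(3,5) by (cases "rd_digits w" rule: rev_cases) auto
      ultimately show ?thesis by (simp only:)
    next
      case False
      then have "?s4 = ?s3(f := [True])" by (simp add: rd_ok_def)
      moreover have "effect (IfTop 11 Skip (set_flag f) Skip) ?s3 = ?s3(f := [True])"
        using False assms(3,5) by (cases "rd_digits w" rule: rev_cases) auto
      ultimately show ?thesis by (simp only:)
    qed
  qed auto
  let ?s5 = "?s4(11 := rev (bits (rd_nat w)))"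
  have len: "length (rd_digits w) \<le> B" using length_rd_digits[of w] assms(8) by (simp add: w_def)
  have e5: "ex Or (IfTop 11 Skip (clear 11) Skip) ?s4 (2 * B + 2) ?s5"
  proof (rule ex_IfTop[where T = "2 * B + 1"])
    show "ex Or (case ?s4 11 of [] \<Rightarrow> Skip | b # _ \<Rightarrow> if b then Skip else clear 11) ?s4 (2 * B + 1) ?s5"
    proof (cases ?can)
      case True
      have "?s5 = ?s4" using True assms(3,5) by (intro ext) (simp add: bits_rd_nat)
      moreover have "(case ?s4 11 of [] \<Rightarrow> Skip | b # _ \<Rightarrow> if b then Skip else clear 11) = Skip"
        using True assms(3,5) by (cases "rd_digits w" rule: rev_cases) auto
      ultimately show ?thesis by (simp only:) (rule ex_Skip, simp_all)
    next
      case False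
      have "(case ?s4 11 of [] \<Rightarrow> Skip | b # _ \<Rightarrow> if b then Skip else clear 11) = clear 11"
        using False assms(3,5) by (cases "rd_digits w" rule: rev_cases) auto
      moreover have "ex Or (clear 11) ?s4 (2 * B + 1) ?s5"
        by (rule ex_clearI) (use False assms(3,5) len in \<open>auto simp: bits_rd_nat\<close>)
      ultimately show ?thesis by (simp only:)
    qed
  qed simp
  let ?s6 = "s(x := bits (rd_nat w), st := rd_rest w, f := flag_word (c \<or> \<not> rd_ok w))"
  have eq: "?s6 = ?s5(11 := [], x := rev (?s5 11) @ ?s5 x)"
    using temps assms(3-6) by (intro ext) auto
  have "length (bits (rd_nat w)) \<le> B" using len by (simp add: bits_rd_nat)
  then have e6: "ex Or (move 11 x) ?s5 (4 * B + 1) ?s6"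
    by (intro ex_moveI[where s = ?s5 and k = 11 and a = x, OF _ eq]) (use assms(4) in auto)
  have "2 * B + 1 + (1 + (8 * B + 10 + (3 + (2 * B + 2 + (4 * B + 1))))) \<le> 100 * (B + 1) ^ 2"
    by (simp add: power2_eq_square)
  then show ?thesis unfolding read_nat_def w_def[symmetric]
    by (rule ex_Seq[OF e1 ex_Seq[OF e2 ex_Seq[OF e3 ex_Seq[OF e4 ex_Seq[OF e5 e6 order.refl] order.refl] order.refl] order.refl]])
qed

subsection \<open>Queries\<close>

text \<open>The code is assembled from its end: the end marker, then the digits from the most
  significant one on, each pushed before its own marker. The register is rebuilt on the way.\<close>

definition encode :: "nat \<Rightarrow> prog" where
  "encode a = Push 13 False ;; move a 10 ;;
     drain 10 (Push a False ;; Push 13 False ;; Push 13 True) (Push a True ;; Push 13 True ;; Push 13 True)"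

lemma ex_encode:
  assumes "s a = bits n" "s 10 = []" "a \<ge> 20" "n < 2 ^ B" "s' = s(13 := nat_code n @ s 13)"
  shows "ex Or (encode a) s (10 * B + 3) s'"
proof -
  let ?f = "\<lambda>b::bool. [True, b]"
  define w where "w = bits n"
  have len: "length w \<le> B" unfolding w_def by (rule length_bits_le[OF assms(4)])
  let ?s1 = "s(13 := False # s 13)"
  have e1: "ex Or (Push 13 False) s 1 ?s1" by (rule ex_loop_free) auto
  let ?s2 = "s(13 := False # s 13, a := [], 10 := rev w)"
  have e2: "ex Or (move a 10) ?s1 (4 * B + 1) ?s2"
    by (rule ex_moveI) (use assms(1-3) len in \<open>auto simp: w_def\<close>)
  let ?I = "\<lambda>v s'. rev v @ s' a = w \<and> concat (map ?f (rev v)) @ s' 13 = concat (map ?f w) @ False # s 13 \<and>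
    (\<forall>j. j \<notin> {10, 13, a} \<longrightarrow> s' j = s j)"
  have "\<exists>s'. ex Or (drain 10 (Push a False ;; Push 13 False ;; Push 13 True)
      (Push a True ;; Push 13 True ;; Push 13 True)) ?s2 (length (rev w) * (3 + 3) + 1) s' \<and>
      s' 10 = [] \<and> ?I [] s'"
  proof (rule ex_drain[where I = ?I])
    fix b v s1
    assume s1: "s1 10 = b # v" and I: "?I (b # v) s1"
    let ?s = "s1(10 := v, a := b # s1 a, 13 := True # b # s1 13)"
    have "ex Or (if b then Push a True ;; Push 13 True ;; Push 13 True
        else Push a False ;; Push 13 False ;; Push 13 True) (s1(10 := v)) 3 ?s"
      by (rule ex_loop_free) (use assms(3) in \<open>auto simp: fun_eq_iff\<close>)
    moreover have "?I v ?s" using I assms(3) by auto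
    moreover have "?s 10 = v" using assms(3) by auto
    ultimately show "\<exists>s'. ex Or (if b then Push a True ;; Push 13 True ;; Push 13 True
        else Push a False ;; Push 13 False ;; Push 13 True) (s1(10 := v)) 3 s' \<and> s' 10 = v \<and> ?I v s'"
      by blast
  qed (use assms(3) in auto)
  then obtain s3 where s3: "ex Or (drain 10 (Push a False ;; Push 13 False ;; Push 13 True)
      (Push a True ;; Push 13 True ;; Push 13 True)) ?s2 (length (rev w) * (3 + 3) + 1) s3"
    "s3 10 = []" "s3 a = w" "s3 13 = concat (map ?f w) @ False # s 13"
    "\<forall>j. j \<notin> {10, 13, a} \<longrightarrow> s3 j = s j" by auto
  have "s3 = s'"
  proof
    fix j
    show "s3 j = s' j" unfolding assms(5)
      using s3(2-5) assms(1-3) by (cases "j \<in> {10, 13, a}") (auto simp: nat_code_def w_def)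
  qed
  note s3' = s3(1)[unfolded this]
  show ?thesis unfolding encode_def
    by (rule ex_Seq[OF e1 ex_Seq[OF e2 s3' order.refl]]) (use len in simp)
qed

definition split_body :: "nat \<Rightarrow> nat \<Rightarrow> prog" where
  "split_body n d = IfTop 14 Skip (double n) (Push n True) ;; Pop 14 ;;
     IfTop 14 Skip (double d) (Push d True) ;; Pop 14"

definition split_digits :: "nat \<Rightarrow> nat \<Rightarrow> prog" where
  "split_digits n d = WhileNonempty 14 (split_body n d)"

lemma effect_double: "effect (double k) s = s(k := cons_bit False (s k))"
  by (auto simp: double_def cons_bit_def split: list.splits)

lemma ex_split_digits:
  assumes "s 14 = concat (map (\<lambda>(a, b). [a, b]) zs)" "n \<noteq> d" "n \<noteq> 14" "d \<noteq> 14"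
  shows "ex Or (split_digits n d) s (9 * length zs + 1)
     (s(14 := [], n := fold cons_bit (map fst zs) (s n), d := fold cons_bit (map snd zs) (s d)))"
  using assms(1)
proof (induction zs arbitrary: s)
  case Nil
  then have eq: "s(14 := [], n := fold cons_bit (map fst []) (s n), d := fold cons_bit (map snd []) (s d)) = s"
    by (intro ext) simp
  show ?case unfolding eq split_digits_def by (rule ex_While_end) (use Nil in auto)
next
  case (Cons z zs)
  obtain a b where z: "z = (a, b)" by fastforce
  let ?s = "s(14 := concat (map (\<lambda>(a, b). [a, b]) zs), n := cons_bit a (s n), d := cons_bit b (s d))"
  have b: "ex Or (split_body n d) s 8 ?s"
  proof (rule ex_loop_free)
    show "effect (split_body n d) s = ?s"
      using Cons.prems z assms(2-4) by (cases a; cases b)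
        (auto simp: split_body_def effect_double fun_eq_iff cons_bit_def)
  qed (auto simp: split_body_def double_def)
  have "ex Or (split_digits n d) ?s (9 * length zs + 1)
     (?s(14 := [], n := fold cons_bit (map fst zs) (?s n), d := fold cons_bit (map snd zs) (?s d)))"
    by (rule Cons.IH) (use assms(2-4) in auto)
  also have "?s(14 := [], n := fold cons_bit (map fst zs) (?s n), d := fold cons_bit (map snd zs) (?s d))
    = s(14 := [], n := fold cons_bit (map fst (z # zs)) (s n), d := fold cons_bit (map snd (z # zs)) (s d))"
    using assms(2-4) z by (intro ext) simp
  finally have w: "ex Or (split_digits n d) ?s (9 * length zs + 1)
    (s(14 := [], n := fold cons_bit (map fst (z # zs)) (s n), d := fold cons_bit (map snd (z # zs)) (s d)))" .
  show ?case unfolding split_digits_def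
    by (rule ex_While_step[OF _ b w[unfolded split_digits_def]]) (use Cons.prems z in auto)
qed

text \<open>Reading digits from the most significant one is Horner's scheme; the padding zeros leave
  no trace because \<open>cons_bit False []\<close> is empty.\<close>

lemma fold_cons_bit_padded: "fold cons_bit (replicate k False @ rev (bits n)) [] = bits n"
proof -
  have "fold cons_bit (replicate k False) [] = []"
    by (induction k) (simp_all add: cons_bit_def)
  moreover have "fold cons_bit (rev (bits n)) [] = bits n"
  proof (induction n rule: less_induct)
    case (less n)
    show ?case
    proof (cases "n = 0")
      case False
      then have "fold cons_bit (rev (bits (n div 2))) [] = bits (n div 2)" using less by simp
      then have "fold cons_bit (rev (bits n)) [] = cons_bit (odd n) (bits (n div 2))"
        using False by (simp add: bits_pos)
      then show ?thesis by (simp add: cons_bit_bits)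
    qed simp
  qed
  ultimately show ?thesis by simp
qed

lemma rat_code_split:
  obtains zs where "rat_code x = (x < 0) # concat (map (\<lambda>(a, b). [a, b]) zs)"
    "fold cons_bit (map fst zs) [] = bits (nat \<bar>fst (quotient_of x)\<bar>)"
    "fold cons_bit (map snd zs) [] = bits (nat (snd (quotient_of x)))"
proof -
  let ?a = "bits (nat \<bar>fst (quotient_of x)\<bar>)" and ?b = "bits (nat (snd (quotient_of x)))"
  let ?l = "max (length ?a) (length ?b)"
  let ?A = "replicate (?l - length ?a) False @ rev ?a"
  let ?B = "replicate (?l - length ?b) False @ rev ?b"
  have "length ?A = length ?B" by simp
  then have "map fst (zip ?A ?B) = ?A" "map snd (zip ?A ?B) = ?B"
    by (auto simp only: map_fst_zip map_snd_zip)
  then show ?thesis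
    by (intro that[of "zip ?A ?B"]) (simp_all only: fold_cons_bit_padded, simp add: rat_code_def Let_def)
qed

text \<open>The column index is encoded before the row index, since the query word grows at its
  front.\<close>

definition get_payoff :: "nat \<Rightarrow> nat \<Rightarrow> nat \<Rightarrow> nat \<Rightarrow> nat \<Rightarrow> prog" where
  "get_payoff i j n d g = clear n ;; clear d ;; clear g ;; encode j ;; encode i ;; Query 13 14 ;;
     clear 13 ;; IfTop 14 Skip Skip (Push g True) ;; Pop 14 ;; split_digits n d"

lemma length_nat_code: "length (nat_code n) = 2 * length (bits n) + 1"
proof -
  have "length (concat (map (\<lambda>b. [True, b]) w)) = 2 * length w" for w
    by (induction w) auto
  then show ?thesis by (simp add: nat_code_def)
qed

lemma ex_get_payoff:
  assumes "s i = bits ni" "s j = bits nj" "\<forall>k\<in>{10..<20}. s k = []"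
    "i \<ge> 20" "j \<ge> 20" "n \<ge> 20" "d \<ge> 20" "g \<ge> 20" "n \<notin> {i, j}" "d \<notin> {i, j, n}" "g \<notin> {i, j, n, d}"
    "length (s n) \<le> B" "length (s d) \<le> B" "length (s g) \<le> B" "ni < 2 ^ B" "nj < 2 ^ B"
    "Or (nat_code ni @ nat_code nj) = rat_code x" "length (rat_code x) \<le> B"
  shows "ex Or (get_payoff i j n d g) s (100 * (B + 1) ^ 2)
    (s(n := bits (nat \<bar>fst (quotient_of x)\<bar>), d := bits (nat (snd (quotient_of x))), g := flag_word (x < 0)))"
proof -
  obtain zs where zs: "rat_code x = (x < 0) # concat (map (\<lambda>(a, b). [a, b]) zs)"
    "fold cons_bit (map fst zs) [] = bits (nat \<bar>fst (quotient_of x)\<bar>)"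
    "fold cons_bit (map snd zs) [] = bits (nat (snd (quotient_of x)))"
    by (rule rat_code_split)
  have "length (concat (map (\<lambda>(a, b). [a, b]) zs)) = 2 * length zs" by (induction zs) auto
  then have lz: "length zs \<le> B" using zs(1) assms(18) by simp
  have temps: "s 10 = []" "s 13 = []" "s 14 = []" using assms(3) by auto
  have li: "length (bits ni) \<le> B" "length (bits nj) \<le> B"
    using length_bits_le assms(15,16) by auto
  let ?s1 = "s(n := [])"
  have e1: "ex Or (clear n) s (2 * B + 1) ?s1" by (rule ex_clearI) (use assms(12) in auto)
  let ?s2 = "s(n := [], d := [])"
  have e2: "ex Or (clear d) ?s1 (2 * B + 1) ?s2" by (rule ex_clearI) (use assms(10,13) in auto)
  let ?s3 = "s(n := [], d := [], g := [])"
  have e3: "ex Or (clear g) ?s2 (2 * B + 1) ?s3" by (rule ex_clearI) (use assms(11,14) in auto)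
  let ?s4 = "?s3(13 := nat_code nj)"
  have e4: "ex Or (encode j) ?s3 (10 * B + 3) ?s4"
    by (rule ex_encode[of _ _ nj]) (use assms(2,5-11,16) temps in auto)
  let ?s5 = "?s3(13 := nat_code ni @ nat_code nj)"
  have e5: "ex Or (encode i) ?s4 (10 * B + 3) ?s5"
    by (rule ex_encode[of _ _ ni]) (use assms(1,4,6-11,15) temps in auto)
  let ?s6 = "?s5(14 := rat_code x)"
  have e6: "ex Or (Query 13 14) ?s5 1 ?s6"
    by (rule ex_Query) (use assms(17) in auto)
  let ?s7 = "?s3(14 := rat_code x)"
  have e7: "ex Or (clear 13) ?s6 (8 * B + 5) ?s7"
    by (rule ex_clearI) (use temps assms(6-8) li in \<open>auto simp: length_nat_code fun_eq_iff\<close>)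
  let ?s8 = "?s7(g := flag_word (x < 0))"
  have e8: "ex Or (IfTop 14 Skip Skip (Push g True)) ?s7 2 ?s8"
    by (rule ex_loop_free) (use assms(8) zs(1) in \<open>auto simp: fun_eq_iff\<close>)
  let ?s9 = "?s8(14 := concat (map (\<lambda>(a, b). [a, b]) zs))"
  have e9: "ex Or (Pop 14) ?s8 1 ?s9"
    by (rule ex_loop_free) (use assms(8) zs(1) in \<open>auto simp: fun_eq_iff\<close>)
  let ?s10 = "s(n := bits (nat \<bar>fst (quotient_of x)\<bar>), d := bits (nat (snd (quotient_of x))), g := flag_word (x < 0))"
  have "ex Or (split_digits n d) ?s9 (9 * length zs + 1)
     (?s9(14 := [], n := fold cons_bit (map fst zs) (?s9 n), d := fold cons_bit (map snd zs) (?s9 d)))"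
    by (rule ex_split_digits) (use assms(6,7,10) in auto)
  also have "?s9(14 := [], n := fold cons_bit (map fst zs) (?s9 n), d := fold cons_bit (map snd zs) (?s9 d)) = ?s10"
    using temps assms(6-11) zs(2,3) by (intro ext) auto
  finally have e10: "ex Or (split_digits n d) ?s9 (9 * B + 1) ?s10"
    by (rule ex_mono) (use lz in auto)
  have "2 * B + 1 + (2 * B + 1 + (2 * B + 1 + (10 * B + 3 + (10 * B + 3 + (1 + (8 * B + 5 + (2 + (1 + (9 * B + 1))))))))) \<le> 100 * (B + 1) ^ 2"
    by (simp add: power2_eq_square)
  then show ?thesis unfolding get_payoff_def
    by (rule ex_Seq[OF e1 ex_Seq[OF e2 ex_Seq[OF e3 ex_Seq[OF e4 ex_Seq[OF e5 ex_Seq[OF e6 ex_Seq[OF e7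
          ex_Seq[OF e8 ex_Seq[OF e9 e10 order.refl] order.refl] order.refl] order.refl] order.refl] order.refl] order.refl] order.refl]])
qed

subsection \<open>Scanning a prefix of a rational\<close>

text \<open>Looks for a nonzero numerator digit among the first \<open>n\<close> aligned digit
  pairs. By the alignment such a digit shows that the rational is at least \<open>1 / 2 ^ n\<close>,
  and at most \<open>2 * n\<close> letters are inspected for it.\<close>

fun num_digit_within :: "nat \<Rightarrow> word \<Rightarrow> bool" where
  "num_digit_within 0 w = False"
| "num_digit_within (Suc n) w = (w \<noteq> [] \<and> hd w \<or> num_digit_within n (tl (tl w)))"

definition scan_step :: "nat \<Rightarrow> prog" where
  "scan_step g = IfTop 2 Skip Skip (set_flag g) ;; Pop 2 ;; Pop 2"

text \<open>The number in \<open>e\<close> acts as a clock through the length of its code. The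
  number of pairs inspected is one less than this length, hence \<open>Pop 13\<close>, because a
  number with \<open>k\<close> digits is only known to be at least \<open>2 ^ (k - 1)\<close>.
  \<open>Pop 2\<close> skips the sign.\<close>

definition scan_eps :: "nat \<Rightarrow> nat \<Rightarrow> prog" where
  "scan_eps e g = copy e 13 ;; Pop 13 ;; Pop 2 ;; drain 13 (scan_step g) (scan_step g)"

lemma ex_scan_eps:
  assumes "s e = bits n" "s g = flag_word c" "\<forall>k\<in>{10..<20}. s k = []" "e \<ge> 20" "g \<ge> 20" "e \<noteq> g" "n < 2 ^ B"
  shows "\<exists>w. ex Or (scan_eps e g) s (100 * (B + 1) ^ 2)
    (s(2 := w, g := flag_word (c \<or> num_digit_within (length (bits n) - 1) (tl (s 2)))))"
proof -
  have temps: "s 10 = []" "s 13 = []" using assms(3) by auto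
  have len: "length (bits n) \<le> B" by (rule length_bits_le[OF assms(7)])
  let ?s1 = "s(13 := bits n)"
  have e1: "ex Or (copy e 13) s (9 * B + 2) ?s1"
    by (rule ex_copyI) (use assms(1,4) temps len in auto)
  let ?s2 = "s(13 := tl (bits n))"
  have e2: "ex Or (Pop 13) ?s1 1 ?s2" by (rule ex_loop_free) auto
  let ?s3 = "s(13 := tl (bits n), 2 := tl (s 2))"
  have e3: "ex Or (Pop 2) ?s2 1 ?s3" by (rule ex_loop_free) auto
  let ?r = "c \<or> num_digit_within (length (bits n) - 1) (tl (s 2))"
  let ?I = "\<lambda>(v::word) s'. \<exists>c'. s' g = flag_word c' \<and> (c' \<or> num_digit_within (length v) (s' 2)) = ?r \<and>
     (\<forall>j. j \<notin> {2, 13, g} \<longrightarrow> s' j = s j)"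
  have "\<exists>s'. ex Or (drain 13 (scan_step g) (scan_step g)) ?s3 (length (tl (bits n)) * (5 + 3) + 1) s' \<and>
     s' 13 = [] \<and> ?I [] s'"
  proof (rule ex_drain[where I = ?I])
    show "?I (tl (bits n)) ?s3" by (rule exI[of _ c]) (use assms(2,5) in auto)
  next
    fix b v s1
    assume s1: "s1 13 = b # v" and "?I (b # v) s1"
    then obtain c' where c': "s1 g = flag_word c'" "(c' \<or> num_digit_within (length (b # v)) (s1 2)) = ?r"
      "\<forall>j. j \<notin> {2, 13, g} \<longrightarrow> s1 j = s j" by blast
    let ?c = "c' \<or> s1 2 \<noteq> [] \<and> hd (s1 2)"
    let ?s = "s1(13 := v, g := flag_word ?c, 2 := tl (tl (s1 2)))"
    have eff: "effect (scan_step g) (s1(13 := v)) = ?s"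
      using c'(1) assms(5) by (cases "s1 2"; cases c') (auto simp: scan_step_def fun_eq_iff set_flag_def)
    have "ex Or (if b then scan_step g else scan_step g) (s1(13 := v)) 5 ?s"
      by (rule ex_loop_free) (use eff in \<open>auto simp: scan_step_def\<close>)
    moreover have "?I v ?s"
      by (rule exI[of _ ?c]) (use c' assms(5) in auto)
    moreover have "?s 13 = v" using assms(5) by auto
    ultimately show "\<exists>s'. ex Or (if b then scan_step g else scan_step g) (s1(13 := v)) 5 s' \<and> s' 13 = v \<and> ?I v s'"
      by blast
  qed simp
  then obtain s4 where s4: "ex Or (drain 13 (scan_step g) (scan_step g)) ?s3 (length (tl (bits n)) * (5 + 3) + 1) s4"
     "s4 13 = []" "s4 g = flag_word ?r" "\<forall>j. j \<notin> {2, 13, g} \<longrightarrow> s4 j = s j"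
    by auto
  have eq: "s4 = s(2 := s4 2, g := flag_word ?r)"
  proof
    fix j
    show "s4 j = (s(2 := s4 2, g := flag_word ?r)) j"
      using s4(2-4) temps assms(5) by (cases "j \<in> {2, 13, g}") auto
  qed
  have "9 * B + 2 + (1 + (1 + (length (tl (bits n)) * (5 + 3) + 1))) \<le> 17 * B + 5"
    using len by simp
  also have "\<dots> \<le> 100 * (B + 1) ^ 2" by (simp add: power2_eq_square)
  finally have "ex Or (scan_eps e g) s (100 * (B + 1) ^ 2) s4" unfolding scan_eps_def
    by (rule ex_Seq[OF e1 ex_Seq[OF e2 ex_Seq[OF e3 s4(1) order.refl] order.refl]])
  then show ?thesis by (subst (asm) eq) blast
qed

subsection \<open>Truncating the certificate\<close>

definition take_step :: prog where
  "take_step = IfTop 4 Skip (Push 14 False ;; Pop 4) (Push 14 True ;; Pop 4)"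

text \<open>The output is the clock: four letters of the certificate are transferred per letter of
  it. All later costs depend on the certificate only through the length of the output.\<close>

definition trunc_cert :: prog where
  "trunc_cert = copy 3 13 ;; (let t = take_step ;; take_step ;; take_step ;; take_step in drain 13 t t) ;; move 14 7"

lemma effect_take_step: "effect take_step s = s(14 := rev (take 1 (s 4)) @ s 14, 4 := drop 1 (s 4))"
  by (auto simp: take_step_def fun_eq_iff split: list.splits)

lemma ex_trunc_cert:
  assumes "\<forall>k\<in>{10..<20}. s k = []" "s 7 = []" "length (s 3) \<le> B"
  shows "\<exists>w. ex Or trunc_cert s (100 * (B + 1) ^ 2) (s(4 := w, 7 := take (4 * length (s 3)) (s 4)))"
proof -
  have temps: "s 10 = []" "s 13 = []" "s 14 = []" using assms(1) by auto
  let ?t = "take_step ;; take_step ;; take_step ;; take_step"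
  let ?s1 = "s(13 := s 3)"
  have e1: "ex Or (copy 3 13) s (9 * B + 2) ?s1"
    by (rule ex_copyI) (use temps assms(3) in auto)
  let ?r = "take (4 * length (s 3)) (s 4)"
  let ?I = "\<lambda>(v::word) s'. rev (s' 14) @ take (4 * length v) (s' 4) = ?r \<and> (\<forall>j. j \<notin> {4, 13, 14} \<longrightarrow> s' j = s j)"
  have "\<exists>s'. ex Or (drain 13 ?t ?t) ?s1 (length (s 3) * (12 + 3) + 1) s' \<and> s' 13 = [] \<and> ?I [] s'"
  proof (rule ex_drain[where I = ?I])
    fix b v s1
    assume s1: "s1 13 = b # v" and I: "?I (b # v) s1"
    let ?s = "s1(13 := v, 14 := rev (take 4 (s1 4)) @ s1 14, 4 := drop 4 (s1 4))"
    have split: "rev (take (Suc 0) (drop (Suc (Suc (Suc 0))) w)) @ rev (take (Suc 0) (drop (Suc (Suc 0)) w)) @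
        rev (take (Suc 0) (drop (Suc 0) w)) @ rev (take (Suc 0) w) = rev (take 4 w)"
      "drop (Suc (Suc (Suc (Suc 0)))) w = drop 4 w" for w :: word
      by (cases w; cases "tl w"; cases "tl (tl w)"; cases "tl (tl (tl w))") (auto simp: numeral_eq_Suc)
    have "effect ?t (s1(13 := v)) = ?s"
      by (intro ext) (simp add: effect_take_step split)
    then have "ex Or (if b then ?t else ?t) (s1(13 := v)) 12 ?s"
      by (intro ex_loop_free) (auto simp: take_step_def)
    moreover have "?I v ?s"
      using I take_add[of 4 "4 * length v" "s1 4"] by auto
    moreover have "?s 13 = v" by auto
    ultimately show "\<exists>s'. ex Or (if b then ?t else ?t) (s1(13 := v)) 12 s' \<and> s' 13 = v \<and> ?I v s'"
      by blast
  qed (use temps in auto)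
  then obtain s2 where s2: "ex Or (drain 13 ?t ?t) ?s1 (length (s 3) * (12 + 3) + 1) s2" "s2 13 = []"
    "rev (s2 14) = ?r" "\<forall>j. j \<notin> {4, 13, 14} \<longrightarrow> s2 j = s j" by auto
  let ?s3 = "s(4 := s2 4, 7 := ?r)"
  have eq: "?s3 = s2(14 := [], 7 := rev (s2 14) @ s2 7)"
  proof
    fix j
    show "?s3 j = (s2(14 := [], 7 := rev (s2 14) @ s2 7)) j"
      using s2(2-4) temps assms(2) by (cases "j \<in> {4, 13, 14}") auto
  qed
  have "length (s2 14) = length ?r" using s2(3) by (metis length_rev)
  then have l: "length (s2 14) \<le> 4 * B" using assms(3) by simp
  have e3: "ex Or (move 14 7) s2 (16 * B + 1) ?s3"
    by (rule ex_moveI[where s = s2 and k = 14 and a = 7, OF _ eq]) (use l in auto)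
  have "9 * B + 2 + (length (s 3) * (12 + 3) + 1 + (16 * B + 1)) \<le> 40 * B + 4" using assms(3) by simp
  also have "\<dots> \<le> 100 * (B + 1) ^ 2" by (simp add: power2_eq_square)
  finally have "ex Or trunc_cert s (100 * (B + 1) ^ 2) ?s3" unfolding trunc_cert_def Let_def
    by (rule ex_Seq[OF e1 ex_Seq[OF s2(1) e3 order.refl]])
  then show ?thesis by blast
qed

section \<open>Register programs\<close>

text \<open>Stacks 0 to 7 are streams, stacks 10 to 19 are scratch space and empty between instructions,
  and the remaining ones hold numbers (in the form \<open>bits n\<close>) and flags.\<close>

record registers =
  nums :: "nat \<Rightarrow> nat"
  flgs :: "nat \<Rightarrow> bool"
  strs :: "nat \<Rightarrow> word"

definition num_stack :: "nat \<Rightarrow> nat" where "num_stack x = 20 + 2 * x"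
definition flag_stack :: "nat \<Rightarrow> nat" where "flag_stack f = 21 + 2 * f"

lemma stack_simps [simp]:
  "num_stack x = num_stack y \<longleftrightarrow> x = y" "flag_stack f = flag_stack g \<longleftrightarrow> f = g"
  "num_stack x \<noteq> flag_stack f" "flag_stack f \<noteq> num_stack x"
  "20 \<le> num_stack x" "20 \<le> flag_stack f"
  "k < 20 \<Longrightarrow> num_stack x \<noteq> k" "k < 20 \<Longrightarrow> k \<noteq> num_stack x"
  "k < 20 \<Longrightarrow> flag_stack x \<noteq> k" "k < 20 \<Longrightarrow> k \<noteq> flag_stack x"
  unfolding num_stack_def flag_stack_def by presburger+

text \<open>Streams 2, 4 and 5 (the code of \<open>\<epsilon>\<close>, the certificate and the universal word) may be too
  long to be read completely within the time bound.\<close>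

definition conc :: "nat \<Rightarrow> registers \<Rightarrow> (nat \<Rightarrow> word) \<Rightarrow> bool" where
  "conc B a s \<longleftrightarrow>
     (\<forall>k. s (num_stack k) = bits (nums a k) \<and> nums a k < 2 ^ B) \<and>
     (\<forall>k. s (flag_stack k) = flag_word (flgs a k)) \<and>
     (\<forall>k<8. s k = strs a k) \<and> (\<forall>k\<in>{0, 1, 3, 6, 7}. length (strs a k) \<le> B) \<and>
     (\<forall>k\<in>{10..<20}. s k = [])"

lemma concD:
  assumes "conc B a s"
  shows "s (num_stack k) = bits (nums a k)" "nums a k < 2 ^ B" "s (flag_stack k) = flag_word (flgs a k)"
    "k < 8 \<Longrightarrow> s k = strs a k" "k \<in> {0, 1, 3, 6, 7} \<Longrightarrow> length (strs a k) \<le> B"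
    "\<forall>k\<in>{10..<20}. s k = []" "length (s (num_stack k)) \<le> B"
  using assms length_bits_le unfolding conc_def by auto

lemma conc_num:
  "conc B a s \<Longrightarrow> v < 2 ^ B \<Longrightarrow> conc B (a\<lparr>nums := (nums a)(x := v)\<rparr>) (s(num_stack x := bits v))"
  unfolding conc_def by simp

lemma conc_flag:
  "conc B a s \<Longrightarrow> conc B (a\<lparr>flgs := (flgs a)(f := b)\<rparr>) (s(flag_stack f := flag_word b))"
  unfolding conc_def by simp

lemma conc_str:
  "conc B a s \<Longrightarrow> st < 8 \<Longrightarrow> st \<in> {2, 4, 5} \<or> length w \<le> B \<Longrightarrow>
    conc B (a\<lparr>strs := (strs a)(st := w)\<rparr>) (s(st := w))"
  unfolding conc_def by auto

text \<open>One common price for all instructions. It is quadratic because of multiplication, which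
  performs up to \<open>B\<close> additions of numbers with \<open>O(B)\<close> digits.\<close>

abbreviation unit_time :: "nat \<Rightarrow> nat" where "unit_time B \<equiv> 100 * (B + 1) ^ 2"

text \<open>A total-correctness triple with a budget of \<open>n\<close> units of time: a
  terminating run from every concrete state of \<open>a\<close> is part of the claim.\<close>

definition run :: "oracle_fun \<Rightarrow> nat \<Rightarrow> prog \<Rightarrow> nat \<Rightarrow> registers \<Rightarrow> (registers \<Rightarrow> bool) \<Rightarrow> bool" where
  "run Or B P n a Q \<longleftrightarrow> (\<forall>s. conc B a s \<longrightarrow>
     (\<exists>s' a'. ex Or P s (n * unit_time B) s' \<and> conc B a' s' \<and> Q a'))"

lemma run_Seq:
  assumes "run Or B P n a R" "\<And>a'. R a' \<Longrightarrow> run Or B P' n' a' Q" "n + n' \<le> m"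
  shows "run Or B (P ;; P') m a Q"
  unfolding run_def
proof (intro allI impI)
  fix s assume "conc B a s"
  then obtain s1 a1 where 1: "ex Or P s (n * unit_time B) s1" "conc B a1 s1" "R a1"
    using assms(1) unfolding run_def by blast
  then obtain s2 a2 where 2: "ex Or P' s1 (n' * unit_time B) s2" "conc B a2 s2" "Q a2"
    using assms(2) unfolding run_def by blast
  have "n * unit_time B + n' * unit_time B \<le> m * unit_time B"
    using mult_right_mono[OF assms(3), of "unit_time B"] by (simp add: add_mult_distrib)
  from ex_Seq[OF 1(1) 2(1) this] show "\<exists>s' a'. ex Or (P ;; P') s (m * unit_time B) s' \<and> conc B a' s' \<and> Q a'"
    using 2 by blast
qed

lemma run_step:
  assumes "\<And>s. conc B a s \<Longrightarrow> \<exists>s'. ex Or P s (unit_time B) s' \<and> conc B a' s'"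
    "run Or B R (n - 1) a' Q" "1 \<le> n"
  shows "run Or B (P ;; R) n a Q"
proof (rule run_Seq)
  show "run Or B P 1 a ((=) a')" using assms(1) unfolding run_def by simp
  show "\<And>a''. a' = a'' \<Longrightarrow> run Or B R (n - 1) a'' Q" using assms(2) by simp
qed (use assms(3) in simp)

lemma run_Skip: "Q a \<Longrightarrow> 1 \<le> n \<Longrightarrow> run Or B Skip n a Q"
  unfolding run_def by (auto intro!: exI ex_Skip simp: Suc_le_eq)

lemma run_weaken: "run Or B P n a Q \<Longrightarrow> (\<And>a. Q a \<Longrightarrow> Q' a) \<Longrightarrow> run Or B P n a Q'"
  unfolding run_def by blast

lemma run_If:
  assumes "\<not> flgs a f \<Longrightarrow> run Or B P n a Q" "flgs a f \<Longrightarrow> run Or B P' n a Q"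
  shows "run Or B (IfTop (flag_stack f) P Skip P') (Suc n) a Q"
  unfolding run_def
proof (intro allI impI)
  fix s assume s: "conc B a s"
  then obtain s1 a1 where 1: "ex Or (if flgs a f then P' else P) s (n * unit_time B) s1" "conc B a1 s1" "Q a1"
    using assms unfolding run_def by metis
  have "ex Or (IfTop (flag_stack f) P Skip P') s (Suc n * unit_time B) s1"
    by (rule ex_IfTop[where T = "n * unit_time B"]) (cases "flgs a f", use 1(1) concD(3)[OF s, of f] in auto)
  then show "\<exists>s' a'. ex Or (IfTop (flag_stack f) P Skip P') s (Suc n * unit_time B) s' \<and> conc B a' s' \<and> Q a'"
    using 1 by blast
qed

text \<open>The number of rounds is known in advance: the flag has to be up as long as rounds remain
  and down after round \<open>N\<close>. Each round pays one extra unit for its test, and the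
  failing test costs the last one.\<close>

lemma run_while:
  assumes "Inv 0 a"
    and step: "\<And>k a. k < N \<Longrightarrow> Inv k a \<Longrightarrow> flgs a f \<and> run Or B P m a (Inv (Suc k))"
    and fin: "\<And>a. Inv N a \<Longrightarrow> \<not> flgs a f"
  shows "run Or B (WhileNonempty (flag_stack f) P) (N * (m + 1) + 1) a (Inv N)"
proof -
  have "run Or B (WhileNonempty (flag_stack f) P) ((N - k) * (m + 1) + 1) a (Inv N)" if "k \<le> N" "Inv k a" for k a
    using that
  proof (induction "N - k" arbitrary: k a)
    case 0
    then have "\<not> flgs a f" using fin by simp
    then have "ex Or (WhileNonempty (flag_stack f) P) s (unit_time B) s" if "conc B a s" for s
      by (intro ex_While_end) (use concD(3)[OF that, of f] in auto)
    then show ?case using 0 unfolding run_def by (auto intro!: exI)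
  next
    case (Suc j)
    have kN: "k < N" "j = N - Suc k" using Suc by auto
    show ?case unfolding run_def
    proof (intro allI impI)
      fix s assume s: "conc B a s"
      obtain s1 a1 where 1: "ex Or P s (m * unit_time B) s1" "conc B a1 s1" "Inv (Suc k) a1"
        using step[OF kN(1) Suc.prems(2)] s unfolding run_def by blast
      have "run Or B (WhileNonempty (flag_stack f) P) ((N - Suc k) * (m + 1) + 1) a1 (Inv N)"
        by (rule Suc.hyps(1)) (use kN 1 in auto)
      then obtain s2 a2 where 2: "ex Or (WhileNonempty (flag_stack f) P) s1 (((N - Suc k) * (m + 1) + 1) * unit_time B) s2"
        "conc B a2 s2" "Inv N a2" using 1(2) unfolding run_def by blast
      have n: "(N - k) * (m + 1) + 1 = m + 1 + ((N - Suc k) * (m + 1) + 1)"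
        using kN(1) by (simp add: Suc_diff_Suc[symmetric])
      have "Suc (m * unit_time B + ((N - Suc k) * (m + 1) + 1) * unit_time B) \<le> ((N - k) * (m + 1) + 1) * unit_time B"
        unfolding n add_mult_distrib by simp
      moreover have "s (flag_stack f) \<noteq> []"
        using step[OF kN(1) Suc.prems(2)] concD(3)[OF s, of f] by simp
      ultimately have "ex Or (WhileNonempty (flag_stack f) P) s (((N - k) * (m + 1) + 1) * unit_time B) s2"
        using ex_While_step[OF _ 1(1) 2(1)] by blast
      then show "\<exists>s' a'. ex Or (WhileNonempty (flag_stack f) P) s (((N - k) * (m + 1) + 1) * unit_time B) s' \<and>
          conc B a' s' \<and> Inv N a'" using 2 by blast
    qed
  qed
  from this[of 0 a] show ?thesis using assms(1) by simp
qed

section \<open>Proof rules for the single register instructions\<close>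

abbreviation "CLR x \<equiv> clear (num_stack x)"
abbreviation "CLRF f \<equiv> clear (flag_stack f)"
abbreviation "ONE x \<equiv> Push (num_stack x) True"
abbreviation "MUL x y z \<equiv> mul_add (num_stack x) (num_stack y) (num_stack z)"
abbreviation "CMP x y f \<equiv> compare (num_stack x) (num_stack y) (flag_stack f)"
abbreviation "READ st x f \<equiv> read_nat st (num_stack x) (flag_stack f)"
abbreviation "PAYOFF i j n d g \<equiv>
  get_payoff (num_stack i) (num_stack j) (num_stack n) (num_stack d) (flag_stack g)"
abbreviation "SCAN e g \<equiv> scan_eps (num_stack e) (flag_stack g)"
abbreviation "CLRS st \<equiv> clear st"
abbreviation "CPYS st st' \<equiv> copy st st'"
abbreviation "NONEMPTY st f \<equiv> IfTop st Skip (set_flag (flag_stack f)) (set_flag (flag_stack f))"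
abbreviation "IFF f P P' \<equiv> IfTop (flag_stack f) P Skip P'"
abbreviation "WHILE f P \<equiv> WhileNonempty (flag_stack f) P"

lemma small_le_unit_time: "k \<le> 100 \<Longrightarrow> k \<le> unit_time B" "l \<le> B \<Longrightarrow> 20 * l + 20 \<le> unit_time B"
  by (simp_all add: power2_eq_square)

text \<open>Each instruction rule carries the rest \<open>R\<close> of the program and describes the
  new state by its three components. A program is then executed by one rule per instruction, and the
  components are computed by rewriting.\<close>

lemma run_CLR:
  assumes "\<And>a'. nums a' = (nums a)(x := 0) \<Longrightarrow> flgs a' = flgs a \<Longrightarrow> strs a' = strs a \<Longrightarrow>
      run Or B R (n - 1) a' Q" "1 \<le> n"
  shows "run Or B (CLR x ;; R) n a Q"
proof (rule run_step[OF _ assms(1) assms(2)])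
  fix s assume s: "conc B a s"
  have "ex Or (CLR x) s (unit_time B) (s(num_stack x := bits 0))"
    by (rule ex_clearI) (use concD(7)[OF s, of x] small_le_unit_time(2)[of "length (s (num_stack x))" B] in auto)
  then show "\<exists>s'. ex Or (CLR x) s (unit_time B) s' \<and> conc B (a\<lparr>nums := (nums a)(x := 0)\<rparr>) s'"
    using conc_num[OF s, of 0 x] by auto
qed simp_all

lemma run_CLRF:
  assumes "\<And>a'. nums a' = nums a \<Longrightarrow> flgs a' = (flgs a)(f := False) \<Longrightarrow> strs a' = strs a \<Longrightarrow>
      run Or B R (n - 1) a' Q" "1 \<le> n"
  shows "run Or B (CLRF f ;; R) n a Q"
proof (rule run_step[OF _ assms(1) assms(2)])
  fix s assume s: "conc B a s"
  have "length (s (flag_stack f)) \<le> 1" unfolding concD(3)[OF s] by simp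
  then have "ex Or (CLRF f) s (unit_time B) (s(flag_stack f := flag_word False))"
    by (intro ex_clearI) (use small_le_unit_time(1)[of 3 B] in auto)
  then show "\<exists>s'. ex Or (CLRF f) s (unit_time B) s' \<and> conc B (a\<lparr>flgs := (flgs a)(f := False)\<rparr>) s'"
    using conc_flag[OF s, of f False] by auto
qed simp_all

lemma run_CLRS:
  assumes "st \<in> {0, 1, 3, 6, 7}" "\<And>a'. nums a' = nums a \<Longrightarrow> flgs a' = flgs a \<Longrightarrow> strs a' = (strs a)(st := []) \<Longrightarrow>
      run Or B R (n - 1) a' Q" "1 \<le> n"
  shows "run Or B (CLRS st ;; R) n a Q"
proof (rule run_step[OF _ assms(2) assms(3)])
  fix s assume s: "conc B a s"
  have st: "st < 8" using assms(1) by auto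
  have "ex Or (CLRS st) s (unit_time B) (s(st := []))"
    by (rule ex_clearI) (use concD(4)[OF s st] concD(5)[OF s assms(1)]
      small_le_unit_time(2)[of "length (s st)" B] in auto)
  then show "\<exists>s'. ex Or (CLRS st) s (unit_time B) s' \<and> conc B (a\<lparr>strs := (strs a)(st := [])\<rparr>) s'"
    using conc_str[OF s st, of "[]"] by auto
qed simp_all

lemma run_CPYS:
  assumes "st \<in> {0, 1, 3, 6, 7}" "st' \<in> {0, 1, 3, 6, 7}" "st \<noteq> st'" "strs a st' = []"
    "\<And>a'. nums a' = nums a \<Longrightarrow> flgs a' = flgs a \<Longrightarrow> strs a' = (strs a)(st' := strs a st) \<Longrightarrow>
      run Or B R (n - 1) a' Q" "1 \<le> n"
  shows "run Or B (CPYS st st' ;; R) n a Q"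
proof (rule run_step[OF _ assms(5) assms(6)])
  fix s assume s: "conc B a s"
  have st: "st < 8" "st' < 8" using assms(1,2) by auto
  have "ex Or (CPYS st st') s (unit_time B) (s(st' := strs a st))"
    by (rule ex_copyI) (use st assms(3,4) concD(4)[OF s st(1)] concD(4)[OF s st(2)] concD(5)[OF s assms(1)] concD(6)[OF s]
      small_le_unit_time(2)[of "length (s st)" B] in auto)
  then show "\<exists>s'. ex Or (CPYS st st') s (unit_time B) s' \<and> conc B (a\<lparr>strs := (strs a)(st' := strs a st)\<rparr>) s'"
    using conc_str[OF s st(2), of "strs a st"] concD(5)[OF s assms(1)] by blast
qed simp_all

lemma run_ONE:
  assumes "nums a x = 0" "1 \<le> B" "\<And>a'. nums a' = (nums a)(x := 1) \<Longrightarrow> flgs a' = flgs a \<Longrightarrow> strs a' = strs a \<Longrightarrow>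
      run Or B R (n - 1) a' Q" "1 \<le> n"
  shows "run Or B (ONE x ;; R) n a Q"
proof (rule run_step[OF _ assms(3) assms(4)])
  fix s assume s: "conc B a s"
  have "bits 1 = [True]" by (simp add: bits_pos)
  then have "ex Or (ONE x) s (unit_time B) (s(num_stack x := bits 1))"
    by (intro ex_Push) (use concD(1)[OF s, of x] assms(1) in auto)
  moreover have "(1::nat) < 2 ^ B" using assms(2) by (intro one_less_power) auto
  ultimately show "\<exists>s'. ex Or (ONE x) s (unit_time B) s' \<and> conc B (a\<lparr>nums := (nums a)(x := 1)\<rparr>) s'"
    using conc_num[OF s] by blast
qed simp_all

lemma run_MUL:
  assumes "x \<noteq> y" "x \<noteq> z" "nums a x + nums a y * nums a z < 2 ^ B"
    "\<And>a'. nums a' = (nums a)(x := nums a x + nums a y * nums a z) \<Longrightarrow> flgs a' = flgs a \<Longrightarrow> strs a' = strs a \<Longrightarrow>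
      run Or B R (n - 1) a' Q" "1 \<le> n"
  shows "run Or B (MUL x y z ;; R) n a Q"
proof (rule run_step[OF _ assms(4) assms(5)])
  fix s assume s: "conc B a s"
  have "ex Or (MUL x y z) s (unit_time B) (s(num_stack x := bits (nums a x + nums a y * nums a z)))"
    by (rule ex_mul_add) (use concD(1,2,6)[OF s] assms(1-3) in simp_all)
  then show "\<exists>s'. ex Or (MUL x y z) s (unit_time B) s' \<and>
      conc B (a\<lparr>nums := (nums a)(x := nums a x + nums a y * nums a z)\<rparr>) s'"
    using conc_num[OF s assms(3)] by blast
qed simp_all

lemma run_CMP:
  assumes "\<And>a'. nums a' = nums a \<Longrightarrow> flgs a' = (flgs a)(f := (flgs a f \<or> nums a y < nums a x)) \<Longrightarrow>
      strs a' = strs a \<Longrightarrow> run Or B R (n - 1) a' Q" "1 \<le> n"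
  shows "run Or B (CMP x y f ;; R) n a Q"
proof (rule run_step[OF _ assms(1) assms(2)])
  fix s assume s: "conc B a s"
  have "ex Or (CMP x y f) s (unit_time B) (s(flag_stack f := flag_word (flgs a f \<or> nums a y < nums a x)))"
    by (rule ex_compare) (use concD(1,2,3,6)[OF s] in simp_all)
  then show "\<exists>s'. ex Or (CMP x y f) s (unit_time B) s' \<and>
      conc B (a\<lparr>flgs := (flgs a)(f := (flgs a f \<or> nums a y < nums a x))\<rparr>) s'"
    using conc_flag[OF s] by blast
qed simp_all

lemma run_READ:
  assumes "st \<in> {0, 1, 3, 6, 7}"
    "\<And>a'. nums a' = (nums a)(x := rd_nat (strs a st)) \<Longrightarrow>
      flgs a' = (flgs a)(f := (flgs a f \<or> \<not> rd_ok (strs a st))) \<Longrightarrow>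
      strs a' = (strs a)(st := rd_rest (strs a st)) \<Longrightarrow> run Or B R (n - 1) a' Q" "1 \<le> n"
  shows "run Or B (READ st x f ;; R) n a Q"
proof (rule run_step[OF _ assms(2) assms(3)])
  fix s assume s: "conc B a s"
  have st: "st < 8" using assms(1) by auto
  let ?w = "strs a st"
  have w: "s st = ?w" "length ?w \<le> B" using concD(4)[OF s st] concD(5)[OF s assms(1)] by auto
  let ?s = "s(num_stack x := bits (rd_nat ?w), st := rd_rest ?w, flag_stack f := flag_word (flgs a f \<or> \<not> rd_ok ?w))"
  have "ex Or (READ st x f) s (unit_time B)
     (s(num_stack x := bits (rd_nat (s st)), st := rd_rest (s st), flag_stack f := flag_word (flgs a f \<or> \<not> rd_ok (s st))))"
    by (rule ex_read_nat) (use concD(3,6,7)[OF s] st w in simp_all)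
  then have e: "ex Or (READ st x f) s (unit_time B) ?s" unfolding w(1) .
  have "rd_nat ?w < 2 ^ B"
    using less_le_trans[OF rd_nat_less[of ?w] power_increasing[OF w(2)]] by simp
  then have "conc B (a\<lparr>nums := (nums a)(x := rd_nat ?w)\<rparr>) (s(num_stack x := bits (rd_nat ?w)))"
    by (rule conc_num[OF s])
  then have "conc B (a\<lparr>nums := (nums a)(x := rd_nat ?w), strs := (strs a)(st := rd_rest ?w)\<rparr>)
     (s(num_stack x := bits (rd_nat ?w), st := rd_rest ?w))"
    using conc_str[OF _ st, of B _ _ "rd_rest ?w"] length_rd_rest[of ?w] w(2) by force
  from conc_flag[OF this, of f "flgs a f \<or> \<not> rd_ok ?w"]
  show "\<exists>s'. ex Or (READ st x f) s (unit_time B) s' \<and>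
      conc B (a\<lparr>nums := (nums a)(x := rd_nat ?w), strs := (strs a)(st := rd_rest ?w),
        flgs := (flgs a)(f := (flgs a f \<or> \<not> rd_ok ?w))\<rparr>) s'"
    using e by (intro exI[of _ ?s]) simp
qed simp_all

lemma run_PAYOFF:
  assumes "distinct [i, j, nn, d]" "1 \<le> B"
    "Or (nat_code (nums a i) @ nat_code (nums a j)) = rat_code x" "length (rat_code x) \<le> B"
    "nat \<bar>fst (quotient_of x)\<bar> < 2 ^ B" "nat (snd (quotient_of x)) < 2 ^ B"
    "\<And>a'. nums a' = (nums a)(nn := nat \<bar>fst (quotient_of x)\<bar>, d := nat (snd (quotient_of x))) \<Longrightarrow>
      flgs a' = (flgs a)(g := (x < 0)) \<Longrightarrow> strs a' = strs a \<Longrightarrow> run Or B R (n - 1) a' Q" "1 \<le> n"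
  shows "run Or B (PAYOFF i j nn d g ;; R) n a Q"
proof (rule run_step[OF _ assms(7) assms(8)])
  fix s assume s: "conc B a s"
  let ?n = "nat \<bar>fst (quotient_of x)\<bar>" and ?d = "nat (snd (quotient_of x))"
  let ?s = "s(num_stack nn := bits ?n, num_stack d := bits ?d, flag_stack g := flag_word (x < 0))"
  have "length (s (flag_stack g)) \<le> B" unfolding concD(3)[OF s] using assms(2) by (simp add: flag_word_def)
  then have e: "ex Or (PAYOFF i j nn d g) s (unit_time B) ?s"
    by (intro ex_get_payoff[where ni = "nums a i" and nj = "nums a j"])
      (use assms(1,3,4) concD(1,2,6,7)[OF s] in \<open>simp_all add: eq_commute\<close>)
  from conc_flag[OF conc_num[OF conc_num[OF s assms(5), of nn] assms(6), of d], of g "x < 0"]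
  show "\<exists>s'. ex Or (PAYOFF i j nn d g) s (unit_time B) s' \<and>
     conc B (a\<lparr>nums := (nums a)(nn := ?n, d := ?d), flgs := (flgs a)(g := (x < 0))\<rparr>) s'"
    using e by (intro exI[of _ ?s]) simp
qed simp_all

lemma run_SCAN:
  assumes "\<And>a' w. nums a' = nums a \<Longrightarrow>
      flgs a' = (flgs a)(g := (flgs a g \<or> num_digit_within (length (bits (nums a e)) - 1) (tl (strs a 2)))) \<Longrightarrow>
      strs a' = (strs a)(2 := w) \<Longrightarrow> run Or B R (n - 1) a' Q" "1 \<le> n"
  shows "run Or B (SCAN e g ;; R) n a Q"
proof -
  let ?b = "flgs a g \<or> num_digit_within (length (bits (nums a e)) - 1) (tl (strs a 2))"
  have step: "\<exists>w. ex Or (SCAN e g) s (unit_time B) (s(2 := w, flag_stack g := flag_word ?b))" if s: "conc B a s" for s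
    using ex_scan_eps[of s "num_stack e" "nums a e" "flag_stack g" "flgs a g" B Or] concD[OF s] by simp
  have "run Or B (SCAN e g) 1 a (\<lambda>a'. \<exists>w. nums a' = nums a \<and> flgs a' = (flgs a)(g := ?b) \<and> strs a' = (strs a)(2 := w))"
    unfolding run_def
  proof (intro allI impI)
    fix s assume s: "conc B a s"
    then obtain w where w: "ex Or (SCAN e g) s (unit_time B) (s(2 := w, flag_stack g := flag_word ?b))" using step by blast
    have "conc B (a\<lparr>strs := (strs a)(2 := w), flgs := (flgs a)(g := ?b)\<rparr>) (s(2 := w, flag_stack g := flag_word ?b))"
      using conc_flag[OF conc_str[OF s, of 2 w], of g ?b] by simp
    then show "\<exists>s' a'. ex Or (SCAN e g) s (1 * unit_time B) s' \<and> conc B a' s' \<and>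
      (\<exists>w. nums a' = nums a \<and> flgs a' = (flgs a)(g := ?b) \<and> strs a' = (strs a)(2 := w))"
      using w by fastforce
  qed
  then show ?thesis by (rule run_Seq[where n' = "n - 1"]) (use assms in auto)
qed

lemma run_trunc_cert:
  assumes "strs a 7 = []" "4 * length (strs a 3) \<le> B"
    "\<And>a' w. nums a' = nums a \<Longrightarrow> flgs a' = flgs a \<Longrightarrow>
      strs a' = (strs a)(4 := w, 7 := take (4 * length (strs a 3)) (strs a 4)) \<Longrightarrow> run Or B R (n - 1) a' Q" "1 \<le> n"
  shows "run Or B (trunc_cert ;; R) n a Q"
proof -
  let ?t = "take (4 * length (strs a 3)) (strs a 4)"
  have "run Or B trunc_cert 1 a (\<lambda>a'. \<exists>w. nums a' = nums a \<and> flgs a' = flgs a \<and> strs a' = (strs a)(4 := w, 7 := ?t))"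
    unfolding run_def
  proof (intro allI impI)
    fix s assume s: "conc B a s"
    obtain w where w: "ex Or trunc_cert s (unit_time B) (s(4 := w, 7 := ?t))"
      using ex_trunc_cert[of s B Or] concD(4)[OF s, of 7] concD(4)[OF s, of 3] concD(4)[OF s, of 4] concD(6)[OF s] assms(1,2)
      by auto
    have "conc B (a\<lparr>strs := (strs a)(4 := w, 7 := ?t)\<rparr>) (s(4 := w, 7 := ?t))"
      using conc_str[OF conc_str[OF s, of 4 w], of 7 ?t] assms(2) by simp
    then show "\<exists>s' a'. ex Or trunc_cert s (1 * unit_time B) s' \<and> conc B a' s' \<and>
      (\<exists>w. nums a' = nums a \<and> flgs a' = flgs a \<and> strs a' = (strs a)(4 := w, 7 := ?t))"
      using w by fastforce
  qed
  then show ?thesis by (rule run_Seq[where n' = "n - 1"]) (use assms in auto)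
qed

lemma run_NONEMPTY:
  assumes "st < 8" "\<And>a'. nums a' = nums a \<Longrightarrow> flgs a' = (flgs a)(f := (flgs a f \<or> strs a st \<noteq> [])) \<Longrightarrow>
      strs a' = strs a \<Longrightarrow> run Or B R (n - 1) a' Q" "1 \<le> n"
  shows "run Or B (NONEMPTY st f ;; R) n a Q"
proof (rule run_step[OF _ assms(2) assms(3)])
  fix s assume s: "conc B a s"
  have "s (flag_stack f) = flag_word (flgs a f)" "s st = strs a st"
    using concD(3)[OF s] concD(4)[OF s assms(1)] by auto
  then have "effect (NONEMPTY st f) s = s(flag_stack f := flag_word (flgs a f \<or> strs a st \<noteq> []))"
    by (cases "strs a st") (auto simp: fun_eq_iff)
  then have "ex Or (NONEMPTY st f) s (unit_time B) (s(flag_stack f := flag_word (flgs a f \<or> strs a st \<noteq> [])))"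
    by (intro ex_loop_free) (use small_le_unit_time(1)[of 3 B] in auto)
  then show "\<exists>s'. ex Or (NONEMPTY st f) s (unit_time B) s' \<and>
      conc B (a\<lparr>flgs := (flgs a)(f := (flgs a f \<or> strs a st \<noteq> []))\<rparr>) s'"
    using conc_flag[OF s] by blast
qed simp_all

section \<open>The verifier\<close>

text \<open>
  The certificate lists the registers \<open>nD, \<dots>, nK\<close> in this order, followed by the integers \<open>N\<^sub>i\<^sub>j\<close>
  (\<open>nN\<close>) first column by column and then row by row, where \<open>M\<^sub>i\<^sub>j = (N\<^sub>i\<^sub>j - nO) / nD\<close>.  Some
  \<open>N\<^sub>i\<^sub>j\<close> must exceed \<open>nHi\<close> and some must be below \<open>nLo\<close>, so that \<open>(nHi - nLo) / nD\<close> bounds the range of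
  the payoffs from below.
\<close>

abbreviation (input) "nR \<equiv> 0::nat"
abbreviation (input) "nC \<equiv> 1::nat"
abbreviation (input) "nD \<equiv> 2::nat"
abbreviation (input) "nO \<equiv> 3::nat"
abbreviation (input) "nHi \<equiv> 4::nat"
abbreviation (input) "nLo \<equiv> 5::nat"
abbreviation (input) "nAl \<equiv> 6::nat"
abbreviation (input) "nBe \<equiv> 7::nat"
abbreviation (input) "nE \<equiv> 8::nat"
abbreviation (input) "nK \<equiv> 9::nat"
abbreviation (input) "nOne \<equiv> 10::nat"
abbreviation (input) "nOut \<equiv> 11::nat"
abbreviation (input) "nIn \<equiv> 12::nat"
abbreviation (input) "nX \<equiv> 13::nat"
abbreviation (input) "nN \<equiv> 14::nat"
abbreviation (input) "nAcc \<equiv> 15::nat"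
abbreviation (input) "nSum \<equiv> 16::nat"
abbreviation (input) "nNum \<equiv> 17::nat"
abbreviation (input) "nDen \<equiv> 18::nat"
abbreviation (input) "nLh \<equiv> 19::nat"
abbreviation (input) "nRh \<equiv> 20::nat"
abbreviation (input) "nOutLim \<equiv> 21::nat"
abbreviation (input) "nInLim \<equiv> 22::nat"
abbreviation (input) "fBad \<equiv> 0::nat"
abbreviation (input) "fHi \<equiv> 1::nat"
abbreviation (input) "fLo \<equiv> 2::nat"
abbreviation (input) "fEps \<equiv> 3::nat"
abbreviation (input) "fNeg \<equiv> 4::nat"
abbreviation (input) "fOuter \<equiv> 5::nat"
abbreviation (input) "fInner \<equiv> 6::nat"

text \<open>The equation between payoff and certificate is multiplied by both denominators, and the
  summand with the numerator goes to the side where it is positive, as registers hold natural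
  numbers. Equality is tested by two strict comparisons, either of which raises
  \<open>fBad\<close>.\<close>

definition verify_entry :: "nat \<Rightarrow> nat \<Rightarrow> prog" where
  "verify_entry i j = PAYOFF i j nNum nDen fNeg ;; CLR nLh ;; CLR nRh ;; MUL nLh nN nDen ;; MUL nRh nO nDen ;;
     IFF fNeg (MUL nRh nNum nD ;; Skip) (MUL nLh nNum nD ;; Skip) ;;
     CMP nLh nRh fBad ;; CMP nRh nLh fBad ;; Skip"

definition matches :: "nat \<Rightarrow> nat \<Rightarrow> nat \<Rightarrow> rat \<Rightarrow> bool" where
  "matches D C N x \<longleftrightarrow> (let n = nat \<bar>fst (quotient_of x)\<bar>; d = nat (snd (quotient_of x)) in
     if x < 0 then N * d + n * D = C * d else N * d = C * d + n * D)"

lemma rat_code_bounds: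
  assumes "length (rat_code x) \<le> l"
  shows "nat \<bar>fst (quotient_of x)\<bar> < 2 ^ l" "nat (snd (quotient_of x)) < 2 ^ l"
proof -
  let ?a = "bits (nat \<bar>fst (quotient_of x)\<bar>)" and ?b = "bits (nat (snd (quotient_of x)))"
  have "length (concat (map2 (\<lambda>d e. [d, e]) xs ys)) = 2 * min (length xs) (length ys)" for xs ys :: word
    by (induction xs ys rule: list_induct2') auto
  then have "length (rat_code x) = 1 + 2 * max (length ?a) (length ?b)"
    by (simp add: rat_code_def Let_def)
  then have "length ?a \<le> l" "length ?b \<le> l" using assms by linarith+
  then show "nat \<bar>fst (quotient_of x)\<bar> < 2 ^ l" "nat (snd (quotient_of x)) < 2 ^ l"
    using less_power_length_bits power_increasing[of _ l "2::nat"] by (meson less_le_trans one_le_numeral)+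
qed

lemma mult_less_power2: "(m::nat) < 2 ^ i \<Longrightarrow> n < 2 ^ j \<Longrightarrow> m * n < 2 ^ (i + j)"
  by (simp add: power_add mult_strict_mono)

lemma run_verify_entry:
  assumes "distinct [i, j, nNum, nDen]"
    "Or (nat_code (nums a i) @ nat_code (nums a j)) = rat_code x" "length (rat_code x) \<le> l"
    "nums a nN < 2 ^ U" "nums a nO < 2 ^ U" "nums a nD < 2 ^ U" "U + l + 1 \<le> B"
  shows "run Or B (verify_entry i j) 12 a (\<lambda>a'. (\<forall>k. k \<notin> {17, 18, 19, 20} \<longrightarrow> nums a' k = nums a k) \<and>
     (\<forall>f. f \<notin> {fBad, fNeg} \<longrightarrow> flgs a' f = flgs a f) \<and> strs a' = strs a \<and>
     flgs a' fBad = (flgs a fBad \<or> \<not> matches (nums a nD) (nums a nO) (nums a nN) x))"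
proof -
  define n where "n = nat \<bar>fst (quotient_of x)\<bar>"
  define d where "d = nat (snd (quotient_of x))"
  have nd: "n < 2 ^ l" "d < 2 ^ l" using rat_code_bounds[OF assms(3)] by (simp_all add: n_def d_def)
  have "(2::nat) ^ l \<le> 2 ^ B" "(2::nat) * 2 ^ (U + l) \<le> 2 ^ B"
    using assms(7) power_increasing[of l B "2::nat"] power_increasing[of "Suc (U + l)" B "2::nat"] by auto
  note pw = this
  have "n < 2 ^ B" "d < 2 ^ B" using nd pw(1) by linarith+
  note ndB = this
  have prods: "nums a nN * d < 2 ^ (U + l)" "nums a nO * d < 2 ^ (U + l)" "n * nums a nD < 2 ^ (U + l)"
    using mult_less_power2[OF assms(4) nd(2)] mult_less_power2[OF assms(5) nd(2)] mult_less_power2[OF nd(1) assms(6)]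
    by (simp_all add: add.commute)
  then have bnds: "nums a nN * d < 2 ^ B" "nums a nO * d < 2 ^ B"
    "nums a nN * d + n * nums a nD < 2 ^ B" "nums a nO * d + n * nums a nD < 2 ^ B"
    using pw(2) by linarith+
  show ?thesis unfolding verify_entry_def
    apply (rule run_PAYOFF[where Or = Or and a = a and i = i and j = j and x = x, OF _ _ assms(2)])
    using assms(1,7) apply simp
    using assms(7) apply simp
    using assms(3,7) apply simp
    using ndB apply (simp add: n_def)
    using ndB apply (simp add: d_def)
    apply (rule run_CLR)
     apply (rule run_CLR)
      apply (rule run_MUL, simp, simp)
        using bnds(1) apply (simp add: d_def)
       apply (rule run_MUL, simp, simp)
        using bnds(2) apply (simp add: d_def)
       \<comment> \<open>The two branches of the sign test are merged here: a conditional summand on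
         each side describes both of them.\<close>
       apply (rule_tac R = "\<lambda>a'. (\<forall>k. k \<notin> {17, 18, 19, 20} \<longrightarrow> nums a' k = nums a k) \<and>
           (\<forall>f. f \<notin> {fBad, fNeg} \<longrightarrow> flgs a' f = flgs a f) \<and> strs a' = strs a \<and> flgs a' fBad = flgs a fBad \<and>
           nums a' nLh = nums a nN * d + (if x < 0 then n * nums a nD else 0) \<and>
           nums a' nRh = nums a nO * d + (if x < 0 then 0 else n * nums a nD)" and n = 3 and n' = 3 in run_Seq)
         apply (subst numeral_3_eq_3, rule run_If)
          apply (rule run_MUL, simp, simp)
            using bnds(4) apply (simp add: d_def n_def)
           apply (rule run_Skip)
            apply (simp add: d_def n_def)
           apply simp
          apply simp
         apply (rule run_MUL, simp, simp)
           using bnds(3) apply (simp add: d_def n_def)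
          apply (rule run_Skip)
           apply (simp add: d_def n_def)
          apply simp
         apply simp
        apply (rule run_CMP)
         apply (rule run_CMP)
          apply (rule run_Skip)
           apply (auto simp: matches_def d_def[symmetric] n_def[symmetric])
    done
qed

section \<open>Checking one column or one row of the matrix\<close>

definition entry_body :: "nat \<Rightarrow> nat \<Rightarrow> prog" where
  "entry_body i j = READ 6 nX fBad ;; READ 7 nN fBad ;; MUL nAcc nX nN ;; MUL nSum nX nOne ;;
     CMP nN nHi fHi ;; CMP nLo nN fLo ;; verify_entry i j"

definition entry_post :: "rat \<Rightarrow> registers \<Rightarrow> registers \<Rightarrow> bool" where
  "entry_post x a a' \<longleftrightarrow> (let X = rd_nat (strs a 6); N = rd_nat (strs a 7) in
     (\<forall>k. k \<notin> {13..20} \<longrightarrow> nums a' k = nums a k) \<and>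
     nums a' nAcc = nums a nAcc + X * N \<and> nums a' nSum = nums a nSum + X \<and>
     strs a' = (strs a)(6 := rd_rest (strs a 6), 7 := rd_rest (strs a 7)) \<and>
     (\<forall>f. f \<notin> {fBad, fHi, fLo, fNeg} \<longrightarrow> flgs a' f = flgs a f) \<and>
     flgs a' fBad = (flgs a fBad \<or> \<not> (rd_ok (strs a 6) \<and> rd_ok (strs a 7) \<and> matches (nums a nD) (nums a nO) N x)) \<and>
     flgs a' fHi = (flgs a fHi \<or> nums a nHi < N) \<and> flgs a' fLo = (flgs a fLo \<or> N < nums a nLo))"

lemma run_entry_body:
  assumes "i \<in> {nOut, nIn}" "j \<in> {nOut, nIn}" "i \<noteq> j" "nums a nOne = 1"
    "Or (nat_code (nums a i) @ nat_code (nums a j)) = rat_code x" "length (rat_code x) \<le> l"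
    "length (strs a 7) \<le> U" "nums a nO < 2 ^ U" "nums a nD < 2 ^ U" "U + l + 1 \<le> B"
    "nums a nAcc + rd_nat (strs a 6) * rd_nat (strs a 7) < 2 ^ B" "nums a nSum + rd_nat (strs a 6) < 2 ^ B"
  shows "run Or B (entry_body i j) 18 a (entry_post x a)"
proof -
  have N: "rd_nat (strs a 7) < 2 ^ U"
    using less_le_trans[OF rd_nat_less[of "strs a 7"] power_increasing[OF assms(7)]] by simp
  show ?thesis unfolding entry_body_def
    apply (rule run_READ, simp)
     apply (rule run_READ, simp)
      apply (rule run_MUL, simp, simp)
        using assms(11) apply simp
       apply (rule run_MUL, simp, simp)
         using assms(4,12) apply simp
        apply (rule run_CMP)
         apply (rule run_CMP)
          subgoal for a1 a2 a3 a4 a5 a6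
            apply (rule run_weaken[where n = "18 - 1 - 1 - 1 - 1 - 1 - 1"])
             apply simp
             apply (rule run_verify_entry[where x = x and l = l and U = U])
            using assms N apply (auto simp: entry_post_def Let_def)
            done
         apply simp_all
    done
qed

definition rd_nth :: "word \<Rightarrow> nat \<Rightarrow> nat" where
  "rd_nth w k = rd_nat ((rd_rest ^^ k) w)"

definition rd_nth_ok :: "word \<Rightarrow> nat \<Rightarrow> bool" where
  "rd_nth_ok w k \<longleftrightarrow> rd_ok ((rd_rest ^^ k) w)"

lemma length_funpow_rd_rest: "length ((rd_rest ^^ k) w) \<le> length w"
  by (induction k) (auto intro: le_trans[OF length_rd_rest])

lemma rd_nth_less: "length w \<le> n \<Longrightarrow> rd_nth w k < 2 ^ n"
  unfolding rd_nth_def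
  by (rule less_le_trans[OF rd_nat_less power_increasing[OF le_trans[OF length_funpow_rd_rest]]]) auto

lemma sum_less_power2:
  assumes "\<And>i. f i < (2::nat) ^ n" "k \<le> m"
  shows "(\<Sum>i<k. f i) < 2 ^ (n + m)"
proof -
  have "(\<Sum>i<k. f i) \<le> k * 2 ^ n"
    using sum_bounded_above[of "{..<k}" f "2 ^ n"] assms(1) by (simp add: less_imp_le)
  also have "\<dots> < 2 ^ m * 2 ^ n"
    using le_less_trans[OF assms(2) less_exp] by (intro mult_strict_right_mono) auto
  finally show ?thesis by (simp add: power_add mult.commute)
qed

text \<open>\<open>i\<close> and \<open>j\<close> are the registers of the row and the column index;
  with \<open>nIn\<close> and \<open>nOut\<close> in either order the same code runs down a column
  or along a row. Comparisons never lower a flag, so the loop flag is lowered first and raised again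
  only if the counter is below its limit.\<close>

definition inner_loop :: "nat \<Rightarrow> nat \<Rightarrow> prog" where
  "inner_loop i j = WHILE fInner (CLRF fInner ;; entry_body i j ;; MUL nIn nOne nOne ;; CMP nInLim nIn fInner ;; Skip)"

definition entry_ok :: "(nat \<Rightarrow> nat) \<Rightarrow> word \<Rightarrow> word \<Rightarrow> (nat \<Rightarrow> rat) \<Rightarrow> nat \<Rightarrow> bool" where
  "entry_ok h y u pf k \<longleftrightarrow> rd_nth_ok y k \<and> rd_nth_ok u k \<and> matches (h nD) (h nO) (rd_nth u k) (pf k)"

definition inner_inv :: "(nat \<Rightarrow> rat) \<Rightarrow> registers \<Rightarrow> nat \<Rightarrow> registers \<Rightarrow> bool" where
  "inner_inv pf a k a' \<longleftrightarrow> (let y = strs a 6; u = strs a 7 in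
     (\<forall>m. m \<notin> {nIn} \<union> {13..20} \<longrightarrow> nums a' m = nums a m) \<and> nums a' nIn = k \<and>
     nums a' nAcc = (\<Sum>i<k. rd_nth y i * rd_nth u i) \<and> nums a' nSum = (\<Sum>i<k. rd_nth y i) \<and>
     strs a' = (strs a)(6 := (rd_rest ^^ k) y, 7 := (rd_rest ^^ k) u) \<and>
     (\<forall>f. f \<notin> {fBad, fHi, fLo, fNeg, fInner} \<longrightarrow> flgs a' f = flgs a f) \<and>
     flgs a' fInner = (k < nums a nInLim) \<and>
     flgs a' fBad = (flgs a fBad \<or> (\<exists>i<k. \<not> entry_ok (nums a) y u pf i)) \<and>
     flgs a' fHi = (flgs a fHi \<or> (\<exists>i<k. nums a nHi < rd_nth u i)) \<and>
     flgs a' fLo = (flgs a fLo \<or> (\<exists>i<k. rd_nth u i < nums a nLo)))"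

lemma inner_inv_step:
  assumes I: "inner_inv pf a k a1"
    and a2: "nums a2 = nums a1" "strs a2 = strs a1" "flgs a2 = (flgs a1)(fInner := False)"
    and post: "entry_post (pf k) a2 a3"
    and a4: "nums a4 = (nums a3)(nIn := nums a3 nIn + nums a3 nOne * nums a3 nOne)"
      "flgs a4 = (flgs a3)(fInner := (flgs a3 fInner \<or> nums a4 nIn < nums a4 nInLim))" "strs a4 = strs a3"
    and one: "nums a nOne = 1"
  shows "inner_inv pf a (Suc k) a4"
proof -
  let ?y = "strs a 6" and ?u = "strs a 7"
  have I': "\<forall>m. m \<notin> {nIn} \<union> {13..20} \<longrightarrow> nums a1 m = nums a m" "nums a1 nIn = k"
     "nums a1 nAcc = (\<Sum>i<k. rd_nth ?y i * rd_nth ?u i)" "nums a1 nSum = (\<Sum>i<k. rd_nth ?y i)"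
     "strs a1 = (strs a)(6 := (rd_rest ^^ k) ?y, 7 := (rd_rest ^^ k) ?u)"
     "\<forall>f. f \<notin> {fBad, fHi, fLo, fNeg, fInner} \<longrightarrow> flgs a1 f = flgs a f"
     "flgs a1 fBad = (flgs a fBad \<or> (\<exists>i<k. \<not> entry_ok (nums a) ?y ?u pf i))"
     "flgs a1 fHi = (flgs a fHi \<or> (\<exists>i<k. nums a nHi < rd_nth ?u i))"
     "flgs a1 fLo = (flgs a fLo \<or> (\<exists>i<k. rd_nth ?u i < nums a nLo))"
    using I unfolding inner_inv_def Let_def by blast+
  have s1: "strs a1 6 = (rd_rest ^^ k) ?y" "strs a1 7 = (rd_rest ^^ k) ?u" using I'(5) by simp_all
  have h: "nums a1 nD = nums a nD" "nums a1 nO = nums a nO" "nums a1 nHi = nums a nHi"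
      "nums a1 nLo = nums a nLo" "nums a1 nOne = 1" "nums a1 nInLim = nums a nInLim"
    using I'(1) one by simp_all
  have P: "\<forall>m. m \<notin> {13..20} \<longrightarrow> nums a3 m = nums a1 m"
     "nums a3 nAcc = nums a1 nAcc + rd_nth ?y k * rd_nth ?u k" "nums a3 nSum = nums a1 nSum + rd_nth ?y k"
     "strs a3 = (strs a1)(6 := rd_rest ((rd_rest ^^ k) ?y), 7 := rd_rest ((rd_rest ^^ k) ?u))"
     "\<forall>f. f \<notin> {fBad, fHi, fLo, fNeg} \<longrightarrow> flgs a3 f = ((flgs a1)(fInner := False)) f"
     "flgs a3 fBad = (flgs a1 fBad \<or> \<not> entry_ok (nums a) ?y ?u pf k)"
     "flgs a3 fHi = (flgs a1 fHi \<or> nums a nHi < rd_nth ?u k)" "flgs a3 fLo = (flgs a1 fLo \<or> rd_nth ?u k < nums a nLo)"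
    using post unfolding entry_post_def Let_def a2 s1 h entry_ok_def rd_nth_def rd_nth_ok_def by auto
  have n3: "nums a3 nIn = k" "nums a3 nOne = 1" "nums a3 nInLim = nums a nInLim" using P(1) I'(2) h by simp_all
  show ?thesis unfolding inner_inv_def Let_def
  proof (intro conjI)
    show "\<forall>m. m \<notin> {nIn} \<union> {13..20} \<longrightarrow> nums a4 m = nums a m"
      using I'(1) P(1) a4(1) by simp
    show "strs a4 = (strs a)(6 := (rd_rest ^^ Suc k) ?y, 7 := (rd_rest ^^ Suc k) ?u)"
      unfolding a4(3) P(4) I'(5) by (intro ext) simp
    show "\<forall>f. f \<notin> {fBad, fHi, fLo, fNeg, fInner} \<longrightarrow> flgs a4 f = flgs a f"
      using I'(6) P(5) a4(2) by simp
    show "flgs a4 fInner = (Suc k < nums a nInLim)" using P(5) a4(1,2) n3 by simp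
    show "flgs a4 fBad = (flgs a fBad \<or> (\<exists>i<Suc k. \<not> entry_ok (nums a) ?y ?u pf i))"
      using a4(2) P(6) I'(7) by (auto simp: less_Suc_eq)
    show "flgs a4 fHi = (flgs a fHi \<or> (\<exists>i<Suc k. nums a nHi < rd_nth ?u i))"
      using a4(2) P(7) I'(8) by (auto simp: less_Suc_eq)
    show "flgs a4 fLo = (flgs a fLo \<or> (\<exists>i<Suc k. rd_nth ?u i < nums a nLo))"
      using a4(2) P(8) I'(9) by (auto simp: less_Suc_eq)
  qed (use a4(1) n3 P(2,3) I'(3,4) in simp_all)
qed

lemma run_inner_loop:
  assumes ij: "i \<in> {nOut, nIn}" "j \<in> {nOut, nIn}" "i \<noteq> j" and a: "nums a nOne = 1"
    "nums a nIn = 0" "nums a nAcc = 0" "nums a nSum = 0" "flgs a fInner = (0 < nums a nInLim)"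
    and orc: "\<And>k. k < nums a nInLim \<Longrightarrow> Or (nat_code (((nums a)(nIn := k)) i) @ nat_code (((nums a)(nIn := k)) j)) = rat_code (pf k)"
    and len: "\<And>k. k < nums a nInLim \<Longrightarrow> length (rat_code (pf k)) \<le> l"
    and bnd: "length (strs a 7) \<le> U" "length (strs a 6) \<le> Y" "nums a nO < 2 ^ U" "nums a nD < 2 ^ U"
      "U + Y + l + nums a nInLim + 1 \<le> B"
  shows "run Or B (inner_loop i j) (nums a nInLim * 26 + 1) a (inner_inv pf a (nums a nInLim))"
proof -
  let ?n = "nums a nInLim"
  have "run Or B (inner_loop i j) (?n * (25 + 1) + 1) a (inner_inv pf a ?n)"
    unfolding inner_loop_def
  proof (rule run_while)
    show "inner_inv pf a 0 a" using a by (simp add: inner_inv_def Let_def fun_upd_idem)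
  next
    fix a' assume "inner_inv pf a ?n a'"
    then show "\<not> flgs a' fInner" by (simp add: inner_inv_def Let_def)
  next
    fix k a1 assume k: "k < ?n" and I: "inner_inv pf a k a1"
    have f: "flgs a1 fInner" using I k by (simp add: inner_inv_def Let_def)
    let ?y = "strs a 6" and ?u = "strs a 7"
    have B1: "(\<Sum>i<Suc k. rd_nth ?y i * rd_nth ?u i) < 2 ^ B"
    proof -
      have "rd_nth ?y i * rd_nth ?u i < 2 ^ (Y + U)" for i
        using rd_nth_less[OF bnd(1), of i] rd_nth_less[OF bnd(2), of i] by (intro mult_less_power2)
      then have "(\<Sum>i<Suc k. rd_nth ?y i * rd_nth ?u i) < 2 ^ (Y + U + ?n)"
        using k by (intro sum_less_power2) auto
      also have "\<dots> \<le> (2::nat) ^ B" using bnd(5) by (intro power_increasing) auto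
      finally show ?thesis .
    qed
    have B2: "(\<Sum>i<Suc k. rd_nth ?y i) < 2 ^ B"
    proof -
      have "(\<Sum>i<Suc k. rd_nth ?y i) < 2 ^ (Y + ?n)"
        using k rd_nth_less[OF bnd(2)] by (intro sum_less_power2) auto
      also have "\<dots> \<le> (2::nat) ^ B" using bnd(5) by (intro power_increasing) auto
      finally show ?thesis .
    qed
    have "?n < 2 ^ ?n" by (rule less_exp)
    also have "(2::nat) ^ ?n \<le> 2 ^ B" using bnd(5) by (intro power_increasing) auto
    finally have nB: "?n < 2 ^ B" .
    have nums1: "nums a1 nD = nums a nD" "nums a1 nO = nums a nO" "nums a1 nHi = nums a nHi"
      "nums a1 nLo = nums a nLo" "nums a1 nOne = 1" "nums a1 nInLim = ?n"
      "nums a1 nOut = nums a nOut" "nums a1 nIn = k" "nums a1 nAcc = (\<Sum>i<k. rd_nth ?y i * rd_nth ?u i)"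
      "nums a1 nSum = (\<Sum>i<k. rd_nth ?y i)"
      "strs a1 6 = (rd_rest ^^ k) ?y" "strs a1 7 = (rd_rest ^^ k) ?u"
      using I a(1) by (simp_all add: inner_inv_def Let_def)
    have body: "run Or B (entry_body i j) 18 a' (entry_post (pf k) a')"
      if eq: "nums a' = nums a1" "strs a' = strs a1" for a'
    proof (rule run_entry_body[OF ij])
      have "nums a1 m = ((nums a)(nIn := k)) m" if "m \<in> {nOut, nIn}" for m
        using that nums1 by auto
      then show "Or (nat_code (nums a' i) @ nat_code (nums a' j)) = rat_code (pf k)"
        using orc[OF k] ij eq by simp
      show "length (rat_code (pf k)) \<le> l" by (rule len[OF k])
      show "length (strs a' 7) \<le> U" using length_funpow_rd_rest[of k ?u] bnd(1) eq nums1 by simp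
    qed (use eq nums1 bnd B1 B2 in \<open>simp_all add: rd_nth_def\<close>)
    have "run Or B (CLRF fInner ;; entry_body i j ;; MUL nIn nOne nOne ;; CMP nInLim nIn fInner ;; Skip) 25 a1 (inner_inv pf a (Suc k))"
      apply (rule run_CLRF)
       apply (rule run_Seq[OF body, where n' = 5])
          apply simp
         apply simp
        apply (rule run_MUL, simp, simp)
          subgoal using nB nums1 k by (simp add: entry_post_def Let_def)
         apply (rule run_CMP)
          apply (rule run_Skip)
           subgoal for a' a3 a4 a5
             using a(1) by (intro inner_inv_step[OF I, of a' a3]) simp_all
          apply simp_all
      done
    then show "flgs a1 fInner \<and> run Or B (CLRF fInner ;; entry_body i j ;; MUL nIn nOne nOne ;; CMP nInLim nIn fInner ;; Skip) 25 a1 (inner_inv pf a (Suc k))"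
      using f by simp
  qed
  then show ?thesis by simp
qed

section \<open>Running over all columns or all rows\<close>

definition outer_body :: "nat \<Rightarrow> nat \<Rightarrow> nat \<Rightarrow> nat \<Rightarrow> prog" where
  "outer_body i j cx cy = CLRF fOuter ;; CLRS 6 ;; CPYS 3 6 ;; CLR nIn ;; CLR nAcc ;; CLR nSum ;; CLRF fInner ;;
     CMP nInLim nIn fInner ;; inner_loop i j ;; CMP cx cy fBad ;; CMP nSum nK fBad ;; CMP nK nSum fBad ;;
     MUL nOut nOne nOne ;; CMP nOutLim nOut fOuter ;; Skip"

text \<open>\<open>cx\<close> and \<open>cy\<close> fix the direction of the test
  \<open>cx \<le> cy\<close>: column sums at most \<open>nAl\<close> for the row player's weights,
  row sums at least \<open>nBe\<close> for the column player's. The weights are copied afresh from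
  stream 3 for every line, while stream 7 simply advances.\<close>

definition phase :: "nat \<Rightarrow> nat \<Rightarrow> nat \<Rightarrow> nat \<Rightarrow> prog" where
  "phase i j cx cy = CLR nOut ;; CLRF fOuter ;; CMP nOutLim nOut fOuter ;; WHILE fOuter (outer_body i j cx cy)"

definition line_sum :: "word \<Rightarrow> word \<Rightarrow> nat \<Rightarrow> nat" where
  "line_sum y u n = (\<Sum>i<n. rd_nth y i * rd_nth u i)"

definition line_ok :: "nat \<Rightarrow> nat \<Rightarrow> (nat \<Rightarrow> nat) \<Rightarrow> word \<Rightarrow> word \<Rightarrow> (nat \<Rightarrow> rat) \<Rightarrow> nat \<Rightarrow> bool" where
  "line_ok cx cy h y u pf n \<longleftrightarrow> (\<forall>i<n. entry_ok h y u pf i) \<and>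
     (h(nAcc := line_sum y u n)) cx \<le> (h(nAcc := line_sum y u n)) cy \<and> (\<Sum>i<n. rd_nth y i) = h nK"

text \<open>\<open>v m\<close> is the position of the \<open>m\<close>-th line in stream 7. Stream 6
  is described only after the first line: what is left there follows the weights just used, which is
  how the other player's weights are found later.\<close>

definition outer_inv :: "nat \<Rightarrow> nat \<Rightarrow> (nat \<Rightarrow> nat \<Rightarrow> rat) \<Rightarrow> registers \<Rightarrow> nat \<Rightarrow> registers \<Rightarrow> bool" where
  "outer_inv cx cy pf a k a' \<longleftrightarrow> (let y = strs a 3; u = strs a 7; n = nums a nInLim; v = (\<lambda>m. (rd_rest ^^ (m * n)) u) in
     (\<forall>m. m \<notin> {nOut, nIn} \<union> {13..20} \<longrightarrow> nums a' m = nums a m) \<and> nums a' nOut = k \<and>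
     strs a' 3 = y \<and> strs a' 7 = v k \<and> (0 < k \<longrightarrow> strs a' 6 = (rd_rest ^^ n) y) \<and>
     (\<forall>f. f \<notin> {fBad, fHi, fLo, fNeg, fOuter, fInner} \<longrightarrow> flgs a' f = flgs a f) \<and>
     flgs a' fOuter = (k < nums a nOutLim) \<and>
     flgs a' fBad = (flgs a fBad \<or> (\<exists>m<k. \<not> line_ok cx cy (nums a) y (v m) (pf m) n)) \<and>
     flgs a' fHi = (flgs a fHi \<or> (\<exists>m<k. \<exists>i<n. nums a nHi < rd_nth (v m) i)) \<and>
     flgs a' fLo = (flgs a fLo \<or> (\<exists>m<k. \<exists>i<n. rd_nth (v m) i < nums a nLo)))"

lemma outer_inv_step:
  assumes I: "outer_inv cx cy pf a k a1" and c: "cx \<in> {nAcc, nAl, nBe}" "cy \<in> {nAcc, nAl, nBe}"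
    and a2: "nums a2 = (nums a1)(nIn := 0, nAcc := 0, nSum := 0)" "strs a2 = (strs a1)(6 := strs a1 3)"
      "flgs a2 = (flgs a1)(fOuter := False, fInner := b)"
    and post: "inner_inv (pf k) a2 (nums a nInLim) a3"
    and a4: "nums a4 = (nums a3)(nOut := nums a3 nOut + nums a3 nOne * nums a3 nOne)"
      "flgs a4 = (flgs a3)(fBad := flgs a3 fBad \<or> nums a3 cy < nums a3 cx \<or> nums a3 nK < nums a3 nSum \<or> nums a3 nSum < nums a3 nK,
         fOuter := (flgs a3 fOuter \<or> nums a4 nOut < nums a4 nOutLim))" "strs a4 = strs a3"
    and one: "nums a nOne = 1"
  shows "outer_inv cx cy pf a (Suc k) a4"
proof -
  let ?y = "strs a 3" and ?n = "nums a nInLim"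
  define v where "v = (\<lambda>m. (rd_rest ^^ (m * ?n)) (strs a 7))"
  have I': "\<forall>m. m \<notin> {nOut, nIn} \<union> {13..20} \<longrightarrow> nums a1 m = nums a m" "nums a1 nOut = k"
     "strs a1 3 = ?y" "strs a1 7 = v k"
     "\<forall>f. f \<notin> {fBad, fHi, fLo, fNeg, fOuter, fInner} \<longrightarrow> flgs a1 f = flgs a f"
     "flgs a1 fBad = (flgs a fBad \<or> (\<exists>m<k. \<not> line_ok cx cy (nums a) ?y (v m) (pf m) ?n))"
     "flgs a1 fHi = (flgs a fHi \<or> (\<exists>m<k. \<exists>i<?n. nums a nHi < rd_nth (v m) i))"
     "flgs a1 fLo = (flgs a fLo \<or> (\<exists>m<k. \<exists>i<?n. rd_nth (v m) i < nums a nLo))"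
    using I unfolding outer_inv_def Let_def v_def by blast+
  have s2: "strs a2 6 = ?y" "strs a2 7 = v k" "strs a2 3 = ?y" using a2(2) I'(3,4) by simp_all
  have h: "nums a2 nD = nums a nD" "nums a2 nO = nums a nO" "nums a2 nHi = nums a nHi"
      "nums a2 nLo = nums a nLo" "nums a2 nOne = 1" "nums a2 nInLim = ?n" "nums a2 nOutLim = nums a nOutLim"
      "nums a2 nK = nums a nK" "nums a2 nAl = nums a nAl" "nums a2 nBe = nums a nBe" "nums a2 nOut = k"
    using I'(1,2) one a2(1) by simp_all
  have P: "\<forall>m. m \<notin> {nIn} \<union> {13..20} \<longrightarrow> nums a3 m = nums a2 m"
     "nums a3 nAcc = line_sum ?y (v k) ?n" "nums a3 nSum = (\<Sum>i<?n. rd_nth ?y i)"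
     "strs a3 = (strs a2)(6 := (rd_rest ^^ ?n) ?y, 7 := (rd_rest ^^ ?n) (v k))"
     "\<forall>f. f \<notin> {fBad, fHi, fLo, fNeg, fInner} \<longrightarrow> flgs a3 f = flgs a2 f"
     "flgs a3 fBad = (flgs a1 fBad \<or> (\<exists>i<?n. \<not> entry_ok (nums a2) ?y (v k) (pf k) i))"
     "flgs a3 fHi = (flgs a1 fHi \<or> (\<exists>i<?n. nums a nHi < rd_nth (v k) i))"
     "flgs a3 fLo = (flgs a1 fLo \<or> (\<exists>i<?n. rd_nth (v k) i < nums a nLo))"
    using post unfolding inner_inv_def Let_def s2 h line_sum_def a2(3) by simp_all
  have n3: "nums a3 nOut = k" "nums a3 nOne = 1" "nums a3 nOutLim = nums a nOutLim" "nums a3 nK = nums a nK"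
     "nums a3 nAl = nums a nAl" "nums a3 nBe = nums a nBe"
    using P(1) h by simp_all
  have e: "entry_ok (nums a2) = entry_ok (nums a)" using h(1,2) by (simp add: entry_ok_def fun_eq_iff)
  have cc: "nums a3 cx = ((nums a)(nAcc := line_sum ?y (v k) ?n)) cx" "nums a3 cy = ((nums a)(nAcc := line_sum ?y (v k) ?n)) cy"
    using c P(2) n3 by auto
  have vS: "(rd_rest ^^ ?n) (v k) = v (Suc k)" by (simp add: v_def funpow_add)
  have "outer_inv cx cy pf a (Suc k) a4 \<longleftrightarrow>
     (\<forall>m. m \<notin> {nOut, nIn} \<union> {13..20} \<longrightarrow> nums a4 m = nums a m) \<and> nums a4 nOut = Suc k \<and>
     strs a4 3 = ?y \<and> strs a4 7 = v (Suc k) \<and> (0 < Suc k \<longrightarrow> strs a4 6 = (rd_rest ^^ ?n) ?y) \<and>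
     (\<forall>f. f \<notin> {fBad, fHi, fLo, fNeg, fOuter, fInner} \<longrightarrow> flgs a4 f = flgs a f) \<and>
     flgs a4 fOuter = (Suc k < nums a nOutLim) \<and>
     flgs a4 fBad = (flgs a fBad \<or> (\<exists>m<Suc k. \<not> line_ok cx cy (nums a) ?y (v m) (pf m) ?n)) \<and>
     flgs a4 fHi = (flgs a fHi \<or> (\<exists>m<Suc k. \<exists>i<?n. nums a nHi < rd_nth (v m) i)) \<and>
     flgs a4 fLo = (flgs a fLo \<or> (\<exists>m<Suc k. \<exists>i<?n. rd_nth (v m) i < nums a nLo))"
    unfolding outer_inv_def Let_def v_def by (rule refl)
  also have \<dots>
  proof (intro conjI)
    show "\<forall>m. m \<notin> {nOut, nIn} \<union> {13..20} \<longrightarrow> nums a4 m = nums a m"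
      using I'(1) P(1) a4(1) a2(1) by simp
    show "nums a4 nOut = Suc k" using a4(1) n3 by simp
    show "strs a4 3 = ?y" "strs a4 7 = v (Suc k)" "0 < Suc k \<longrightarrow> strs a4 6 = (rd_rest ^^ ?n) ?y"
      unfolding a4(3) P(4) vS using s2 by simp_all
    show "\<forall>f. f \<notin> {fBad, fHi, fLo, fNeg, fOuter, fInner} \<longrightarrow> flgs a4 f = flgs a f"
      using I'(5) P(5) a4(2) a2(3) by simp
    show "flgs a4 fOuter = (Suc k < nums a nOutLim)" using P(5) a4(1,2) a2(3) n3 by simp
    have "(flgs a3 fBad \<or> nums a3 cy < nums a3 cx \<or> nums a3 nK < nums a3 nSum \<or> nums a3 nSum < nums a3 nK) =
        (flgs a1 fBad \<or> \<not> line_ok cx cy (nums a) ?y (v k) (pf k) ?n)"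
      unfolding line_ok_def P(3,6) cc n3 e by auto
    then show "flgs a4 fBad = (flgs a fBad \<or> (\<exists>m<Suc k. \<not> line_ok cx cy (nums a) ?y (v m) (pf m) ?n))"
      using a4(2) I'(6) by (auto simp: less_Suc_eq)
    show "flgs a4 fHi = (flgs a fHi \<or> (\<exists>m<Suc k. \<exists>i<?n. nums a nHi < rd_nth (v m) i))"
      using a4(2) P(7) I'(7) by (auto simp: less_Suc_eq)
    show "flgs a4 fLo = (flgs a fLo \<or> (\<exists>m<Suc k. \<exists>i<?n. rd_nth (v m) i < nums a nLo))"
      using a4(2) P(8) I'(8) by (auto simp: less_Suc_eq)
  qed
  finally show ?thesis .
qed

lemma run_phase:
  assumes ij: "i \<in> {nOut, nIn}" "j \<in> {nOut, nIn}" "i \<noteq> j"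
    and c: "cx \<in> {nAcc, nAl, nBe}" "cy \<in> {nAcc, nAl, nBe}" and one: "nums a nOne = 1"
    and orc: "\<And>m k. m < nums a nOutLim \<Longrightarrow> k < nums a nInLim \<Longrightarrow>
      Or (nat_code (((nums a)(nOut := m, nIn := k)) i) @ nat_code (((nums a)(nOut := m, nIn := k)) j)) = rat_code (pf m k)"
    and len: "\<And>m k. m < nums a nOutLim \<Longrightarrow> k < nums a nInLim \<Longrightarrow> length (rat_code (pf m k)) \<le> l"
    and bnd: "length (strs a 7) \<le> U" "length (strs a 3) \<le> Y" "nums a nO < 2 ^ U" "nums a nD < 2 ^ U"
      "U + Y + l + nums a nInLim + nums a nOutLim + 1 \<le> B"
  shows "run Or B (phase i j cx cy) (nums a nOutLim * (nums a nInLim * 26 + 22) + 4) a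
     (outer_inv cx cy pf a (nums a nOutLim))"
proof -
  let ?n = "nums a nInLim" and ?N = "nums a nOutLim"
  have loop: "run Or B (WHILE fOuter (outer_body i j cx cy)) (?N * ((?n * 26 + 21) + 1) + 1) a0 (outer_inv cx cy pf a ?N)"
    if "outer_inv cx cy pf a 0 a0" for a0
  proof (rule run_while)
    show "outer_inv cx cy pf a 0 a0" by fact
  next
    fix a' assume "outer_inv cx cy pf a ?N a'"
    then show "\<not> flgs a' fOuter" by (simp add: outer_inv_def Let_def)
  next
    fix k a1 assume k: "k < ?N" and I: "outer_inv cx cy pf a k a1"
    have f: "flgs a1 fOuter" using I k by (simp add: outer_inv_def Let_def)
    have nums1: "nums a1 nD = nums a nD" "nums a1 nO = nums a nO" "nums a1 nOne = 1" "nums a1 nInLim = ?n"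
      "nums a1 nOut = k" "nums a1 nOutLim = ?N" "strs a1 3 = strs a 3" "strs a1 7 = (rd_rest ^^ (k * ?n)) (strs a 7)"
      using I one by (simp_all add: outer_inv_def Let_def)
    have "?N < 2 ^ ?N" by (rule less_exp)
    also have "(2::nat) ^ ?N \<le> 2 ^ B" using bnd(5) by (intro power_increasing) auto
    finally have nB: "?N < 2 ^ B" .
    have inner: "run Or B (inner_loop i j) (?n * 26 + 1) a2 (inner_inv (pf k) a2 ?n)"
      if a2: "nums a2 = (nums a1)(nIn := 0, nAcc := 0, nSum := 0)" "strs a2 = (strs a1)(6 := strs a1 3)"
        "flgs a2 fInner = (0 < ?n)" for a2
    proof -
      have n: "nums a2 nInLim = ?n" using a2 nums1 by simp
      have "run Or B (inner_loop i j) (nums a2 nInLim * 26 + 1) a2 (inner_inv (pf k) a2 (nums a2 nInLim))"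
      proof (rule run_inner_loop[OF ij, where l = l and U = U and Y = Y])
        fix m assume m: "m < nums a2 nInLim"
        have "((nums a2)(nIn := m)) x = ((nums a)(nOut := k, nIn := m)) x" if "x \<in> {nOut, nIn}" for x
          using that a2 nums1 by auto
        then show "Or (nat_code (((nums a2)(nIn := m)) i) @ nat_code (((nums a2)(nIn := m)) j)) = rat_code (pf k m)"
          using orc[OF k, of m] ij m n by simp
        show "length (rat_code (pf k m)) \<le> l" using len[OF k, of m] m n by simp
      next
        show "length (strs a2 7) \<le> U"
          using length_funpow_rd_rest[of "k * ?n" "strs a 7"] bnd(1) a2 nums1 by simp
      qed (use a2 nums1 bnd in simp_all)
      then show ?thesis unfolding n .
    qed
    have "run Or B (outer_body i j cx cy) (?n * 26 + 21) a1 (outer_inv cx cy pf a (Suc k))"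
      unfolding outer_body_def
      apply (rule run_CLRF)
       apply (rule run_CLRS, simp)
        apply (rule run_CPYS, simp, simp, simp, simp)
         apply (rule run_CLR)
          apply (rule run_CLR)
           apply (rule run_CLR)
            apply (rule run_CLRF)
             apply (rule run_CMP)
              subgoal for a2 a3 a4 a5 a6 a7 a8 a9
                apply (rule run_Seq[OF inner, where n' = 7])
                    apply (simp add: fun_eq_iff)
                   apply (simp add: fun_eq_iff)
                  apply (simp add: nums1)
                 apply (rule run_CMP)
                  apply (rule run_CMP)
                   apply (rule run_CMP)
                    apply (rule run_MUL, simp, simp)
                      subgoal using nB nums1 k by (simp add: inner_inv_def Let_def)
                     apply (rule run_CMP)
                      apply (rule run_Skip)
                       subgoal for b1 b2 b3 b4 b5 b6
                         apply (rule outer_inv_step[OF I c, of a9 "0 < ?n" b1])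
                         using one nums1 apply (simp_all add: fun_eq_iff)
                         done
                      apply simp_all
                done
             apply simp_all
      done
    then show "flgs a1 fOuter \<and> run Or B (outer_body i j cx cy) (?n * 26 + 21) a1 (outer_inv cx cy pf a (Suc k))"
      using f by simp
  qed
  show ?thesis unfolding phase_def
    apply (rule run_CLR)
     apply (rule run_CLRF)
      apply (rule run_CMP)
       subgoal for a1 a2 a3
         \<comment> \<open>The time bound of \<open>loop\<close> and the time left after three
           instructions are the same number in different form.\<close>
         apply (rule run_weaken[where n = "(?N * ((?n * 26 + 21) + 1) + 1)", THEN back_subst[where P = "\<lambda>n. run Or B _ n _ _"]])
           apply (rule loop)
           apply (simp add: outer_inv_def Let_def)
          apply simp
         apply simp
         done
      apply simp_all
    done
qed

lemma run_mono: "run Or B P n a Q \<Longrightarrow> n \<le> m \<Longrightarrow> run Or B P m a Q"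
  unfolding run_def by (meson ex_mono mult_le_mono1)

section \<open>Header, change of players and final inequality\<close>

fun read_block :: "nat \<Rightarrow> nat \<Rightarrow> prog" where
  "read_block 0 x = Skip"
| "read_block (Suc n) x = READ 7 x fBad ;; read_block n (Suc x)"

lemma rd_nth_0: "rd_nth w 0 = rd_nat w" "rd_nth_ok w 0 = rd_ok w"
  by (simp_all add: rd_nth_def rd_nth_ok_def)

lemma rd_nth_Suc: "rd_nth w (Suc k) = rd_nth (rd_rest w) k" "rd_nth_ok w (Suc k) = rd_nth_ok (rd_rest w) k"
  by (simp_all add: rd_nth_def rd_nth_ok_def funpow_swap1)

lemma run_read_block:
  "run Or B (read_block n x) (Suc n) a (\<lambda>a'.
     nums a' = (\<lambda>k. if x \<le> k \<and> k < x + n then rd_nth (strs a 7) (k - x) else nums a k) \<and>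
     flgs a' = (flgs a)(fBad := (flgs a fBad \<or> (\<exists>k<n. \<not> rd_nth_ok (strs a 7) k))) \<and>
     strs a' = (strs a)(7 := (rd_rest ^^ n) (strs a 7)))"
proof (induction n arbitrary: x a)
  case 0
  show ?case by (simp, rule run_Skip) (auto simp: fun_eq_iff)
next
  case (Suc n)
  show ?case unfolding read_block.simps
  proof (rule run_READ)
    fix a1 :: registers assume a1: "nums a1 = (nums a)(x := rd_nat (strs a 7))"
      "flgs a1 = (flgs a)(fBad := (flgs a fBad \<or> \<not> rd_ok (strs a 7)))"
      "strs a1 = (strs a)(7 := rd_rest (strs a 7))"
    have "run Or B (read_block n (Suc x)) (Suc n) a1 (\<lambda>a'.
     nums a' = (\<lambda>k. if x \<le> k \<and> k < x + Suc n then rd_nth (strs a 7) (k - x) else nums a k) \<and>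
     flgs a' = (flgs a)(fBad := (flgs a fBad \<or> (\<exists>k<Suc n. \<not> rd_nth_ok (strs a 7) k))) \<and>
     strs a' = (strs a)(7 := (rd_rest ^^ Suc n) (strs a 7)))"
    proof (rule run_weaken[OF Suc.IH])
      fix a' assume a': "nums a' = (\<lambda>k. if Suc x \<le> k \<and> k < Suc x + n then rd_nth (strs a1 7) (k - Suc x) else nums a1 k) \<and>
         flgs a' = (flgs a1)(fBad := (flgs a1 fBad \<or> (\<exists>k<n. \<not> rd_nth_ok (strs a1 7) k))) \<and>
         strs a' = (strs a1)(7 := (rd_rest ^^ n) (strs a1 7))"
      have 1: "nums a' k = (if x \<le> k \<and> k < x + Suc n then rd_nth (strs a 7) (k - x) else nums a k)" for k
      proof (cases "k = x")
        case False
        then show ?thesis using a' a1 rd_nth_Suc(1)[of "strs a 7" "k - Suc x"] by (auto simp: Suc_diff_Suc)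
      qed (use a' a1 in \<open>simp add: rd_nth_0\<close>)
      have 2: "(\<exists>k<Suc n. \<not> rd_nth_ok (strs a 7) k) = (\<not> rd_ok (strs a 7) \<or> (\<exists>k<n. \<not> rd_nth_ok (strs a1 7) k))"
        using a1 by (auto simp: less_Suc_eq_0_disj rd_nth_0 rd_nth_Suc)
      have 3: "(rd_rest ^^ Suc n) (strs a 7) = (rd_rest ^^ n) (strs a1 7)"
        using a1 by (simp add: funpow_swap1)
      show "nums a' = (\<lambda>k. if x \<le> k \<and> k < x + Suc n then rd_nth (strs a 7) (k - x) else nums a k) \<and>
        flgs a' = (flgs a)(fBad := (flgs a fBad \<or> (\<exists>k<Suc n. \<not> rd_nth_ok (strs a 7) k))) \<and>
        strs a' = (strs a)(7 := (rd_rest ^^ Suc n) (strs a 7))"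
        unfolding 2 3 using 1 a' a1 by (auto simp: fun_eq_iff)
    qed
    then show "run Or B (read_block n (Suc x)) (Suc (Suc n) - 1) a1 (\<lambda>a'.
     nums a' = (\<lambda>k. if x \<le> k \<and> k < x + Suc n then rd_nth (strs a 7) (k - x) else nums a k) \<and>
     flgs a' = (flgs a)(fBad := (flgs a fBad \<or> (\<exists>k<Suc n. \<not> rd_nth_ok (strs a 7) k))) \<and>
     strs a' = (strs a)(7 := (rd_rest ^^ Suc n) (strs a 7)))" by simp
  qed simp_all
qed

text \<open>The comparisons with 1 reject a zero in \<open>nK\<close>, \<open>nD\<close> or
  \<open>nE\<close>, which are denominators in the meaning of the certificate. The last two
  multiplications copy the loop limits, with the columns as outer loop.\<close>

definition verifier_init :: prog where
  "verifier_init = trunc_cert ;; READ 0 nR fBad ;; READ 1 nC fBad ;; read_block 8 2 ;;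
     ONE nOne ;; CMP nOne nK fBad ;; CMP nOne nD fBad ;; CMP nOne nE fBad ;; SCAN nE fEps ;;
     MUL nOutLim nC nOne ;; MUL nInLim nR nOne ;; Skip"

text \<open>After the first phase stream 6 starts with the column player's weights. It becomes the
  new master copy, and rows and columns exchange their places in the loop limits.\<close>

definition verifier_switch :: prog where
  "verifier_switch = CLR nOutLim ;; CLR nInLim ;; MUL nOutLim nR nOne ;; MUL nInLim nC nOne ;; CLRS 3 ;; CPYS 6 3 ;; Skip"

text \<open>Letters left in stream 6 would follow the last weight and are rejected. If the scan of
  the precision or one of the threshold tests has failed, both thresholds are set to 0, and the
  inequality then demands \<open>Al \<le> Be\<close>, as \<open>E\<close> is positive.\<close>

definition verifier_final :: prog where
  "verifier_final = NONEMPTY 6 fBad ;;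
     IFF fEps (CLR nHi ;; CLR nLo ;; Skip) (IFF fHi (CLR nHi ;; CLR nLo ;; Skip) (IFF fLo (CLR nHi ;; CLR nLo ;; Skip) Skip)) ;;
     CLR nLh ;; CLR nRh ;; MUL nLh nE nAl ;; MUL nLh nK nLo ;; MUL nRh nE nBe ;; MUL nRh nK nHi ;; CMP nLh nRh fBad ;; Skip"

definition verifier :: prog where
  "verifier = (verifier_init ;; phase nIn nOut nAcc nAl ;; verifier_switch ;; phase nOut nIn nBe nAcc ;; verifier_final) ;;
     clear 0 ;; IfTop (flag_stack fBad) (Push 0 True) Skip Skip"

definition header :: "word \<Rightarrow> nat \<Rightarrow> nat" where
  "header w k = rd_nth w (k - 2)"

definition init_post :: "nat \<Rightarrow> nat \<Rightarrow> word \<Rightarrow> word \<Rightarrow> word \<Rightarrow> registers \<Rightarrow> bool" where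
  "init_post r c e y w a \<longleftrightarrow> nums a nR = r \<and> nums a nC = c \<and> (\<forall>k\<in>{2..9}. nums a k = header w k) \<and>
     nums a nOne = 1 \<and> nums a nOutLim = c \<and> nums a nInLim = r \<and>
     flgs a fBad = (\<not> ((\<forall>k<8. rd_nth_ok w k) \<and> 1 \<le> header w nK \<and> 1 \<le> header w nD \<and> 1 \<le> header w nE)) \<and>
     flgs a fEps = num_digit_within (length (bits (header w nE)) - 1) (tl e) \<and>
     \<not> flgs a fHi \<and> \<not> flgs a fLo \<and> strs a 3 = y \<and> strs a 7 = (rd_rest ^^ 8) w"

lemma run_verifier_init:
  assumes "nums a = (\<lambda>_. 0)" "flgs a = (\<lambda>_. False)" "strs a 0 = nat_code r" "strs a 1 = nat_code c" "strs a 2 = e"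
    "strs a 3 = y" "strs a 7 = []" "4 * length y \<le> B" "r < 2 ^ B" "c < 2 ^ B" "1 \<le> B"
  shows "run Or B verifier_init 30 a (init_post r c e y (take (4 * length y) (strs a 4)))"
proof -
  have code: "rd_nat (nat_code n) = n" "rd_rest (nat_code n) = []" "rd_ok (nat_code n)" for n
    using rd_nat_code[of n "[]"] by simp_all
  show ?thesis unfolding verifier_init_def
    apply (rule run_trunc_cert)
       using assms(7) apply simp
      using assms(6,8) apply simp
     apply (rule run_READ, simp)
      apply (rule run_READ, simp)
       apply (rule run_Seq[OF run_read_block, where n' = 9])
        apply (rule run_ONE)
           using assms(1) apply simp
          using assms(11) apply simp
         apply (rule run_CMP)
          apply (rule run_CMP)
           apply (rule run_CMP)
           apply (rule run_SCAN)
            apply (rule run_MUL, simp, simp)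
              subgoal using assms by (simp add: code)
             apply (rule run_MUL, simp, simp)
               subgoal using assms by (simp add: code)
              apply (rule run_Skip)
               subgoal premises p
                 using assms p by (simp add: init_post_def header_def code) (auto simp: linorder_not_le less_Suc_eq)
              apply simp_all
    done
qed

lemma run_verifier_switch:
  assumes "nums a nOne = 1"
  shows "run Or B verifier_switch 8 a (\<lambda>a'. nums a' = (nums a)(nOutLim := nums a nR, nInLim := nums a nC) \<and>
     flgs a' = flgs a \<and> strs a' = (strs a)(3 := strs a 6))"
proof -
  have "run Or B verifier_switch 8 a (\<lambda>a'. nums a' = (nums a)(nOutLim := nums a nR, nInLim := nums a nC) \<and>
     flgs a' = flgs a \<and> strs a' = (strs a)(3 := strs a 6))"
    if B: "nums a nR < 2 ^ B" "nums a nC < 2 ^ B"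
    unfolding verifier_switch_def
    apply (rule run_CLR)
     apply (rule run_CLR)
      apply (rule run_MUL, simp, simp)
        using B assms apply simp
       apply (rule run_MUL, simp, simp)
         using B assms apply simp
        apply (rule run_CLRS, simp)
         apply (rule run_CPYS, simp, simp, simp, simp)
          apply (rule run_Skip)
           using assms apply (simp add: fun_eq_iff)
          apply simp_all
    done
  \<comment> \<open>The size bounds are part of \<open>conc\<close> and hence hold in every state
    that \<open>run\<close> speaks about.\<close>
  then show ?thesis unfolding run_def using concD(2) by blast
qed

text \<open>For \<open>g\<close> this is
  \<open>(Al - Be) / (K * D) \<le> (1 / E) * ((Hi - Lo) / D)\<close>, multiplied out so that no
  subtraction occurs.\<close>

definition final_check :: "bool \<Rightarrow> (nat \<Rightarrow> nat) \<Rightarrow> bool" where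
  "final_check g h \<longleftrightarrow> h nE * h nAl + h nK * (if g then h nLo else 0) \<le> h nE * h nBe + h nK * (if g then h nHi else 0)"

lemma run_verifier_final:
  assumes b: "\<forall>k\<in>{2..9}. nums a k < 2 ^ U" and B: "2 * U + 1 \<le> B"
  shows "run Or B verifier_final 20 a (\<lambda>a'. flgs a' fBad = (flgs a fBad \<or> strs a 6 \<noteq> [] \<or>
     \<not> final_check (flgs a fEps \<and> flgs a fHi \<and> flgs a fLo) (nums a)))"
proof -
  let ?g = "flgs a fEps \<and> flgs a fHi \<and> flgs a fLo"
  let ?h = "nums a" and ?lo = "if ?g then nums a nLo else 0" and ?hi = "if ?g then nums a nHi else 0"
  have pw: "(2::nat) * 2 ^ (U + U) \<le> 2 ^ B"
    using B power_increasing[of "Suc (U + U)" B "2::nat"] by auto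
  have lt: "?lo < 2 ^ U" "?hi < 2 ^ U" "?h nE < 2 ^ U" "?h nAl < 2 ^ U" "?h nBe < 2 ^ U" "?h nK < 2 ^ U"
    using b by auto
  have prods: "?h nE * ?h nAl < 2 ^ (U + U)" "?h nE * ?h nBe < 2 ^ (U + U)" "?h nK * ?lo < 2 ^ (U + U)" "?h nK * ?hi < 2 ^ (U + U)"
    by (intro mult_less_power2 lt)+
  then have bnds: "?h nE * ?h nAl < 2 ^ B" "?h nE * ?h nBe < 2 ^ B" "?h nE * ?h nAl + ?h nK * ?lo < 2 ^ B" "?h nE * ?h nBe + ?h nK * ?hi < 2 ^ B"
    using pw by linarith+
  define mid where "mid = (\<lambda>a'::registers. nums a' = (nums a)(nLo := ?lo, nHi := ?hi) \<and> flgs a' = (flgs a)(fBad := flgs a fBad \<or> strs a 6 \<noteq> []))"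
  have clr: "run Or B (CLR nHi ;; CLR nLo ;; Skip) 3 a1 mid"
    if "nums a1 = nums a" "flgs a1 = (flgs a)(fBad := flgs a fBad \<or> strs a 6 \<noteq> [])" "\<not> ?g" for a1
    apply (rule run_CLR)
     apply (rule run_CLR)
      apply (rule run_Skip)
       using that apply (auto simp: mid_def fun_eq_iff)
    done
  have cond: "run Or B (IFF fEps (CLR nHi ;; CLR nLo ;; Skip) (IFF fHi (CLR nHi ;; CLR nLo ;; Skip) (IFF fLo (CLR nHi ;; CLR nLo ;; Skip) Skip))) 6 a1 mid"
    if a1: "nums a1 = nums a" "flgs a1 = (flgs a)(fBad := flgs a fBad \<or> strs a 6 \<noteq> [])" for a1
  proof -
    have s: "run Or B Skip 3 a1 mid" if ?g
      by (rule run_Skip) (use that a1 in \<open>auto simp: mid_def fun_eq_iff\<close>)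
    have c5: "run Or B (CLR nHi ;; CLR nLo ;; Skip) n a1 mid" if "\<not> ?g" "3 \<le> n" for n
      using run_mono[OF clr[OF a1 that(1)] that(2)] .
    have i1: "run Or B (IFF fLo (CLR nHi ;; CLR nLo ;; Skip) Skip) (Suc 3) a1 mid" if "flgs a fEps" "flgs a fHi"
      by (rule run_If) (use that a1 s c5 in auto)
    have i2: "run Or B (IFF fHi (CLR nHi ;; CLR nLo ;; Skip) (IFF fLo (CLR nHi ;; CLR nLo ;; Skip) Skip)) (Suc (Suc 3)) a1 mid" if "flgs a fEps"
      by (rule run_If) (use that a1 i1 c5 in auto)
    have "run Or B (IFF fEps (CLR nHi ;; CLR nLo ;; Skip) (IFF fHi (CLR nHi ;; CLR nLo ;; Skip) (IFF fLo (CLR nHi ;; CLR nLo ;; Skip) Skip))) (Suc (Suc (Suc 3))) a1 mid"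
      by (rule run_If) (use a1 i2 c5 in auto)
    then show ?thesis by simp
  qed
  show ?thesis unfolding verifier_final_def
    apply (rule run_NONEMPTY, simp)
     apply (rule run_Seq[OF cond, where n' = 8])
        apply simp
       apply simp
      apply (rule run_CLR)
       apply (rule run_CLR)
        apply (rule run_MUL, simp, simp)
          subgoal using bnds(1) by (simp add: mid_def)
         apply (rule run_MUL, simp, simp)
           subgoal using bnds(3) by (simp add: mid_def)
          apply (rule run_MUL, simp, simp)
            subgoal using bnds(2) by (simp add: mid_def)
           apply (rule run_MUL, simp, simp)
             subgoal using bnds(4) by (simp add: mid_def)
            apply (rule run_CMP)
             apply (rule run_Skip)
              subgoal by (simp add: mid_def final_check_def linorder_not_le)
             apply simp_all
    done
qed

section \<open>The acceptance condition and the cost of the verifier\<close>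

definition entry_above :: "nat \<Rightarrow> nat \<Rightarrow> word \<Rightarrow> bool" where
  "entry_above r c w \<longleftrightarrow> (\<exists>m<c. \<exists>i<r. header w nHi < rd_nth ((rd_rest ^^ (m * r + 8)) w) i) \<or>
     (\<exists>m<r. \<exists>i<c. header w nHi < rd_nth ((rd_rest ^^ (m * c + (c * r + 8))) w) i)"

definition entry_below :: "nat \<Rightarrow> nat \<Rightarrow> word \<Rightarrow> bool" where
  "entry_below r c w \<longleftrightarrow> (\<exists>m<c. \<exists>i<r. rd_nth ((rd_rest ^^ (m * r + 8)) w) i < header w nLo) \<or>
     (\<exists>m<r. \<exists>i<c. rd_nth ((rd_rest ^^ (m * c + (c * r + 8))) w) i < header w nLo)"

text \<open>The verdict of the verifier as a predicate on words. The offsets follow the layout: 8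
  header numbers, \<open>c * r\<close> payoffs by columns, then the payoffs by rows. They are listed
  twice because a stream can only be read forwards; each copy is compared with the oracle.\<close>

definition cert_ok :: "nat \<Rightarrow> nat \<Rightarrow> (nat \<Rightarrow> nat \<Rightarrow> rat) \<Rightarrow> word \<Rightarrow> word \<Rightarrow> word \<Rightarrow> bool" where
  "cert_ok r c M e y w \<longleftrightarrow> (\<forall>k<8. rd_nth_ok w k) \<and> 1 \<le> header w nK \<and> 1 \<le> header w nD \<and> 1 \<le> header w nE \<and>
     (\<forall>m<c. line_ok nAcc nAl (header w) y ((rd_rest ^^ (m * r + 8)) w) (\<lambda>i. M i m) r) \<and>
     (\<forall>m<r. line_ok nBe nAcc (header w) ((rd_rest ^^ r) y) ((rd_rest ^^ (m * c + (c * r + 8))) w) (M m) c) \<and>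
     (rd_rest ^^ (c + r)) y = [] \<and>
     final_check (num_digit_within (length (bits (header w nE)) - 1) (tl e) \<and> entry_above r c w \<and> entry_below r c w) (header w)"

lemma line_ok_cong:
  assumes "\<forall>k\<in>{2..9}. h k = h' k" "cx \<in> {nAcc, nAl, nBe}" "cy \<in> {nAcc, nAl, nBe}"
  shows "line_ok cx cy h = line_ok cx cy h'"
proof -
  have h: "h nD = h' nD" "h nO = h' nO" "h nK = h' nK" "h nAl = h' nAl" "h nBe = h' nBe"
    using assms(1) by auto
  have "entry_ok h = entry_ok h'" using h by (simp add: entry_ok_def fun_eq_iff)
  moreover have "(h(nAcc := z)) x = (h'(nAcc := z)) x" if "x \<in> {nAcc, nAl, nBe}" for x z using that h by auto
  ultimately show ?thesis using assms(2,3) h unfolding line_ok_def fun_eq_iff by simp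
qed

lemma final_check_cong: "\<forall>k\<in>{2..9}. h k = h' k \<Longrightarrow> final_check g h = final_check g h'"
  by (simp add: final_check_def)

text \<open>Truncation keeps all guessed numbers below \<open>2 ^ (4 * length y)\<close>. The factor
  9 in the register size covers the products of two of them in the final test, which need
  \<open>8 * length y + 1\<close> digits; the sums of weights times payoffs need
  \<open>5 * length y\<close> digits and smaller terms.\<close>

lemma run_verifier_main:
  assumes rc: "0 < r" "0 < c"
    and orc: "\<And>i j. i < r \<Longrightarrow> j < c \<Longrightarrow> Or (nat_code i @ nat_code j) = rat_code (M i j)"
    and len: "\<And>i j. i < r \<Longrightarrow> j < c \<Longrightarrow> length (rat_code (M i j)) \<le> l"
    and B: "9 * length y + l + r + c + 8 \<le> B"
    and a: "nums a = (\<lambda>_. 0)" "flgs a = (\<lambda>_. False)" "strs a 0 = nat_code r" "strs a 1 = nat_code c" "strs a 2 = e"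
    "strs a 3 = y" "strs a 7 = []"
  shows "run Or B (verifier_init ;; phase nIn nOut nAcc nAl ;; verifier_switch ;; phase nOut nIn nBe nAcc ;; verifier_final)
     (52 * (r * c) + 22 * (r + c) + 66) a (\<lambda>a'. flgs a' fBad = (\<not> cert_ok r c M e y (take (4 * length y) (strs a 4))))"
proof -
  define w where "w = take (4 * length y) (strs a 4)"
  have lw: "length w \<le> 4 * length y" by (simp add: w_def)
  have rB: "r < 2 ^ B" "c < 2 ^ B"
    using less_le_trans[OF less_exp[of r] power_increasing[of r B]]
      less_le_trans[OF less_exp[of c] power_increasing[of c B]] B by auto
  have hd: "header w k < 2 ^ (4 * length y)" for k unfolding header_def by (rule rd_nth_less[OF lw])
  have l8: "length ((rd_rest ^^ k) w) \<le> 4 * length y" for k using length_funpow_rd_rest[of k w] lw by linarith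
  have ly: "length ((rd_rest ^^ k) y) \<le> length y" for k by (rule length_funpow_rd_rest)
  have init: "run Or B verifier_init 30 a (init_post r c e y w)"
    unfolding w_def by (rule run_verifier_init) (use a rB B in auto)
  have ph1: "run Or B (phase nIn nOut nAcc nAl) (c * (r * 26 + 22) + 4) a1 (outer_inv nAcc nAl (\<lambda>m i. M i m) a1 c)"
    if "init_post r c e y w a1" for a1
  proof -
    have h: "nums a1 nOutLim = c" "nums a1 nInLim = r" "nums a1 nOne = 1" "nums a1 nO = header w nO" "nums a1 nD = header w nD"
      "strs a1 3 = y" "strs a1 7 = (rd_rest ^^ 8) w"
      using that by (simp_all add: init_post_def)
    have "run Or B (phase nIn nOut nAcc nAl) (nums a1 nOutLim * (nums a1 nInLim * 26 + 22) + 4) a1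
      (outer_inv nAcc nAl (\<lambda>m i. M i m) a1 (nums a1 nOutLim))"
      by (rule run_phase[where l = l and U = "4 * length y" and Y = "length y"])
        (use h orc len hd l8 B in simp_all)
    then show ?thesis using h by simp
  qed
  define post1 where "post1 = (\<lambda>a1::registers. nums a1 nR = r \<and> nums a1 nC = c \<and> (\<forall>k\<in>{2..9}. nums a1 k = header w k) \<and>
     nums a1 nOne = 1 \<and>
     flgs a1 fBad = (\<not> ((\<forall>k<8. rd_nth_ok w k) \<and> 1 \<le> header w nK \<and> 1 \<le> header w nD \<and> 1 \<le> header w nE \<and>
       (\<forall>m<c. line_ok nAcc nAl (header w) y ((rd_rest ^^ (m * r + 8)) w) (\<lambda>i. M i m) r))) \<and>
     flgs a1 fEps = num_digit_within (length (bits (header w nE)) - 1) (tl e) \<and>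
     flgs a1 fHi = (\<exists>m<c. \<exists>i<r. header w nHi < rd_nth ((rd_rest ^^ (m * r + 8)) w) i) \<and>
     flgs a1 fLo = (\<exists>m<c. \<exists>i<r. rd_nth ((rd_rest ^^ (m * r + 8)) w) i < header w nLo) \<and>
     strs a1 6 = (rd_rest ^^ r) y \<and> strs a1 7 = (rd_rest ^^ (c * r + 8)) w)"
  have p1: "post1 a2" if i: "init_post r c e y w a1" and o: "outer_inv nAcc nAl (\<lambda>m i. M i m) a1 c a2" for a1 a2
  proof -
    have h: "nums a1 nInLim = r" "nums a1 nOne = 1" "strs a1 3 = y" "strs a1 7 = (rd_rest ^^ 8) w" "nums a1 nR = r" "nums a1 nC = c"
      "\<forall>k\<in>{2..9}. nums a1 k = header w k" "nums a1 nHi = header w nHi" "nums a1 nLo = header w nLo"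
      "flgs a1 fBad = (\<not> ((\<forall>k<8. rd_nth_ok w k) \<and> 1 \<le> header w nK \<and> 1 \<le> header w nD \<and> 1 \<le> header w nE))"
      "flgs a1 fEps = num_digit_within (length (bits (header w nE)) - 1) (tl e)" "\<not> flgs a1 fHi" "\<not> flgs a1 fLo"
      using i by (simp_all add: init_post_def)
    have v: "(rd_rest ^^ (m * r)) ((rd_rest ^^ 8) w) = (rd_rest ^^ (m * r + 8)) w" for m by (simp add: funpow_add)
    have lk: "line_ok nAcc nAl (nums a1) = line_ok nAcc nAl (header w)" by (rule line_ok_cong[OF h(7)]) auto
    have O: "\<forall>m. m \<notin> {nOut, nIn} \<union> {13..20} \<longrightarrow> nums a2 m = nums a1 m"
     "strs a2 7 = (rd_rest ^^ (c * r + 8)) w" "0 < c \<longrightarrow> strs a2 6 = (rd_rest ^^ r) y"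
     "\<forall>f. f \<notin> {fBad, fHi, fLo, fNeg, fOuter, fInner} \<longrightarrow> flgs a2 f = flgs a1 f"
     "flgs a2 fBad = (flgs a1 fBad \<or> (\<exists>m<c. \<not> line_ok nAcc nAl (header w) y ((rd_rest ^^ (m * r + 8)) w) (\<lambda>i. M i m) r))"
     "flgs a2 fHi = (flgs a1 fHi \<or> (\<exists>m<c. \<exists>i<r. header w nHi < rd_nth ((rd_rest ^^ (m * r + 8)) w) i))"
     "flgs a2 fLo = (flgs a1 fLo \<or> (\<exists>m<c. \<exists>i<r. rd_nth ((rd_rest ^^ (m * r + 8)) w) i < header w nLo))"
      using o unfolding outer_inv_def Let_def h(1,3,4,8,9) v lk by blast+
    have n: "nums a2 nR = r" "nums a2 nC = c" "nums a2 nOne = 1" "flgs a2 fEps = flgs a1 fEps"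
      using O(1,4) h by simp_all
    have "\<forall>k\<in>{2..9}. nums a2 k = header w k" using O(1) h(7) by auto
    then show ?thesis unfolding post1_def using n O(2,3,5-7) h(10-13) rc(2) by blast
  qed
  define post2 where "post2 = (\<lambda>a1::registers. nums a1 nOutLim = r \<and> nums a1 nInLim = c \<and> (\<forall>k\<in>{2..9}. nums a1 k = header w k) \<and>
     nums a1 nOne = 1 \<and>
     flgs a1 fBad = (\<not> ((\<forall>k<8. rd_nth_ok w k) \<and> 1 \<le> header w nK \<and> 1 \<le> header w nD \<and> 1 \<le> header w nE \<and>
       (\<forall>m<c. line_ok nAcc nAl (header w) y ((rd_rest ^^ (m * r + 8)) w) (\<lambda>i. M i m) r))) \<and>
     flgs a1 fEps = num_digit_within (length (bits (header w nE)) - 1) (tl e) \<and>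
     flgs a1 fHi = (\<exists>m<c. \<exists>i<r. header w nHi < rd_nth ((rd_rest ^^ (m * r + 8)) w) i) \<and>
     flgs a1 fLo = (\<exists>m<c. \<exists>i<r. rd_nth ((rd_rest ^^ (m * r + 8)) w) i < header w nLo) \<and>
     strs a1 3 = (rd_rest ^^ r) y \<and> strs a1 7 = (rd_rest ^^ (c * r + 8)) w)"
  have sw: "run Or B verifier_switch 8 a1 post2" if p: "post1 a1" for a1
  proof (rule run_weaken[OF run_verifier_switch])
    show "nums a1 nOne = 1" using p by (simp add: post1_def)
    fix a' :: registers assume "nums a' = (nums a1)(nOutLim := nums a1 nR, nInLim := nums a1 nC) \<and>
     flgs a' = flgs a1 \<and> strs a' = (strs a1)(3 := strs a1 6)"
    then show "post2 a'" using p unfolding post1_def post2_def by simp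
  qed
  have ph2: "run Or B (phase nOut nIn nBe nAcc) (r * (c * 26 + 22) + 4) a1 (outer_inv nBe nAcc M a1 r)"
    if "post2 a1" for a1
  proof -
    have h: "nums a1 nOutLim = r" "nums a1 nInLim = c" "nums a1 nOne = 1" "nums a1 nO = header w nO" "nums a1 nD = header w nD"
      "strs a1 3 = (rd_rest ^^ r) y" "strs a1 7 = (rd_rest ^^ (c * r + 8)) w"
      using that by (simp_all add: post2_def)
    have "run Or B (phase nOut nIn nBe nAcc) (nums a1 nOutLim * (nums a1 nInLim * 26 + 22) + 4) a1
      (outer_inv nBe nAcc M a1 (nums a1 nOutLim))"
      by (rule run_phase[where l = l and U = "4 * length y" and Y = "length y"])
        (use h orc len hd l8 ly B in simp_all)
    then show ?thesis using h by simp
  qed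
  have fin: "run Or B verifier_final 20 a2 (\<lambda>a'. flgs a' fBad = (\<not> cert_ok r c M e y w))"
    if i: "post2 a1" and o: "outer_inv nBe nAcc M a1 r a2" for a1 a2
  proof -
    have h: "nums a1 nInLim = c" "nums a1 nOne = 1" "strs a1 3 = (rd_rest ^^ r) y" "strs a1 7 = (rd_rest ^^ (c * r + 8)) w"
      "\<forall>k\<in>{2..9}. nums a1 k = header w k" "nums a1 nHi = header w nHi" "nums a1 nLo = header w nLo"
      "flgs a1 fBad = (\<not> ((\<forall>k<8. rd_nth_ok w k) \<and> 1 \<le> header w nK \<and> 1 \<le> header w nD \<and> 1 \<le> header w nE \<and>
       (\<forall>m<c. line_ok nAcc nAl (header w) y ((rd_rest ^^ (m * r + 8)) w) (\<lambda>i. M i m) r)))"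
      "flgs a1 fEps = num_digit_within (length (bits (header w nE)) - 1) (tl e)"
      "flgs a1 fHi = (\<exists>m<c. \<exists>i<r. header w nHi < rd_nth ((rd_rest ^^ (m * r + 8)) w) i)"
      "flgs a1 fLo = (\<exists>m<c. \<exists>i<r. rd_nth ((rd_rest ^^ (m * r + 8)) w) i < header w nLo)"
      using i by (simp_all add: post2_def)
    have v: "(rd_rest ^^ (m * c)) ((rd_rest ^^ (c * r + 8)) w) = (rd_rest ^^ (m * c + (c * r + 8))) w" for m by (simp add: funpow_add)
    have vy: "(rd_rest ^^ c) ((rd_rest ^^ r) y) = (rd_rest ^^ (c + r)) y" by (simp add: funpow_add)
    have lk: "line_ok nBe nAcc (nums a1) = line_ok nBe nAcc (header w)" by (rule line_ok_cong[OF h(5)]) auto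
    have O: "\<forall>m. m \<notin> {nOut, nIn} \<union> {13..20} \<longrightarrow> nums a2 m = nums a1 m"
     "0 < r \<longrightarrow> strs a2 6 = (rd_rest ^^ (c + r)) y"
     "\<forall>f. f \<notin> {fBad, fHi, fLo, fNeg, fOuter, fInner} \<longrightarrow> flgs a2 f = flgs a1 f"
     "flgs a2 fBad = (flgs a1 fBad \<or> (\<exists>m<r. \<not> line_ok nBe nAcc (header w) ((rd_rest ^^ r) y) ((rd_rest ^^ (m * c + (c * r + 8))) w) (M m) c))"
     "flgs a2 fHi = (flgs a1 fHi \<or> (\<exists>m<r. \<exists>i<c. header w nHi < rd_nth ((rd_rest ^^ (m * c + (c * r + 8))) w) i))"
     "flgs a2 fLo = (flgs a1 fLo \<or> (\<exists>m<r. \<exists>i<c. rd_nth ((rd_rest ^^ (m * c + (c * r + 8))) w) i < header w nLo))"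
      using o unfolding outer_inv_def Let_def h(1,3,4,6,7) v vy lk by blast+
    have e: "flgs a2 fEps = flgs a1 fEps" using O(3) by simp
    have h2: "\<forall>k\<in>{2..9}. nums a2 k = header w k" using O(1) h(5) by auto
    have hi: "flgs a2 fHi = entry_above r c w" "flgs a2 fLo = entry_below r c w"
      unfolding O(5,6) h(10,11) entry_above_def entry_below_def by (rule refl)+
    show ?thesis
    proof (rule run_weaken[OF run_verifier_final[where U = "4 * length y"]])
      show "\<forall>k\<in>{2..9}. nums a2 k < 2 ^ (4 * length y)" using h2 hd by auto
      show "2 * (4 * length y) + 1 \<le> B" using B by simp
      fix a' :: registers assume A: "flgs a' fBad = (flgs a2 fBad \<or> strs a2 6 \<noteq> [] \<or>
         \<not> final_check (flgs a2 fEps \<and> flgs a2 fHi \<and> flgs a2 fLo) (nums a2))"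
      have s6: "strs a2 6 = (rd_rest ^^ (c + r)) y" using O(2) rc(1) by simp
      show "flgs a' fBad = (\<not> cert_ok r c M e y w)"
        unfolding A hi e h(9) final_check_cong[OF h2] O(4) h(8) s6 cert_ok_def by blast
    qed
  qed
  have time: "30 + ((c * (r * 26 + 22) + 4) + (8 + ((r * (c * 26 + 22) + 4) + 20))) \<le> 52 * (r * c) + 22 * (r + c) + 66"
    by (simp add: algebra_simps)
  show ?thesis unfolding w_def[symmetric]
    apply (rule run_Seq[OF init _ time])
    subgoal for a1
      apply (rule run_Seq[where R = post1, OF run_weaken[OF ph1] _ order.refl])
        apply assumption
       apply (erule (1) p1)
      apply (rule run_Seq[OF sw _ order.refl], assumption)
      subgoal for a2 a3
        apply (rule run_Seq[OF ph2 _ order.refl], assumption)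
        apply (rule fin, assumption, assumption)
        done
      done
    done
qed

lemma length_nat_code_le: "length (nat_code n) \<le> 2 * n + 1"
  using length_bits_le[OF less_exp[of n]] by (simp add: length_nat_code)

lemma verifier_runs:
  assumes rc: "0 < r" "0 < c"
    and orc: "\<And>i j. i < r \<Longrightarrow> j < c \<Longrightarrow> Or (nat_code i @ nat_code j) = rat_code (M i j)"
    and len: "\<And>i j. i < r \<Longrightarrow> j < c \<Longrightarrow> length (rat_code (M i j)) \<le> l"
    and B: "9 * length y + l + 2 * r + 2 * c + 8 \<le> B"
  shows "\<exists>t out. runs Or verifier [nat_code r, nat_code c, e, y, u, v] t out \<and>
     t \<le> (52 * (r * c) + 22 * (r + c) + 68) * unit_time B \<and>
     (out = [True] \<longleftrightarrow> cert_ok r c M e y (take (4 * length y) u))"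
proof -
  let ?ws = "[nat_code r, nat_code c, e, y, u, v]"
  define s where "s = (\<lambda>k. if k < length ?ws then ?ws ! k else [])"
  have s: "s 0 = nat_code r" "s 1 = nat_code c" "s 2 = e" "s 3 = y" "s 4 = u" "\<And>k. 6 \<le> k \<Longrightarrow> s k = []"
    by (simp_all add: s_def)
  define a where "a = \<lparr>nums = \<lambda>_. 0, flgs = \<lambda>_. False, strs = s\<rparr>"
  have conc: "conc B a s"
    using s length_nat_code_le[of r] length_nat_code_le[of c] B
    by (auto simp: conc_def a_def num_stack_def flag_stack_def)
  let ?P = "verifier_init ;; phase nIn nOut nAcc nAl ;; verifier_switch ;; phase nOut nIn nBe nAcc ;; verifier_final"
  let ?n = "52 * (r * c) + 22 * (r + c) + 66"
  have "run Or B ?P ?n a (\<lambda>a'. flgs a' fBad = (\<not> cert_ok r c M e y (take (4 * length y) (strs a 4))))"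
    by (rule run_verifier_main[where Or = Or and M = M and r = r and c = c and l = l, OF rc orc len]) (use B s in \<open>auto simp: a_def\<close>)
  moreover have su: "strs a 4 = u" using s(5) by (simp add: a_def)
  ultimately obtain s1 a1 where 1: "ex Or ?P s (?n * unit_time B) s1" "conc B a1 s1"
      "flgs a1 fBad = (\<not> cert_ok r c M e y (take (4 * length y) u))"
    using conc unfolding run_def su by blast
  have l0: "length (s1 0) \<le> B" using concD(4,5)[OF 1(2), of 0] by simp
  let ?s2 = "s1(0 := [])"
  have 2: "ex Or (clear 0) s1 (unit_time B) ?s2"
    by (rule ex_clearI) (use l0 small_le_unit_time(2)[OF l0] in auto)
  let ?s3 = "?s2(0 := flag_word (\<not> flgs a1 fBad))"
  have 3: "ex Or (IfTop (flag_stack fBad) (Push 0 True) Skip Skip) ?s2 (unit_time B) ?s3"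
  proof (rule ex_loop_free)
    have "s1 (flag_stack fBad) = flag_word (flgs a1 fBad)" by (rule concD(3)[OF 1(2)])
    then show "effect (IfTop (flag_stack fBad) (Push 0 True) Skip Skip) ?s2 = ?s3"
      by (cases "flgs a1 fBad") auto
    show "cost (IfTop (flag_stack fBad) (Push 0 True) Skip Skip) \<le> unit_time B"
      by (rule le_trans[OF _ small_le_unit_time(1)[of 2 B]]) simp_all
  qed simp
  have tm: "?n * unit_time B + (unit_time B + unit_time B) = (52 * (r * c) + 22 * (r + c) + 68) * unit_time B"
    by (simp add: algebra_simps)
  have "ex Or verifier s ((52 * (r * c) + 22 * (r + c) + 68) * unit_time B) ?s3"
    unfolding verifier_def by (rule ex_Seq[OF 1(1) ex_Seq[OF 2 3 order.refl] eq_refl[OF tm]])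
  then obtain t where t: "t \<le> (52 * (r * c) + 22 * (r + c) + 68) * unit_time B" "exec Or verifier s t ?s3"
    unfolding ex_def by blast
  have "runs Or verifier ?ws t (?s3 0)" unfolding runs_def using t(2) unfolding s_def by blast
  moreover have "?s3 0 = [True] \<longleftrightarrow> cert_ok r c M e y (take (4 * length y) u)"
    using 1(3) by (simp add: flag_word_def)
  ultimately show ?thesis using t(1) by blast
qed

section \<open>Approximate minimax theorem\<close>

text \<open>If no regret is positive, there is nothing to be proportional to and the uniform
  strategy is the default.\<close>

definition matching_strategy :: "nat \<Rightarrow> (nat \<Rightarrow> real) \<Rightarrow> nat \<Rightarrow> real" where
  "matching_strategy r R i = (let S = (\<Sum>k<r. max 0 (R k)) in if S = 0 then 1 / real r else max 0 (R i) / S)"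

lemma mixed_matching_strategy:
  assumes "0 < r"
  shows "mixed r (matching_strategy r R)"
proof -
  let ?S = "\<Sum>k<r. max 0 (R k)"
  have "0 \<le> ?S" by (intro sum_nonneg) auto
  moreover have "(\<Sum>i<r. max 0 (R i) / ?S) = 1" if "?S \<noteq> 0"
    using that by (simp flip: sum_divide_distrib)
  ultimately show ?thesis using assms
    by (cases "?S = 0") (auto simp: mixed_def matching_strategy_def Let_def)
qed

definition best_column :: "nat \<Rightarrow> nat \<Rightarrow> (nat \<Rightarrow> nat \<Rightarrow> real) \<Rightarrow> (nat \<Rightarrow> real) \<Rightarrow> nat" where
  "best_column r c A x = (SOME j. j < c \<and> (\<forall>k<c. (\<Sum>i<r. x i * A i k) \<le> (\<Sum>i<r. x i * A i j)))"

lemma best_column: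
  assumes "0 < c"
  shows "best_column r c A x < c"
    "k < c \<Longrightarrow> (\<Sum>i<r. x i * A i k) \<le> (\<Sum>i<r. x i * A i (best_column r c A x))"
proof -
  let ?f = "\<lambda>j. \<Sum>i<r. x i * A i j"
  have "\<exists>j\<in>{..<c}. \<forall>k\<in>{..<c}. ?f k \<le> ?f j"
  proof -
    have m: "Max (?f ` {..<c}) \<in> ?f ` {..<c}" using assms by (intro Max_in) auto
    then obtain j where "j < c" "?f j = Max (?f ` {..<c})" by auto
    then show ?thesis by (intro bexI[of _ j]) auto
  qed
  then have "\<exists>j. j < c \<and> (\<forall>k<c. ?f k \<le> ?f j)" by auto
  from someI_ex[OF this] show "best_column r c A x < c"
    "k < c \<Longrightarrow> (\<Sum>i<r. x i * A i k) \<le> (\<Sum>i<r. x i * A i (best_column r c A x))"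
    unfolding best_column_def by auto
qed

text \<open>Regret matching: the row player plays proportionally to the positive parts of the accumulated
  regrets against a best-responding opponent.\<close>

fun regret :: "nat \<Rightarrow> nat \<Rightarrow> (nat \<Rightarrow> nat \<Rightarrow> real) \<Rightarrow> nat \<Rightarrow> nat \<Rightarrow> real" where
  "regret r c A 0 i = 0"
| "regret r c A (Suc t) i = regret r c A t i +
     (let x = matching_strategy r (regret r c A t); j = best_column r c A x
      in (\<Sum>k<r. x k * A k j) - A i j)"

lemma mixed_average_bounds:
  assumes "mixed r x" "\<And>i. i < r \<Longrightarrow> 0 \<le> f i" "\<And>i. i < r \<Longrightarrow> f i \<le> (1::real)"
  shows "0 \<le> (\<Sum>i<r. x i * f i)" "(\<Sum>i<r. x i * f i) \<le> 1"
proof -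
  show "0 \<le> (\<Sum>i<r. x i * f i)" using assms by (intro sum_nonneg) (auto simp: mixed_def)
  have "(\<Sum>i<r. x i * f i) \<le> (\<Sum>i<r. x i)"
    using assms by (intro sum_mono) (auto simp: mixed_def mult_left_le)
  then show "(\<Sum>i<r. x i * f i) \<le> 1" using assms(1) by (simp add: mixed_def)
qed

text \<open>Blackwell's approachability argument: the strategy is proportional to the positive
  regrets, so these are orthogonal to the new increments \<open>d\<close>. The squared length of the
  positive part therefore grows per round by at most that of \<open>d\<close>, which is at most
  \<open>r\<close> for payoffs in the unit interval.\<close>

lemma regret_potential:
  assumes "0 < r" "0 < c" "\<And>i j. i < r \<Longrightarrow> j < c \<Longrightarrow> 0 \<le> A i j \<and> A i j \<le> 1"
  shows "(\<Sum>i<r. (max 0 (regret r c A t i))\<^sup>2) \<le> real r * real t"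
proof (induction t)
  case (Suc t)
  define R where "R = regret r c A t"
  define x where "x = matching_strategy r R"
  define j where "j = best_column r c A x"
  define v where "v = (\<Sum>k<r. x k * A k j)"
  define d where "d = (\<lambda>i. v - A i j)"
  have x: "mixed r x" unfolding x_def by (rule mixed_matching_strategy[OF assms(1)])
  have j: "j < c" unfolding j_def by (rule best_column[OF assms(2)])
  have step: "regret r c A (Suc t) i = R i + d i" for i
    by (simp add: R_def x_def j_def v_def d_def Let_def)
  have v: "0 \<le> v" "v \<le> 1" unfolding v_def
    using mixed_average_bounds[OF x, of "\<lambda>k. A k j"] assms(3) j by auto
  have d: "(d i)\<^sup>2 \<le> 1" if "i < r" for i
  proof -
    have "\<bar>d i\<bar> \<le> 1" using v assms(3)[OF that j] by (auto simp: d_def)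
    then show ?thesis using abs_le_square_iff[of "d i" 1] by simp
  qed
  have orth: "(\<Sum>i<r. max 0 (R i) * d i) = 0"
  proof (cases "(\<Sum>k<r. max 0 (R k)) = 0")
    case True
    then have "\<forall>k\<in>{..<r}. max 0 (R k) = 0" by (subst (asm) sum_nonneg_eq_0_iff) auto
    then show ?thesis by simp
  next
    case False
    define S where "S = (\<Sum>k<r. max 0 (R k))"
    have Sx: "max 0 (R i) = S * x i" for i using False by (simp add: x_def matching_strategy_def Let_def S_def)
    have "(\<Sum>i<r. max 0 (R i) * d i) = S * (\<Sum>i<r. x i * d i)"
      unfolding Sx by (simp add: sum_distrib_left mult.assoc)
    also have "(\<Sum>i<r. x i * d i) = v * (\<Sum>i<r. x i) - v"
      unfolding d_def v_def right_diff_distrib sum_subtractf by (simp add: mult.commute flip: sum_distrib_right)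
    also have "\<dots> = 0" using x by (simp add: mixed_def)
    finally show ?thesis by simp
  qed
  \<comment> \<open>Where the new regret is positive it is at most \<open>max 0 (R i) + d i\<close>;
    elsewhere the left-hand summand is 0.\<close>
  have "(\<Sum>i<r. (max 0 (regret r c A (Suc t) i))\<^sup>2) \<le> (\<Sum>i<r. (max 0 (R i) + d i)\<^sup>2)"
  proof (rule sum_mono)
    fix i
    show "(max 0 (regret r c A (Suc t) i))\<^sup>2 \<le> (max 0 (R i) + d i)\<^sup>2"
    proof (cases "R i + d i \<le> 0")
      case True
      then have "max 0 (R i + d i) = 0" by simp
      then show ?thesis unfolding step by simp
    next
      case False
      then show ?thesis unfolding step by (intro power_mono) auto
    qed
  qed
  also have "\<dots> = (\<Sum>i<r. (max 0 (R i))\<^sup>2) + 2 * (\<Sum>i<r. max 0 (R i) * d i) + (\<Sum>i<r. (d i)\<^sup>2)"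
  proof -
    have "(max 0 (R i) + d i)\<^sup>2 = (max 0 (R i))\<^sup>2 + 2 * (max 0 (R i) * d i) + (d i)\<^sup>2" for i
      by (simp add: power2_sum)
    then show ?thesis by (simp only: sum.distrib sum_distrib_left)
  qed
  also have "\<dots> \<le> real r * real t + 0 + real r"
    using Suc.IH orth sum_bounded_above[of "{..<r}" "\<lambda>i. (d i)\<^sup>2" 1] d by (simp add: R_def)
  also have "\<dots> = real r * real (Suc t)" by (simp add: algebra_simps)
  finally show ?case .
qed simp

text \<open>\<open>p\<close> is the average of the strategies played and \<open>q\<close> the
  empirical distribution of the best responses. Since the responses are best, no column yields more
  against \<open>p\<close> than the average payoff; since the regret is small, that average exceeds
  no row's payoff against \<open>q\<close> by more than \<open>\<delta>\<close>.\<close>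

lemma approximate_minimax:
  assumes rc: "0 < r" "0 < c" and A: "\<And>i j. i < r \<Longrightarrow> j < c \<Longrightarrow> 0 \<le> A i j \<and> A i j \<le> 1" and "0 < \<delta>"
  shows "\<exists>p q. mixed r p \<and> mixed c q \<and>
    (\<forall>i<r. \<forall>j<c. (\<Sum>k<r. p k * A k j) \<le> (\<Sum>k<c. q k * A i k) + \<delta>)"
proof -
  \<comment> \<open>By the potential bound the regret is at most \<open>sqrt (r * T)\<close>, which
    is at most \<open>\<delta> * T\<close> as soon as \<open>T\<close> exceeds
    \<open>r / (\<delta> * \<delta>)\<close>.\<close>
  obtain T :: nat where T: "real r / \<delta>\<^sup>2 < real T" using reals_Archimedean2 by blast
  have T0: "0 < real T" using T \<open>0 < \<delta>\<close> by (smt (verit) divide_nonneg_nonneg of_nat_0_le_iff zero_le_power2)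
  define x where "x = (\<lambda>t. matching_strategy r (regret r c A t))"
  define jj where "jj = (\<lambda>t. best_column r c A (x t))"
  define v where "v = (\<lambda>t. \<Sum>k<r. x t k * A k (jj t))"
  have x: "mixed r (x t)" for t unfolding x_def by (rule mixed_matching_strategy[OF rc(1)])
  have jj: "jj t < c" for t unfolding jj_def by (rule best_column[OF rc(2)])
  define p where "p = (\<lambda>i. (\<Sum>t<T. x t i) / T)"
  define q where "q = (\<lambda>j. (\<Sum>t<T. of_bool (jj t = j)) / real T)"
  have "mixed r p" unfolding mixed_def
  proof
    show "\<forall>i<r. 0 \<le> p i" using x by (auto simp: p_def mixed_def intro!: divide_nonneg_nonneg sum_nonneg)
    have "(\<Sum>i<r. p i) = (\<Sum>t<T. \<Sum>i<r. x t i) / T"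
      unfolding p_def by (subst sum.swap) (simp flip: sum_divide_distrib)
    then show "(\<Sum>i<r. p i) = 1" using x T0 by (simp add: mixed_def)
  qed
  moreover have "mixed c q" unfolding mixed_def
  proof
    show "\<forall>j<c. 0 \<le> q j" by (auto simp: q_def intro!: divide_nonneg_nonneg sum_nonneg)
    have "(\<Sum>j<c. q j) = (\<Sum>t<T. \<Sum>j<c. of_bool (jj t = j)) / T"
      unfolding q_def by (subst sum.swap) (simp flip: sum_divide_distrib)
    also have "(\<Sum>t<T. \<Sum>j<c. of_bool (jj t = j)) = (\<Sum>t<T. (1::real))"
      using jj by (intro sum.cong) (auto simp: of_bool_def)
    finally show "(\<Sum>j<c. q j) = 1" using T0 by simp
  qed
  moreover have "(\<Sum>k<r. p k * A k j) \<le> (\<Sum>k<c. q k * A i k) + \<delta>" if ij: "i < r" "j < c" for i j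
  proof -
    have R: "regret r c A t i = (\<Sum>s<t. v s) - (\<Sum>s<t. A i (jj s))" for t
      by (induction t) (simp_all add: v_def x_def jj_def Let_def)
    have "regret r c A T i \<le> \<delta> * T"
    proof (rule power2_le_imp_le[of _ "\<delta> * T", THEN order.trans[OF max.cobounded2[of _ 0]]])
      have "(max 0 (regret r c A T i))\<^sup>2 \<le> (\<Sum>i<r. (max 0 (regret r c A T i))\<^sup>2)"
        using ij(1) by (intro member_le_sum) auto
      also have "\<dots> \<le> real r * real T" by (rule regret_potential[OF rc A])
      also have "\<dots> \<le> (\<delta>\<^sup>2 * real T) * real T"
        using T \<open>0 < \<delta>\<close> by (intro mult_right_mono) (auto simp: field_simps)
      finally show "(max 0 (regret r c A T i))\<^sup>2 \<le> (\<delta> * real T)\<^sup>2" by (simp add: power2_eq_square algebra_simps)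
    qed (use \<open>0 < \<delta>\<close> in auto)
    then have 1: "(\<Sum>t<T. v t) \<le> (\<Sum>t<T. A i (jj t)) + \<delta> * T" using R[of T] by simp
    have "(\<Sum>k<r. p k * A k j) = (\<Sum>k<r. \<Sum>t<T. x t k * A k j) / T"
      unfolding p_def by (simp add: sum_divide_distrib sum_distrib_right)
    also have "(\<Sum>k<r. \<Sum>t<T. x t k * A k j) = (\<Sum>t<T. \<Sum>k<r. x t k * A k j)" by (rule sum.swap)
    also have "\<dots> \<le> (\<Sum>t<T. v t)"
      unfolding v_def jj_def by (rule sum_mono, rule best_column(2)[OF rc(2) ij(2)])
    finally have 2: "(\<Sum>k<r. p k * A k j) \<le> (\<Sum>t<T. v t) / T" using T0 by (simp add: divide_right_mono)
    have "(\<Sum>k<c. q k * A i k) = (\<Sum>k<c. \<Sum>t<T. of_bool (jj t = k) * A i k) / T"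
      unfolding q_def by (simp add: sum_divide_distrib sum_distrib_right)
    also have "(\<Sum>k<c. \<Sum>t<T. of_bool (jj t = k) * A i k) = (\<Sum>t<T. \<Sum>k<c. of_bool (jj t = k) * A i k)" by (rule sum.swap)
    also have "\<dots> = (\<Sum>t<T. A i (jj t))"
      using jj by (intro sum.cong) (auto simp: of_bool_def if_distrib[of "\<lambda>x. x * _"] cong: if_cong)
    finally have 3: "(\<Sum>k<c. q k * A i k) = (\<Sum>t<T. A i (jj t)) / T" .
    have "(\<Sum>t<T. v t) / T \<le> ((\<Sum>t<T. A i (jj t)) + \<delta> * T) / T" using 1 T0 by (simp add: divide_right_mono)
    also have "\<dots> = (\<Sum>t<T. A i (jj t)) / T + \<delta>" using T0 by (simp add: field_simps)
    finally show ?thesis using 2 3 by simp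
  qed
  ultimately show ?thesis by blast
qed

text \<open>Round down and put the missing weight, at most \<open>n\<close>, on the first
  coordinate. Rounding errs downwards and the correction upwards, each by at most
  \<open>n * F\<close>, so the two errors do not add up. The estimate is uniform in \<open>f\<close>
  because one rounding has to serve all lines of the matrix.\<close>

lemma round_strategy:
  assumes p: "mixed n p" and n: "0 < n"
  shows "\<exists>a. (\<Sum>i<n. a i) = (K::nat) \<and> (\<forall>f F. (\<forall>i<n. 0 \<le> f i \<and> f i \<le> F) \<longrightarrow>
     \<bar>(\<Sum>i<n. real (a i) * f i) - real K * (\<Sum>i<n. p i * f i)\<bar> \<le> real n * F)"
proof -
  define b where "b = (\<lambda>i. nat \<lfloor>real K * p i\<rfloor>)"
  have b: "real (b i) \<le> real K * p i" "real K * p i \<le> real (b i) + 1" if "i < n" for i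
  proof -
    have "0 \<le> real K * p i" using p that by (simp add: mixed_def)
    then have "real (b i) = of_int \<lfloor>real K * p i\<rfloor>" by (simp add: b_def)
    then show "real (b i) \<le> real K * p i" "real K * p i \<le> real (b i) + 1" by linarith+
  qed
  have Kp: "(\<Sum>i<n. real K * p i) = real K" using p by (simp add: mixed_def flip: sum_distrib_left)
  have "(\<Sum>i<n. real (b i)) \<le> (\<Sum>i<n. real K * p i)" using b by (intro sum_mono) auto
  then have le: "(\<Sum>i<n. b i) \<le> K" using Kp by (simp flip: of_nat_sum)
  define m where "m = K - (\<Sum>i<n. b i)"
  have "(\<Sum>i<n. real K * p i) \<le> (\<Sum>i<n. real (b i) + 1)" using b by (intro sum_mono) auto
  then have m: "m \<le> n" using Kp le unfolding m_def by (simp add: sum.distrib flip: of_nat_sum)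
  define a where "a = (\<lambda>i. b i + (if i = 0 then m else 0))"
  have "(\<Sum>i<n. a i) = K" using n le by (simp add: a_def sum.distrib m_def)
  moreover have "\<bar>(\<Sum>i<n. real (a i) * f i) - real K * (\<Sum>i<n. p i * f i)\<bar> \<le> real n * F"
    if f: "\<forall>i<n. 0 \<le> f i \<and> f i \<le> F" for f F
  proof -
    have e: "(\<Sum>i<n. real (a i) * f i) = (\<Sum>i<n. real (b i) * f i) + real m * f 0"
    proof -
      have "real (a i) * f i = real (b i) * f i + (if i = 0 then real m * f 0 else 0)" for i
        by (simp add: a_def algebra_simps)
      then show ?thesis using n by (simp add: sum.distrib)
    qed
    have up: "(\<Sum>i<n. real (b i) * f i) \<le> (\<Sum>i<n. real K * p i * f i)"
      using b f by (intro sum_mono mult_right_mono) auto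
    have "(\<Sum>i<n. real K * p i * f i) \<le> (\<Sum>i<n. real (b i) * f i + F)"
    proof (rule sum_mono)
      fix i assume "i \<in> {..<n}"
      then have i: "i < n" by simp
      have "real K * p i * f i \<le> (real (b i) + 1) * f i" using b[OF i] f i by (intro mult_right_mono) auto
      then show "real K * p i * f i \<le> real (b i) * f i + F" using f i by (simp add: algebra_simps) (smt (verit))
    qed
    then have lo: "(\<Sum>i<n. real K * p i * f i) \<le> (\<Sum>i<n. real (b i) * f i) + real n * F" by (simp add: sum.distrib)
    have "0 \<le> real m * f 0" "real m * f 0 \<le> real n * F" using f n m by (auto intro: mult_mono)
    moreover have "real K * (\<Sum>i<n. p i * f i) = (\<Sum>i<n. real K * p i * f i)"
      by (simp add: sum_distrib_left mult.assoc)
    ultimately show ?thesis using up lo e by linarith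
  qed
  ultimately show ?thesis by blast
qed

section \<open>Near-optimal pairs\<close>

text \<open>Weak duality: averaging the bounds against an arbitrary opponent places
  \<open>\<beta>\<close> below and \<open>\<alpha>\<close> above the value, so what either strategy
  secures differs from the value by at most \<open>\<alpha> - \<beta>\<close>.\<close>

lemma near_optimal_from_bounds:
  assumes p: "mixed r p" and q: "mixed c q" and rc: "0 < r" "0 < c"
    and up: "\<And>j. j < c \<Longrightarrow> (\<Sum>i<r. p i * M i j) \<le> \<alpha>" and lo: "\<And>i. i < r \<Longrightarrow> \<beta> \<le> (\<Sum>j<c. q j * M i j)"
    and gap: "\<alpha> - \<beta> \<le> \<delta>"
  shows "row_guarantees r c M p (game_val r c M + \<delta>)" "col_guarantees r c M q (game_val r c M - \<delta>)"
proof -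
  have col: "expected_payoff r c M p' q' = (\<Sum>j<c. q' j * (\<Sum>i<r. p' i * M i j))" for p' q'
    unfolding expected_payoff_def by (subst sum.swap) (simp add: sum_distrib_left mult_ac)
  have row: "expected_payoff r c M p' q' = (\<Sum>i<r. p' i * (\<Sum>j<c. q' j * M i j))" for p' q'
    unfolding expected_payoff_def by (simp add: sum_distrib_left mult_ac)
  have avg_le: "(\<Sum>j<n. q' j * f j) \<le> C" if "mixed n q'" "\<And>j. j < n \<Longrightarrow> f j \<le> C" for n q' f and C :: real
  proof -
    have "(\<Sum>j<n. q' j * f j) \<le> (\<Sum>j<n. q' j * C)" using that by (intro sum_mono mult_left_mono) (auto simp: mixed_def)
    also have "\<dots> = C" using that(1) by (simp add: mixed_def flip: sum_distrib_right)
    finally show ?thesis .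
  qed
  have avg_ge: "C \<le> (\<Sum>j<n. q' j * f j)" if "mixed n q'" "\<And>j. j < n \<Longrightarrow> C \<le> f j" for n q' f and C :: real
  proof -
    have "(\<Sum>j<n. q' j * C) \<le> (\<Sum>j<n. q' j * f j)" using that by (intro sum_mono mult_left_mono) (auto simp: mixed_def)
    moreover have "(\<Sum>j<n. q' j * C) = C" using that(1) by (simp add: mixed_def flip: sum_distrib_right)
    ultimately show ?thesis by simp
  qed
  let ?F = "\<lambda>p. Max ((\<lambda>j. \<Sum>i<r. p i * M i j) ` {..<c})"
  have lower: "\<beta> \<le> ?F p'" if p': "mixed r p'" for p'
  proof -
    have "\<beta> \<le> expected_payoff r c M p' q" unfolding row by (rule avg_ge[OF p' lo])
    also have "\<dots> \<le> ?F p'" unfolding col by (rule avg_le[OF q]) (auto intro!: Max_ge)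
    finally show ?thesis .
  qed
  have "?F p \<le> \<alpha>" using rc up by (subst Max_le_iff) auto
  moreover have "game_val r c M \<le> ?F p" unfolding game_val_def
    by (rule cINF_lower) (use p lower in \<open>auto intro!: bdd_belowI2[of _ \<beta>]\<close>)
  ultimately have 1: "game_val r c M \<le> \<alpha>" by simp
  have 2: "\<beta> \<le> game_val r c M" unfolding game_val_def
    by (rule cINF_greatest) (use p lower in auto)
  show "row_guarantees r c M p (game_val r c M + \<delta>)"
    unfolding row_guarantees_def
  proof (intro conjI allI impI p)
    fix q' assume "mixed c q'"
    then have "expected_payoff r c M p q' \<le> \<alpha>" unfolding col by (rule avg_le[OF _ up])
    then show "expected_payoff r c M p q' \<le> game_val r c M + \<delta>" using 2 gap by linarith
  qed
  show "col_guarantees r c M q (game_val r c M - \<delta>)"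
    unfolding col_guarantees_def
  proof (intro conjI allI impI q)
    fix p' assume "mixed r p'"
    then have "\<beta> \<le> expected_payoff r c M p' q" unfolding row by (rule avg_ge[OF _ lo])
    then show "game_val r c M - \<delta> \<le> expected_payoff r c M p' q" using 1 gap by linarith
  qed
qed

section \<open>Soundness of certificates\<close>

lemma rd_decomp:
  "(\<forall>k<n. rd_nth_ok y k) \<Longrightarrow> y = concat (map nat_code (map (rd_nth y) [0..<n])) @ (rd_rest ^^ n) y"
proof (induction n)
  case (Suc n)
  then have "(rd_rest ^^ n) y = nat_code (rd_nth y n) @ (rd_rest ^^ Suc n) y"
    using rd_ok_decomp[of "(rd_rest ^^ n) y"] by (simp add: rd_nth_ok_def rd_nth_def)
  then show ?case using Suc by simp
qed simp

lemma rd_nth_shift: "rd_nth ((rd_rest ^^ m) w) k = rd_nth w (k + m)" "rd_nth_ok ((rd_rest ^^ m) w) k = rd_nth_ok w (k + m)"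
  by (simp_all add: rd_nth_def rd_nth_ok_def funpow_add)

lemma real_of_rat_quotient:
  assumes "d = nat (snd (quotient_of x))"
  shows "0 < d" "real_of_rat x * real d = of_int (fst (quotient_of x))"
proof -
  obtain p q where q: "quotient_of x = (p, q)" by fastforce
  then have "0 < q" "x = of_int p / of_int q" using quotient_of_denom_pos quotient_of_div by auto
  then show "0 < d" "real_of_rat x * real d = of_int (fst (quotient_of x))"
    using assms q by (simp_all add: of_rat_divide)
qed

lemma quotient_of_neg_iff: "fst (quotient_of x) < 0 \<longleftrightarrow> x < 0"
proof -
  obtain p q where q: "quotient_of x = (p, q)" by fastforce
  then have "0 < q" "x = of_int p / of_int q" using quotient_of_denom_pos quotient_of_div by auto
  then show ?thesis using q by (simp add: divide_less_0_iff)
qed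

text \<open>The test on natural numbers is this real equation multiplied by the positive denominator
  of \<open>x\<close>, with negative terms moved to the other side.\<close>

lemma matches_iff: "matches D C N x \<longleftrightarrow> real_of_rat x * real D = real N - real C"
proof -
  define d where "d = nat (snd (quotient_of x))"
  define n where "n = nat \<bar>fst (quotient_of x)\<bar>"
  note q = real_of_rat_quotient[OF d_def]
  have n: "of_int (fst (quotient_of x)) = (if x < 0 then - real n else real n)"
    using quotient_of_neg_iff[of x] by (auto simp: n_def)
  have "real_of_rat x * real D = real N - real C \<longleftrightarrow> real_of_rat x * real d * real D = (real N - real C) * real d"
  proof -
    have "real_of_rat x * real d * real D = real_of_rat x * real D * real d" by simp
    then show ?thesis using q(1) by (simp only: mult_cancel_right) simp
  qed
  also have "\<dots> \<longleftrightarrow> (if x < 0 then real N * real d + real n * real D = real C * real d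
       else real N * real d = real C * real d + real n * real D)"
    unfolding q(2) n by (auto simp: algebra_simps)
  also have "\<dots> \<longleftrightarrow> matches D C N x"
    unfolding matches_def Let_def d_def[symmetric] n_def[symmetric]
    by (auto simp flip: of_nat_mult of_nat_add)
  finally show ?thesis by simp
qed

section \<open>The order of magnitude of a rational, read off its code\<close>

lemma num_digit_within_iff:
  "length xs = length ys \<Longrightarrow> num_digit_within n (concat (map2 (\<lambda>d e. [d, e]) xs ys)) \<longleftrightarrow> True \<in> set (take n xs)"
proof (induction xs ys arbitrary: n rule: list_induct2)
  case Nil
  have "\<not> num_digit_within n []" by (induction n) auto
  then show ?case by simp
next
  case (Cons x xs y ys)
  then show ?case by (cases n) auto
qed

text \<open>The first nonzero numerator digit is its leading one, and the alignment puts
  \<open>max (length a) (length b) - length a\<close> zeros in front of it.\<close>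

lemma num_digit_within_rat_code:
  assumes "0 < x"
  defines "a \<equiv> bits (nat \<bar>fst (quotient_of x)\<bar>)" and "b \<equiv> bits (nat (snd (quotient_of x)))"
  shows "num_digit_within n (tl (rat_code x)) \<longleftrightarrow> max (length a) (length b) - length a < n"
proof -
  let ?l = "max (length a) (length b)"
  let ?A = "replicate (?l - length a) False @ rev a" and ?B = "replicate (?l - length b) False @ rev b"
  have "fst (quotient_of x) \<noteq> 0"
  proof
    assume "fst (quotient_of x) = 0"
    then have "x = 0" using quotient_of_div[of x] by (metis div_0 of_int_0 prod.collapse)
    then show False using assms by simp
  qed
  then have pos: "0 < nat \<bar>fst (quotient_of x)\<bar>" by simp
  have a: "a \<noteq> []" "last a" using last_bits[OF pos] pos unfolding a_def by auto
  then obtain z where z: "rev a = True # z" by (metis hd_rev list.exhaust_sel rev_is_Nil_conv)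
  have "tl (rat_code x) = concat (map2 (\<lambda>d e. [d, e]) ?A ?B)" by (simp add: rat_code_def Let_def a_def b_def)
  then have "num_digit_within n (tl (rat_code x)) \<longleftrightarrow> True \<in> set (take n ?A)"
    using num_digit_within_iff[of ?A ?B n] by simp
  also have "\<dots> \<longleftrightarrow> ?l - length a < n" using z by (cases "n - (?l - length a)") auto
  finally show ?thesis .
qed

text \<open>A number lies between half of \<open>2 ^ k\<close> and \<open>2 ^ k\<close>, where
  \<open>k\<close> is its number of digits. Hence \<open>x\<close> agrees with
  \<open>2 ^ length a / 2 ^ length b\<close> up to a factor 2 in either direction.\<close>

lemma rat_size_bounds:
  assumes "0 < x"
  defines "a \<equiv> bits (nat \<bar>fst (quotient_of x)\<bar>)" and "b \<equiv> bits (nat (snd (quotient_of x)))"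
  shows "real (2 ^ (length a)) \<le> 2 * (real_of_rat x * 2 ^ length b)" "real_of_rat x * 2 ^ length b \<le> 2 * 2 ^ length a"
    "0 < length a" "0 < length b"
proof -
  let ?n = "nat \<bar>fst (quotient_of x)\<bar>" and ?d = "nat (snd (quotient_of x))"
  note q = real_of_rat_quotient[OF refl, of x]
  have xp: "0 < real_of_rat x" using assms(1) by simp
  have num: "real ?n = real_of_rat x * real ?d"
    using q(2) quotient_of_neg_iff[of x] assms(1) by simp
  then have npos: "0 < ?n" using q(1) xp by (metis mult_pos_pos of_nat_0_less_iff)
  show la: "0 < length a" "0 < length b" using npos q(1) by (auto simp: a_def b_def)
  have A: "?n < 2 ^ length a" "2 ^ (length a - 1) \<le> ?n"
    unfolding a_def using less_power_length_bits power_length_bits_le[OF npos] by auto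
  have Bb: "?d < 2 ^ length b" "2 ^ (length b - 1) \<le> ?d"
    unfolding b_def using less_power_length_bits power_length_bits_le[OF q(1)] by auto
  have dbl: "(2::nat) ^ length a = 2 * 2 ^ (length a - 1)" "(2::nat) ^ length b = 2 * 2 ^ (length b - 1)"
    using la by (metis Suc_diff_1 power_Suc)+
  have le: "real (2 ^ length a) \<le> real (2 * ?n)" "real (2 ^ length b) \<le> real (2 * ?d)"
    "real ?n \<le> real (2 ^ length a)" "real ?d \<le> real (2 ^ length b)"
    using A Bb dbl unfolding of_nat_le_iff by linarith+
  have "real_of_rat x * real ?d \<le> real_of_rat x * 2 ^ length b"
    using le(4) xp by (intro mult_left_mono) auto
  then show "real (2 ^ (length a)) \<le> 2 * (real_of_rat x * 2 ^ length b)"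
    using le(1) num by (simp del: of_nat_power)
  have "real_of_rat x * real (2 ^ length b) \<le> real_of_rat x * real (2 * ?d)"
    using le(2) xp by (intro mult_left_mono) auto
  also have "\<dots> = 2 * real ?n" using num by simp
  finally show "real_of_rat x * 2 ^ length b \<le> 2 * 2 ^ length a" using le(3) by simp
qed

lemma num_digit_within_sound:
  assumes "0 < x" "num_digit_within n (tl (rat_code x))"
  shows "1 \<le> real_of_rat x * 2 ^ n"
proof -
  let ?a = "length (bits (nat \<bar>fst (quotient_of x)\<bar>))" and ?b = "length (bits (nat (snd (quotient_of x))))"
  have "?b + 1 \<le> ?a + n" using assms num_digit_within_rat_code by force
  note pw = power_increasing[OF this, of "2::real"]
  note bd = rat_size_bounds[OF assms(1)]
  have "(2::real) ^ ?b * 2 \<le> 2 ^ ?a * 2 ^ n" using pw by (simp add: power_add)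
  also have "\<dots> \<le> 2 * (real_of_rat x * 2 ^ ?b) * 2 ^ n" using bd(1) by (intro mult_right_mono) auto
  finally have "2 ^ ?b * 2 * (1::real) \<le> 2 ^ ?b * 2 * (real_of_rat x * 2 ^ n)" by (simp add: algebra_simps)
  then show ?thesis by (subst (asm) mult_le_cancel_left_pos) auto
qed

text \<open>Take one pair more than there are padding zeros. The summand 2 covers a numerator at
  least as long as the denominator, where \<open>n = 1\<close>; otherwise the extra pair and the
  factor 2 of \<open>rat_size_bounds\<close> make up the 4.\<close>

lemma num_digit_within_complete:
  assumes "0 < x"
  shows "\<exists>n. num_digit_within n (tl (rat_code x)) \<and> 2 ^ n \<le> 2 + 4 / real_of_rat x"
proof -
  let ?a = "length (bits (nat \<bar>fst (quotient_of x)\<bar>))" and ?b = "length (bits (nat (snd (quotient_of x))))"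
  note bd = rat_size_bounds[OF assms(1)]
  have xp: "0 < real_of_rat x" using assms by simp
  let ?n = "max ?a ?b - ?a + 1"
  have 1: "num_digit_within ?n (tl (rat_code x))" unfolding num_digit_within_rat_code[OF assms] by simp
  have "(2::real) ^ ?n \<le> 2 + 4 / real_of_rat x"
  proof (cases "?b \<le> ?a")
    case True
    then show ?thesis using xp by simp
  next
    case False
    then have e: "?n + ?a = ?b + 1" by simp
    have "(2::real) ^ ?n * 2 ^ ?a = 2 * 2 ^ ?b" unfolding power_add[symmetric] e by simp
    then have "real_of_rat x * 2 ^ ?n * 2 ^ ?a = 2 * (real_of_rat x * 2 ^ ?b)" by (simp add: algebra_simps)
    also have "\<dots> \<le> 4 * 2 ^ ?a" using bd(2) by simp
    finally have "real_of_rat x * 2 ^ ?n \<le> 4" by (subst (asm) mult_le_cancel_right_pos) auto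
    then have "2 ^ ?n \<le> 4 / real_of_rat x" using xp by (simp add: field_simps)
    then show ?thesis by linarith
  qed
  then show ?thesis using 1 by blast
qed

lemma cert_sound:
  assumes rc: "0 < r" "0 < c" and eps: "0 < \<epsilon>" and cert: "cert_ok r c M (rat_code \<epsilon>) y w"
  defines "MM \<equiv> (\<lambda>i j. real_of_rat (M i j))"
  defines "\<delta> \<equiv> real_of_rat \<epsilon> * (game_max r c MM - game_min r c MM)"
  shows "\<exists>a b. length a = r \<and> length b = c \<and> y = concat (map nat_code (a @ b)) \<and>
     row_guarantees r c MM (strategy a) (game_val r c MM + \<delta>) \<and>
     col_guarantees r c MM (strategy b) (game_val r c MM - \<delta>)"
proof -
  define D C Hi Lo Al Be E K where "D = header w nD" and "C = header w nO" and "Hi = header w nHi"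
    and "Lo = header w nLo" and "Al = header w nAl" and "Be = header w nBe" and "E = header w nE" and "K = header w nK"
  define N1 where "N1 = (\<lambda>i j. rd_nth w (i + (j * r + 8)))"
  define N2 where "N2 = (\<lambda>i j. rd_nth w (j + (i * c + (c * r + 8))))"
  define Y where "Y = rd_nth y"
  have pos: "1 \<le> K" "1 \<le> D" "1 \<le> E" using cert by (simp_all add: cert_ok_def K_def D_def E_def)
  have l1: "\<forall>m<c. line_ok nAcc nAl (header w) y ((rd_rest ^^ (m * r + 8)) w) (\<lambda>i. M i m) r"
    and l2: "\<forall>m<r. line_ok nBe nAcc (header w) ((rd_rest ^^ r) y) ((rd_rest ^^ (m * c + (c * r + 8))) w) (M m) c"
    and fin: "final_check (num_digit_within (length (bits E) - 1) (tl (rat_code \<epsilon>)) \<and> entry_above r c w \<and> entry_below r c w) (header w)"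
    and rest: "(rd_rest ^^ (c + r)) y = []"
    using cert unfolding cert_ok_def E_def by blast+
  have c1: "(\<Sum>i<r. Y i * N1 i j) \<le> Al" "(\<Sum>i<r. Y i) = K"
    "\<And>i. i < r \<Longrightarrow> MM i j * D = real (N1 i j) - C" "\<And>i. i < r \<Longrightarrow> rd_nth_ok y i" if "j < c" for j
    using l1 that unfolding line_ok_def entry_ok_def matches_iff
    by (simp_all add: line_sum_def rd_nth_shift Y_def N1_def Al_def K_def MM_def D_def C_def)
  have c2: "Be \<le> (\<Sum>j<c. Y (j + r) * N2 i j)" "(\<Sum>j<c. Y (j + r)) = K"
    "\<And>j. j < c \<Longrightarrow> MM i j * D = real (N2 i j) - C" "\<And>j. j < c \<Longrightarrow> rd_nth_ok y (j + r)" if "i < r" for i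
    using l2 that unfolding line_ok_def entry_ok_def matches_iff
    by (simp_all add: line_sum_def rd_nth_shift Y_def N2_def Be_def K_def MM_def D_def C_def)
  define a where "a = map Y [0..<r]"
  define b where "b = map (\<lambda>j. Y (j + r)) [0..<c]"
  have sa: "sum_list a = K" using c1(2)[OF rc(2)] by (simp add: a_def sum_list_distinct_conv_sum_set atLeast0LessThan)
  have sb: "sum_list b = K" using c2(2)[OF rc(1)] by (simp add: b_def sum_list_distinct_conv_sum_set atLeast0LessThan)
  have stra: "strategy a i = real (Y i) / K" if "i < r" for i using that sa by (simp add: strategy_def a_def)
  have strb: "strategy b j = real (Y (j + r)) / K" if "j < c" for j using that sb by (simp add: strategy_def b_def)
  have y: "y = concat (map nat_code (a @ b))"
  proof -
    have "rd_nth_ok y k" if "k < r + c" for k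
    proof (cases "k < r")
      case True
      then show ?thesis using c1(4)[OF rc(2)] by simp
    next
      case False
      then show ?thesis using c2(4)[OF rc(1), of "k - r"] that by simp
    qed
    then have "y = concat (map nat_code (map (rd_nth y) [0..<r + c]))"
      using rd_decomp[of "r + c" y] rest by (simp add: add.commute)
    also have "map (rd_nth y) [0..<r + c] = a @ b"
      by (rule nth_equalityI) (auto simp: a_def b_def Y_def nth_append)
    finally show ?thesis .
  qed
  have ma: "mixed r (strategy a)"
  proof -
    have "(\<Sum>i<r. strategy a i) = (\<Sum>i<r. real (Y i)) / K" by (simp add: stra sum_divide_distrib)
    also have "(\<Sum>i<r. real (Y i)) = real K" using c1(2)[OF rc(2)] by (metis of_nat_sum)
    finally show ?thesis using pos stra by (simp add: mixed_def)
  qed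
  have mb: "mixed c (strategy b)"
  proof -
    have "(\<Sum>j<c. strategy b j) = (\<Sum>j<c. real (Y (j + r))) / K" by (simp add: strb sum_divide_distrib)
    also have "(\<Sum>j<c. real (Y (j + r))) = real K" using c2(2)[OF rc(1)] by (metis of_nat_sum)
    finally show ?thesis using pos strb by (simp add: mixed_def)
  qed
  have D0: "0 < real D" "0 < real K" "0 < real E" using pos by auto
  have M1: "MM i j = (real (N1 i j) - C) / D" "MM i j = (real (N2 i j) - C) / D" if "i < r" "j < c" for i j
    using c1(3)[OF that(2,1)] c2(3)[OF that] D0(1) by (simp_all add: field_simps)
  \<comment> \<open>The probabilities sum to 1, so the shift \<open>C\<close> passes through the
    average unchanged, and the bound \<open>Al\<close> on the integer sums turns into a bound on
    payoffs.\<close>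
  have up: "(\<Sum>i<r. strategy a i * MM i j) \<le> (real Al / K - C) / D" if j: "j < c" for j
  proof -
    have "(\<Sum>i<r. strategy a i * MM i j) = (\<Sum>i<r. strategy a i * (real (N1 i j) - C)) / D"
      using M1(1) j by (simp add: sum_divide_distrib)
    also have "(\<Sum>i<r. strategy a i * (real (N1 i j) - C)) = (\<Sum>i<r. strategy a i * real (N1 i j)) - (\<Sum>i<r. strategy a i) * C"
      by (simp add: right_diff_distrib sum_subtractf sum_distrib_right)
    also have "(\<Sum>i<r. strategy a i * real (N1 i j)) = real (\<Sum>i<r. Y i * N1 i j) / K"
      by (simp add: stra sum_divide_distrib)
    also have "(\<Sum>i<r. strategy a i) = 1" using ma by (simp add: mixed_def)
    finally have e: "(\<Sum>i<r. strategy a i * MM i j) = (real (\<Sum>i<r. Y i * N1 i j) / K - 1 * real C) / D" .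
    have "real (\<Sum>i<r. Y i * N1 i j) \<le> real Al" using c1(1)[OF j] by (simp only: of_nat_le_iff)
    then show ?thesis unfolding e using D0 by (simp add: divide_right_mono)
  qed
  have lo: "(real Be / K - C) / D \<le> (\<Sum>j<c. strategy b j * MM i j)" if i: "i < r" for i
  proof -
    have "(\<Sum>j<c. strategy b j * MM i j) = (\<Sum>j<c. strategy b j * (real (N2 i j) - C)) / D"
      using M1(2) i by (simp add: sum_divide_distrib)
    also have "(\<Sum>j<c. strategy b j * (real (N2 i j) - C)) = (\<Sum>j<c. strategy b j * real (N2 i j)) - (\<Sum>j<c. strategy b j) * C"
      by (simp add: right_diff_distrib sum_subtractf sum_distrib_right)
    also have "(\<Sum>j<c. strategy b j * real (N2 i j)) = real (\<Sum>j<c. Y (j + r) * N2 i j) / K"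
      by (simp add: strb sum_divide_distrib)
    also have "(\<Sum>j<c. strategy b j) = 1" using mb by (simp add: mixed_def)
    finally have e: "(\<Sum>j<c. strategy b j * MM i j) = (real (\<Sum>j<c. Y (j + r) * N2 i j) / K - 1 * real C) / D" .
    have "real Be \<le> real (\<Sum>j<c. Y (j + r) * N2 i j)" using c2(1)[OF i] by (simp only: of_nat_le_iff)
    then show ?thesis unfolding e using D0 by (simp add: divide_right_mono)
  qed
  let ?S = "{MM i j | i j. i < r \<and> j < c}"
  have "?S = (\<lambda>(i, j). MM i j) ` ({..<r} \<times> {..<c})" by auto
  then have finS: "finite ?S" by simp
  have rng: "game_min r c MM \<le> MM i j" "MM i j \<le> game_max r c MM" if "i < r" "j < c" for i j
    unfolding game_min_def game_max_def using finS that by (auto intro!: Min_le Max_ge)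
  have rng0: "0 \<le> game_max r c MM - game_min r c MM" using rng[OF rc] by linarith
  define good where "good \<longleftrightarrow> num_digit_within (length (bits E) - 1) (tl (rat_code \<epsilon>)) \<and> entry_above r c w \<and> entry_below r c w"
  have fin': "E * Al + K * (if good then Lo else 0) \<le> E * Be + K * (if good then Hi else 0)"
    using fin unfolding final_check_def good_def[symmetric] unfolding E_def Al_def K_def Lo_def Be_def Hi_def .
  \<comment> \<open>If the thresholds were discarded, the gap is at most 0 and the range is
    nonnegative. Otherwise the gap is at most \<open>1 / E\<close> times the difference of the
    thresholds, where \<open>1 / E \<le> \<epsilon>\<close> by the scanned prefix and the difference
    is at most the range because entries lie beyond both thresholds.\<close>
  have "(real Al - Be) / (K * D) \<le> \<delta>"
  proof (cases good)
    case False
    then have "real (E * Al) \<le> real (E * Be)" using fin' by (simp only: of_nat_le_iff) simp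
    then have "real Al \<le> Be" using D0 by simp
    then have "(real Al - Be) / (K * D) \<le> 0" using D0 by (simp add: divide_nonpos_pos)
    also have "0 \<le> \<delta>" unfolding \<delta>_def using rng0 eps by simp
    finally show ?thesis .
  next
    case True
    have "real (E * Al + K * Lo) \<le> real (E * Be + K * Hi)" using fin' True by (simp only: of_nat_le_iff) simp
    then have f: "E * (real Al - Be) \<le> K * (real Hi - Lo)" by (simp add: algebra_simps)
    have hi: "(real Hi - C) / D \<le> game_max r c MM"
    proof -
      have "\<exists>i<r. \<exists>j<c. Hi < N1 i j \<or> Hi < N2 i j"
        using True unfolding good_def entry_above_def rd_nth_shift N1_def N2_def Hi_def by blast
      then obtain i j where ij: "i < r" "j < c" "real Hi \<le> N1 i j \<or> real Hi \<le> N2 i j"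
        by (metis less_imp_le of_nat_le_iff)
      then have "(real Hi - C) / D \<le> MM i j" using M1[OF ij(1,2)] D0 by (auto simp: divide_right_mono)
      then show ?thesis using rng(2)[OF ij(1,2)] by linarith
    qed
    have lw: "game_min r c MM \<le> (real Lo - C) / D"
    proof -
      have "\<exists>i<r. \<exists>j<c. N1 i j < Lo \<or> N2 i j < Lo"
        using True unfolding good_def entry_below_def rd_nth_shift N1_def N2_def Lo_def by blast
      then obtain i j where ij: "i < r" "j < c" "N1 i j \<le> real Lo \<or> N2 i j \<le> real Lo"
        by (metis less_imp_le of_nat_le_iff)
      then have "MM i j \<le> (real Lo - C) / D" using M1[OF ij(1,2)] D0 by (auto simp: divide_right_mono)
      then show ?thesis using rng(1)[OF ij(1,2)] by linarith
    qed
    have "1 \<le> real_of_rat \<epsilon> * 2 ^ (length (bits E) - 1)"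
      using num_digit_within_sound[OF eps] True by (simp add: good_def)
    also have "\<dots> \<le> real_of_rat \<epsilon> * E"
    proof -
      have "2 ^ (length (bits E) - 1) \<le> E" using power_length_bits_le[of E] pos by simp
      then have "real (2 ^ (length (bits E) - 1)) \<le> real E" by (simp only: of_nat_le_iff)
      then show ?thesis using eps by (intro mult_left_mono) auto
    qed
    finally have e: "1 / E \<le> real_of_rat \<epsilon>" using D0 by (simp add: field_simps)
    have "(real Al - Be) / (K * D) = (1 / E) * ((E * (real Al - Be)) / (K * D))" using D0 by simp
    also have "\<dots> \<le> (1 / E) * ((K * (real Hi - Lo)) / (K * D))"
      using f D0 by (intro mult_left_mono divide_right_mono) auto
    also have "\<dots> = (1 / E) * ((real Hi - C) / D - (real Lo - C) / D)" using D0 by (simp add: diff_divide_distrib)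
    also have "\<dots> \<le> (1 / E) * (game_max r c MM - game_min r c MM)" using hi lw D0 by (intro mult_left_mono) auto
    also have "\<dots> \<le> \<delta>" unfolding \<delta>_def using e rng0 by (intro mult_right_mono)
    finally show ?thesis .
  qed
  moreover have "(real Al / K - C) / D - (real Be / K - C) / D = (real Al - Be) / (K * D)"
    using D0 by (simp add: field_simps)
  ultimately have gap: "(real Al / K - C) / D - (real Be / K - C) / D \<le> \<delta>" by simp
  note near_optimal_from_bounds[OF ma mb rc up lo gap]
  then show ?thesis using y by (intro exI[of _ a] exI[of _ b]) (auto simp: a_def b_def)
qed

section \<open>Existence of certificates\<close>

lemma rd_concat:
  "k \<le> length xs \<Longrightarrow> (rd_rest ^^ k) (concat (map nat_code xs)) = concat (map nat_code (drop k xs))"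
  "k < length xs \<Longrightarrow> rd_nth (concat (map nat_code xs)) k = xs ! k"
  "k < length xs \<Longrightarrow> rd_nth_ok (concat (map nat_code xs)) k"
proof -
  show 1: "k \<le> length xs \<Longrightarrow> (rd_rest ^^ k) (concat (map nat_code xs)) = concat (map nat_code (drop k xs))" for k
  proof (induction k)
    case (Suc k)
    then have "drop k xs = xs ! k # drop (Suc k) xs" by (simp add: Cons_nth_drop_Suc)
    then show ?case using Suc by simp
  qed simp
  assume k: "k < length xs"
  then have "(rd_rest ^^ k) (concat (map nat_code xs)) = nat_code (xs ! k) @ concat (map nat_code (drop (Suc k) xs))"
    using 1[of k] by (simp add: Cons_nth_drop_Suc[symmetric])
  then show "rd_nth (concat (map nat_code xs)) k = xs ! k" "rd_nth_ok (concat (map nat_code xs)) k"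
    by (simp_all add: rd_nth_def rd_nth_ok_def)
qed

lemma length_nat_code_bound: "x < 2 ^ b \<Longrightarrow> length (nat_code x) \<le> 2 * b + 1"
  using length_bits_le[of x b] by (simp add: length_nat_code)

lemma length_codes_bound:
  "(\<And>x. x \<in> set xs \<Longrightarrow> x < 2 ^ b) \<Longrightarrow> length (concat (map nat_code xs)) \<le> length xs * (2 * b + 1)"
proof (induction xs)
  case (Cons x xs)
  then show ?case using length_nat_code_bound[of x b] by fastforce
qed simp

lemma length_bits_power: "length (bits (2 ^ n)) = Suc n"
proof (rule antisym)
  show "length (bits (2 ^ n)) \<le> Suc n" by (rule length_bits_le) simp
  have "(2::nat) ^ n < 2 ^ length (bits (2 ^ n))" by (rule less_power_length_bits)
  then show "Suc n \<le> length (bits (2 ^ n))" by simp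
qed

text \<open>Clearing denominators; the factor 4 leaves room for the strict tests against the thresholds.\<close>

lemma integer_payoffs:
  assumes len: "\<And>i j. i < r \<Longrightarrow> j < c \<Longrightarrow> length (rat_code (M i j)) \<le> l"
  shows "\<exists>D C N. 0 < D \<and> D < 2 ^ (l * (r * c) + l + 4) \<and> C < 2 ^ (l * (r * c) + l + 4) \<and>
    (\<forall>i<r. \<forall>j<c. matches D C (4 * N i j) (M i j) \<and> 4 * N i j < (2::nat) ^ (l * (r * c) + l + 4))"
proof -
  define den where "den = (\<lambda>i j. nat (snd (quotient_of (M i j))))"
  \<comment> \<open>\<open>P\<close> is a common denominator. Shifting by \<open>Z * P\<close>,
    where \<open>Z = 2 ^ l\<close> exceeds every numerator in absolute value, makes all scaled
    payoffs nonnegative.\<close>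
  define P where "P = (\<Prod>x\<in>{..<r} \<times> {..<c}. den (fst x) (snd x))"
  define Z :: nat where "Z = 2 ^ l"
  have den: "0 < den i j" "den i j < 2 ^ l" if "i < r" "j < c" for i j
    unfolding den_def using real_of_rat_quotient(1)[OF refl] rat_code_bounds(2)[OF len[OF that]] by auto
  have P0: "0 < P" unfolding P_def using den by (intro prod_pos) auto
  have "P \<le> (\<Prod>x\<in>{..<r} \<times> {..<c}. 2 ^ l)"
    unfolding P_def using den by (intro prod_mono) (auto simp: less_imp_le)
  then have P: "P \<le> 2 ^ (l * (r * c))" by (simp add: card_cartesian_product power_mult)
  have ZP: "Z * P \<le> 2 ^ (l * (r * c) + l)" using P by (simp add: Z_def power_add mult.commute)
  have ex: "\<exists>n::nat. real n = real (Z * P) + real_of_rat (M i j) * P \<and> n \<le> 2 * (Z * P)" if ij: "i < r" "j < c" for i j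
  proof -
    let ?n = "fst (quotient_of (M i j))"
    have "den i j dvd P" unfolding P_def using ij
      by (intro dvd_prodI[where f = "\<lambda>x. den (fst x) (snd x)" and a = "(i, j)", simplified]) auto
    then obtain k where k: "P = den i j * k" by blast
    have q: "real_of_rat (M i j) * real (den i j) = of_int ?n" by (rule real_of_rat_quotient(2)) (simp add: den_def)
    have "nat \<bar>?n\<bar> < Z" using rat_code_bounds(1)[OF len[OF ij]] by (simp add: Z_def)
    then have nZ: "\<bar>?n\<bar> \<le> int Z" by linarith
    have kP: "k \<le> P" using k den(1)[OF ij] by simp
    have "\<bar>?n * int k\<bar> \<le> int Z * int P" unfolding abs_mult using nZ kP by (intro mult_mono) auto
    then have b: "0 \<le> int (Z * P) + ?n * int k" "int (Z * P) + ?n * int k \<le> 2 * int (Z * P)"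
      unfolding of_nat_mult abs_le_iff by linarith+
    have e: "real_of_rat (M i j) * P = of_int (?n * int k)" using q by (simp add: k mult.assoc[symmetric])
    have "real (nat (int (Z * P) + ?n * int k)) = of_int (int (Z * P) + ?n * int k)" using b(1) by (simp only: of_nat_nat)
    also have "\<dots> = real (Z * P) + real_of_rat (M i j) * P" unfolding e by simp
    finally show ?thesis using b by (intro exI[of _ "nat (int (Z * P) + ?n * int k)"]) linarith
  qed
  define N where "N = (\<lambda>i j. SOME n::nat. real n = real (Z * P) + real_of_rat (M i j) * P \<and> n \<le> 2 * (Z * P))"
  have N: "real (N i j) = real (Z * P) + real_of_rat (M i j) * P" "N i j \<le> 2 * (Z * P)" if "i < r" "j < c" for i j
    using someI_ex[OF ex[OF that]] by (simp_all add: N_def)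
  \<comment> \<open>Four additional binary places absorb the factor 4 of the claim and the factor 2
    in \<open>N i j \<le> 2 * (Z * P)\<close>.\<close>
  have pw: "(2::nat) ^ (l * (r * c) + l + 4) = 16 * 2 ^ (l * (r * c) + l)" by (simp add: power_add)
  have ZP0: "0 < Z * P" using P0 by (simp add: Z_def)
  show ?thesis
  proof (rule exI[of _ "4 * P"], rule exI[of _ "4 * (Z * P)"], rule exI[of _ N], intro conjI allI impI)
    have "P \<le> Z * P" by (simp add: Z_def)
    then show "4 * P < 2 ^ (l * (r * c) + l + 4)" using ZP ZP0 unfolding pw by linarith
    show "4 * (Z * P) < 2 ^ (l * (r * c) + l + 4)" using ZP ZP0 unfolding pw by linarith
    fix i j assume ij: "i < r" "j < c"
    show "matches (4 * P) (4 * (Z * P)) (4 * N i j) (M i j)"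
      unfolding matches_iff using N(1)[OF ij] by (simp add: algebra_simps)
    show "4 * N i j < 2 ^ (l * (r * c) + l + 4)" using N(2)[OF ij] ZP ZP0 unfolding pw by linarith
  qed (use P0 in simp)
qed

text \<open>The weights will sum to \<open>2 ^ cert_scale\<close>.  The last summand makes one of them so long that
  four times the output exceeds the certificate.\<close>

definition cert_scale :: "nat \<Rightarrow> nat \<Rightarrow> nat \<Rightarrow> nat \<Rightarrow> nat" where
  "cert_scale r c l n = n + 2 + r + c + (8 + 2 * (r * c)) * (2 * (n + 2 + r + c + (l * (r * c) + l + n + 4) + 2) + 1)"

text \<open>After scaling the payoffs to the unit interval, an approximate equilibrium with gap
  \<open>1 / (4 * E)\<close> spends a quarter of the permitted \<open>K * (hi - lo)\<close>, and the
  rounding error, thanks to the size of \<open>K\<close>, another quarter. The remaining half pays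
  for thresholds strictly inside the range.\<close>

lemma integer_near_optimal:
  fixes N :: "nat \<Rightarrow> nat \<Rightarrow> nat"
  assumes rc: "0 < r" "0 < c" and E: "0 < E" and K: "4 * E * (r + c) \<le> K"
    and lohi: "\<And>i j. i < r \<Longrightarrow> j < c \<Longrightarrow> lo \<le> N i j \<and> N i j \<le> hi"
  shows "\<exists>a b. (\<Sum>i<r. a i) = K \<and> (\<Sum>j<c. b j) = K \<and>
    (\<forall>i<r. \<forall>j<c. real E * (real (\<Sum>k<r. a k * N k j) - real (\<Sum>k<c. b k * N i k)) \<le> real K * (real hi - real lo) / 2)"
proof -
  define F where "F = real hi - real lo"
  define f where "f = (\<lambda>i j. real (N i j) - real lo)"
  have "lo \<le> hi" using lohi[OF rc] by linarith
  then have F0: "0 \<le> F" by (simp add: F_def)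
  have f: "0 \<le> f i j" "f i j \<le> F" if "i < r" "j < c" for i j using lohi[OF that] by (simp_all add: f_def F_def)
  \<comment> \<open>For a constant matrix \<open>F = 0\<close> and the division yields 0, so that
    \<open>f i j = F * A i j\<close> stays true.\<close>
  define A where "A = (\<lambda>i j. f i j / F)"
  have A: "0 \<le> A i j \<and> A i j \<le> 1" if "i < r" "j < c" for i j
    using f[OF that] F0 by (auto simp: A_def divide_le_eq_1)
  have fA: "f i j = F * A i j" if "i < r" "j < c" for i j using f[OF that] F0 by (cases "F = 0") (auto simp: A_def)
  have d: "0 < 1 / (4 * real E)" using E by simp
  obtain p q where pq: "mixed r p" "mixed c q"
    "\<And>i j. i < r \<Longrightarrow> j < c \<Longrightarrow> (\<Sum>k<r. p k * A k j) \<le> (\<Sum>k<c. q k * A i k) + 1 / (4 * real E)"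
    using approximate_minimax[where A = A and r = r and c = c, OF rc A d] by blast
  obtain a where a: "(\<Sum>i<r. a i) = K" "\<And>f F. (\<forall>i<r. 0 \<le> f i \<and> f i \<le> F) \<Longrightarrow>
     \<bar>(\<Sum>i<r. real (a i) * f i) - real K * (\<Sum>i<r. p i * f i)\<bar> \<le> real r * F"
    using round_strategy[OF pq(1) rc(1), of K] by blast
  obtain b where b: "(\<Sum>j<c. b j) = K" "\<And>f F. (\<forall>i<c. 0 \<le> f i \<and> f i \<le> F) \<Longrightarrow>
     \<bar>(\<Sum>i<c. real (b i) * f i) - real K * (\<Sum>i<c. q i * f i)\<bar> \<le> real c * F"
    using round_strategy[OF pq(2) rc(2), of K] by blast
  have "real E * (real (\<Sum>k<r. a k * N k j) - real (\<Sum>k<c. b k * N i k)) \<le> real K * F / 2"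
    if ij: "i < r" "j < c" for i j
  proof -
    have sa: "real (\<Sum>k<r. a k * N k j) = (\<Sum>k<r. real (a k) * f k j) + real K * real lo"
    proof -
      have "(\<Sum>k<r. real (a k) * f k j) = (\<Sum>k<r. real (a k) * real (N k j)) - (\<Sum>k<r. real (a k)) * real lo"
        by (simp add: f_def right_diff_distrib sum_subtractf sum_distrib_right)
      also have "(\<Sum>k<r. real (a k)) = real K" using a(1) by (metis of_nat_sum)
      finally show ?thesis by simp
    qed
    have sb: "real (\<Sum>k<c. b k * N i k) = (\<Sum>k<c. real (b k) * f i k) + real K * real lo"
    proof -
      have "(\<Sum>k<c. real (b k) * f i k) = (\<Sum>k<c. real (b k) * real (N i k)) - (\<Sum>k<c. real (b k)) * real lo"
        by (simp add: f_def right_diff_distrib sum_subtractf sum_distrib_right)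
      also have "(\<Sum>k<c. real (b k)) = real K" using b(1) by (metis of_nat_sum)
      finally show ?thesis by simp
    qed
    have ra: "(\<Sum>k<r. real (a k) * f k j) \<le> real K * (\<Sum>k<r. p k * f k j) + real r * F"
      using a(2)[of "\<lambda>k. f k j" F] f ij by force
    have rb: "real K * (\<Sum>k<c. q k * f i k) - real c * F \<le> (\<Sum>k<c. real (b k) * f i k)"
      using b(2)[of "\<lambda>k. f i k" F] f ij by force
    have pA: "(\<Sum>k<r. p k * f k j) = F * (\<Sum>k<r. p k * A k j)"
      using fA ij by (simp add: sum_distrib_left mult.left_commute)
    have qA: "(\<Sum>k<c. q k * f i k) = F * (\<Sum>k<c. q k * A i k)"
      using fA ij by (simp add: sum_distrib_left mult.left_commute)
    have "F * (\<Sum>k<r. p k * A k j) \<le> F * ((\<Sum>k<c. q k * A i k) + 1 / (4 * real E))"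
      using pq(3)[OF ij] F0 by (intro mult_left_mono)
    then have "(\<Sum>k<r. p k * f k j) - (\<Sum>k<c. q k * f i k) \<le> F / (4 * real E)"
      unfolding pA qA by (simp add: algebra_simps)
    then have "real K * ((\<Sum>k<r. p k * f k j) - (\<Sum>k<c. q k * f i k)) \<le> real K * (F / (4 * real E))"
      by (intro mult_left_mono) auto
    then have "real (\<Sum>k<r. a k * N k j) - real (\<Sum>k<c. b k * N i k) \<le> real K * (F / (4 * real E)) + (real r + real c) * F"
      using ra rb unfolding sa sb by (simp add: algebra_simps)
    then have "real E * (real (\<Sum>k<r. a k * N k j) - real (\<Sum>k<c. b k * N i k)) \<le>
        real E * (real K * (F / (4 * real E)) + (real r + real c) * F)" by (intro mult_left_mono) auto
    also have "\<dots> = real K * F / 4 + (real (4 * E * (r + c)) * F) / 4" using E by (simp add: field_simps)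
    also have "\<dots> \<le> real K * F / 4 + (real K * F) / 4"
    proof -
      have "real (4 * E * (r + c)) \<le> real K" using K by (simp only: of_nat_le_iff)
      then have "real (4 * E * (r + c)) * F \<le> real K * F" using F0 by (rule mult_right_mono)
      then show ?thesis by (intro add_left_mono divide_right_mono) auto
    qed
    also have "\<dots> = real K * F / 2" by simp
    finally show ?thesis .
  qed
  then show ?thesis using a(1) b(1) unfolding F_def by blast
qed

text \<open>The alternative in the last assumption is exactly what the size parameter can guarantee:
  either \<open>n\<close> digit pairs reveal the magnitude of the precision, or the payoffs are
  constant and the final test succeeds without thresholds.\<close>

lemma cert_complete:
  assumes rc: "0 < r" "0 < c"
    and len: "\<And>i j. i < r \<Longrightarrow> j < c \<Longrightarrow> length (rat_code (M i j)) \<le> l"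
    and eps: "num_digit_within n (tl e) \<or> (\<forall>i<r. \<forall>j<c. M i j = M 0 0)"
  shows "\<exists>y w. length y \<le> (r + c) * (2 * (cert_scale r c l n + 1) + 1) \<and> length w \<le> 4 * length y \<and> cert_ok r c M e y w"
proof -
  \<comment> \<open>\<open>S0\<close> bounds the digits of the integer payoffs and of
    \<open>E = 2 ^ n\<close>. With \<open>2 ^ k0 = 4 * E * 2 ^ (r + c)\<close> the weight sum is
    large enough for the rounding. The padding \<open>s\<close> has to outweigh those parts of the
    certificate that do not depend on it.\<close>
  define S0 where "S0 = l * (r * c) + l + n + 4"
  define k0 where "k0 = n + 2 + r + c"
  define s where "s = (8 + 2 * (r * c)) * (2 * (k0 + S0 + 2) + 1)"
  have scale: "cert_scale r c l n = k0 + s" by (simp add: cert_scale_def k0_def s_def S0_def)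
  have pS: "(2::nat) ^ (l * (r * c) + l + 4) \<le> 2 ^ S0" by (intro power_increasing) (auto simp: S0_def)
  obtain D C N' where DCN': "0 < D" "D < 2 ^ (l * (r * c) + l + 4)" "C < 2 ^ (l * (r * c) + l + 4)"
    "\<forall>i<r. \<forall>j<c. matches D C (4 * N' i j) (M i j) \<and> 4 * N' i j < 2 ^ (l * (r * c) + l + 4)"
    using integer_payoffs[of r c M l, OF len] by blast
  have DCN: "0 < D" "D < 2 ^ S0" "C < 2 ^ S0" using DCN'(1-3) pS by linarith+
  have DCN4: "matches D C (4 * N' i j) (M i j) \<and> 4 * N' i j < 2 ^ S0" if "i < r" "j < c" for i j
    using DCN'(4) that pS by (meson less_le_trans)
  define N where "N = (\<lambda>i j. 4 * N' i j)"
  have N: "matches D C (N i j) (M i j)" "N i j < 2 ^ S0" if "i < r" "j < c" for i j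
    using DCN4[OF that] by (auto simp: N_def)
  define S where "S = (\<lambda>(i, j). N' i j) ` ({..<r} \<times> {..<c})"
  have S: "finite S" "S \<noteq> {}" using rc by (auto simp: S_def)
  define hi where "hi = 4 * Max S"
  define lo where "lo = 4 * Min S"
  have lohi: "lo \<le> N i j \<and> N i j \<le> hi" if "i < r" "j < c" for i j
    using that S(1) by (auto simp: lo_def hi_def N_def S_def intro!: Min_le Max_ge)
  obtain i1 j1 where hi: "i1 < r" "j1 < c" "hi = N i1 j1"
    using Max_in[OF S] by (auto simp: hi_def S_def N_def)
  obtain i0 j0 where lo: "i0 < r" "j0 < c" "lo = N i0 j0"
    using Min_in[OF S] by (auto simp: lo_def S_def N_def)
  \<comment> \<open>The scaled payoffs are multiples of 4, so if the extremes differ, moving both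
    inwards by 1 still leaves half of the range.\<close>
  have gap: "lo = hi \<or> lo + 4 \<le> hi"
  proof -
    have "lo \<le> hi" using lohi[OF rc] by linarith
    then show ?thesis unfolding lo_def hi_def by presburger
  qed
  have eps': "num_digit_within n (tl e)" if "lo \<noteq> hi"
  proof (rule ccontr)
    assume "\<not> num_digit_within n (tl e)"
    then have const: "\<forall>i<r. \<forall>j<c. M i j = M 0 0" using eps by blast
    have "M i0 j0 = M 0 0" "M i1 j1 = M 0 0" using const hi(1,2) lo(1,2) by blast+
    then have "real (N i0 j0) = real (N i1 j1)"
      using N(1)[OF hi(1,2)] N(1)[OF lo(1,2)] unfolding matches_iff by simp
    then show False using that hi(3) lo(3) by simp
  qed
  define E :: nat where "E = 2 ^ n"
  define K :: nat where "K = 2 ^ (k0 + s)"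
  have rc2: "r + c < 2 ^ (r + c)" by (rule less_exp)
  have "4 * E * (r + c) \<le> 4 * E * 2 ^ (r + c)" using rc2 by simp
  also have "\<dots> = 2 ^ k0" by (simp add: E_def k0_def power_add)
  also have "\<dots> \<le> K" by (simp add: K_def)
  finally have KE: "4 * E * (r + c) \<le> K" .
  have E0: "0 < E" by (simp add: E_def)
  obtain a b where ab: "(\<Sum>i<r. a i) = K" "(\<Sum>j<c. b j) = K"
    "\<And>i j. i < r \<Longrightarrow> j < c \<Longrightarrow> real E * (real (\<Sum>k<r. a k * N k j) - real (\<Sum>k<c. b k * N i k)) \<le> real K * (real hi - real lo) / 2"
    using integer_near_optimal[of r c E K lo N hi, OF rc E0 KE lohi] by blast
  define As where "As = (\<lambda>j. \<Sum>k<r. a k * N k j)"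
  define Bs where "Bs = (\<lambda>i. \<Sum>k<c. b k * N i k)"
  define Al where "Al = Max (As ` {..<c})"
  define Be where "Be = Min (Bs ` {..<r})"
  have Al: "As j \<le> Al" if "j < c" for j using that by (simp add: Al_def)
  have Be: "Be \<le> Bs i" if "i < r" for i using that by (simp add: Be_def)
  have "Al \<in> As ` {..<c}" unfolding Al_def by (rule Max_in) (use rc in auto)
  then obtain j' where j': "j' < c" "Al = As j'" by blast
  have "Be \<in> Bs ` {..<r}" unfolding Be_def by (rule Min_in) (use rc in auto)
  then obtain i' where i': "i' < r" "Be = Bs i'" by blast
  have main: "real E * (real Al - real Be) \<le> real K * (real hi - real lo) / 2"
    using ab(3)[OF i'(1) j'(1)] unfolding i'(2) j'(2) As_def Bs_def .
  \<comment> \<open>The thresholds must be exceeded strictly. For a constant matrix both are 0, so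
    the final inequality is the same whether or not its side conditions hold.\<close>
  define Hi where "Hi = (if lo = hi then 0 else hi - 1)"
  define Lo where "Lo = (if lo = hi then 0 else lo + 1)"
  have main': "E * Al + K * Lo \<le> E * Be + K * Hi"
  proof -
    have "real E * (real Al - real Be) \<le> real K * (real Hi - real Lo)"
    proof (cases "lo = hi")
      case True
      then show ?thesis using main by (simp add: Hi_def Lo_def)
    next
      case False
      then have "lo + 4 \<le> hi" using gap by simp
      then have "(real hi - real lo) / 2 \<le> real Hi - real Lo" using False by (simp add: Hi_def Lo_def of_nat_diff)
      then have "real K * ((real hi - real lo) / 2) \<le> real K * (real Hi - real Lo)" by (intro mult_left_mono) auto
      then show ?thesis using main by simp
    qed
    then have "real (E * Al + K * Lo) \<le> real (E * Be + K * Hi)" by (simp add: algebra_simps)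
    then show ?thesis by (simp only: of_nat_le_iff)
  qed
  define L1 where "L1 = map (\<lambda>k. N (k mod r) (k div r)) [0..<c * r]"
  define L2 where "L2 = map (\<lambda>k. N (k div c) (k mod c)) [0..<r * c]"
  define wl where "wl = [D, C, Hi, Lo, Al, Be, E, K] @ L1 @ L2"
  define w where "w = concat (map nat_code wl)"
  define yl where "yl = map a [0..<r] @ map b [0..<c]"
  define y where "y = concat (map nat_code yl)"
  have lwl: "length wl = 8 + c * r + r * c" by (simp add: wl_def L1_def L2_def)
  have lyl: "length yl = r + c" by (simp add: yl_def)
  have hdr: "header w nD = D" "header w nO = C" "header w nHi = Hi" "header w nLo = Lo" "header w nAl = Al"
    "header w nBe = Be" "header w nE = E" "header w nK = K"
    unfolding header_def w_def by (subst rd_concat(2); simp add: lwl; simp add: wl_def nth_append)+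
  have wok: "rd_nth_ok w k" if "k < 8 + c * r + r * c" for k unfolding w_def by (rule rd_concat(3)) (use that lwl in simp)
  have yok: "rd_nth_ok y k" if "k < r + c" for k unfolding y_def by (rule rd_concat(3)) (use that lyl in simp)
  have Ya: "rd_nth y k = a k" if "k < r" for k
    unfolding y_def by (subst rd_concat(2)) (use that lyl in \<open>auto simp: yl_def nth_append\<close>)
  have Yb: "rd_nth y (k + r) = b k" if "k < c" for k
    unfolding y_def by (subst rd_concat(2)) (use that lyl in \<open>auto simp: yl_def nth_append\<close>)
  have idx: "i + m * r < c * r" if "i < r" "m < c" for i m r c :: nat
  proof -
    have "i + m * r < Suc m * r" using that by simp
    also have "\<dots> \<le> c * r" using that by (intro mult_right_mono) auto
    finally show ?thesis .
  qed
  have W1: "rd_nth w (i + (m * r + 8)) = N i m" "rd_nth_ok w (i + (m * r + 8))" if "i < r" "m < c" for i m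
  proof -
    note x = idx[OF that]
    have "rd_nth w (i + (m * r + 8)) = wl ! (i + (m * r + 8))"
      unfolding w_def by (rule rd_concat(2)) (use x lwl in linarith)
    also have "\<dots> = L1 ! (i + m * r)" using x by (simp add: wl_def nth_append L1_def)
    also have "\<dots> = N i m" using x that by (simp add: L1_def)
    finally show "rd_nth w (i + (m * r + 8)) = N i m" .
    show "rd_nth_ok w (i + (m * r + 8))" by (rule wok) (use x in linarith)
  qed
  have W2: "rd_nth w (j + (m * c + (c * r + 8))) = N m j" "rd_nth_ok w (j + (m * c + (c * r + 8)))" if "j < c" "m < r" for j m
  proof -
    note x = idx[OF that]
    have "rd_nth w (j + (m * c + (c * r + 8))) = wl ! (j + (m * c + (c * r + 8)))"
      unfolding w_def by (rule rd_concat(2)) (use x lwl in linarith)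
    also have "\<dots> = L2 ! (j + m * c)" using x by (simp add: wl_def nth_append L1_def)
    also have "\<dots> = N m j" using x that by (simp add: L2_def)
    finally show "rd_nth w (j + (m * c + (c * r + 8))) = N m j" .
    show "rd_nth_ok w (j + (m * c + (c * r + 8)))" by (rule wok) (use x in linarith)
  qed
  have cert: "cert_ok r c M e y w"
    unfolding cert_ok_def
  proof (intro conjI allI impI)
    show "rd_nth_ok w k" if "k < 8" for k by (rule wok) (use that in simp)
    show "1 \<le> header w nK" "1 \<le> header w nD" "1 \<le> header w nE" using DCN(1) E0 unfolding hdr by (simp_all add: K_def)
    show "line_ok nAcc nAl (header w) y ((rd_rest ^^ (m * r + 8)) w) (\<lambda>i. M i m) r" if m: "m < c" for m
    proof -
      have "line_sum y ((rd_rest ^^ (m * r + 8)) w) r = As m"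
        unfolding line_sum_def As_def rd_nth_shift by (intro sum.cong) (use Ya W1 m in auto)
      moreover have "(\<Sum>i<r. rd_nth y i) = K" using ab(1) Ya by simp
      moreover have "\<forall>i<r. entry_ok (header w) y ((rd_rest ^^ (m * r + 8)) w) (\<lambda>i. M i m) i"
        unfolding entry_ok_def rd_nth_shift hdr using W1 N(1) m yok by simp
      ultimately show ?thesis unfolding line_ok_def using Al[OF m] hdr by simp
    qed
    show "line_ok nBe nAcc (header w) ((rd_rest ^^ r) y) ((rd_rest ^^ (m * c + (c * r + 8))) w) (M m) c" if m: "m < r" for m
    proof -
      have "line_sum ((rd_rest ^^ r) y) ((rd_rest ^^ (m * c + (c * r + 8))) w) c = Bs m"
        unfolding line_sum_def Bs_def rd_nth_shift by (intro sum.cong) (use Yb W2 m in auto)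
      moreover have "(\<Sum>i<c. rd_nth ((rd_rest ^^ r) y) i) = K" using ab(2) Yb by (simp add: rd_nth_shift)
      moreover have "\<forall>i<c. entry_ok (header w) ((rd_rest ^^ r) y) ((rd_rest ^^ (m * c + (c * r + 8))) w) (M m) i"
        unfolding entry_ok_def rd_nth_shift hdr using W2 N(1) m yok by simp
      ultimately show ?thesis unfolding line_ok_def using Be[OF m] hdr by simp
    qed
    show "(rd_rest ^^ (c + r)) y = []" unfolding y_def by (subst rd_concat(1)) (simp_all add: lyl add.commute)
    show "final_check (num_digit_within (length (bits (header w nE)) - 1) (tl e) \<and> entry_above r c w \<and> entry_below r c w) (header w)"
    proof (cases "lo = hi")
      case True
      then show ?thesis using main' unfolding final_check_def hdr by (simp add: Hi_def Lo_def)
    next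
      case False
      have "num_digit_within (length (bits (header w nE)) - 1) (tl e)"
        using eps'[OF False] unfolding hdr E_def length_bits_power by simp
      moreover have "entry_above r c w"
      proof -
        have "Hi < N i1 j1" using False gap hi(3) by (auto simp: Hi_def)
        then show ?thesis unfolding entry_above_def rd_nth_shift hdr using W1(1)[OF hi(1,2)] hi(1,2) by metis
      qed
      moreover have "entry_below r c w"
      proof -
        have "N i0 j0 < Lo" using False lo(3) by (auto simp: Lo_def)
        then show ?thesis unfolding entry_below_def rd_nth_shift hdr using W1(1)[OF lo(1,2)] lo(1,2) by metis
      qed
      ultimately show ?thesis using main' unfolding final_check_def hdr by simp
    qed
  qed
  have KB: "K < 2 ^ (k0 + s + 1)" by (simp add: K_def)
  have a_le: "a i \<le> K" if "i < r" for i using member_le_sum[of i "{..<r}" a] that ab(1) by simp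
  have b_le: "b i \<le> K" if "i < c" for i using member_le_sum[of i "{..<c}" b] that ab(2) by simp
  have ylen: "length y \<le> (r + c) * (2 * (cert_scale r c l n + 1) + 1)"
    unfolding y_def lyl[symmetric] scale
  proof (rule length_codes_bound)
    fix x assume "x \<in> set yl"
    then have "x \<le> K" using a_le b_le by (auto simp: yl_def)
    then show "x < 2 ^ (k0 + s + 1)" using KB by linarith
  qed
  \<comment> \<open>Otherwise the weights would sum to less than \<open>2 ^ r * 2 ^ s\<close>, which
    is at most \<open>K\<close>. A weight of this size forces the output to have at least
    \<open>2 * s\<close> letters.\<close>
  have "\<exists>i<r. 2 ^ s \<le> a i"
  proof (rule ccontr)
    assume "\<not> (\<exists>i<r. 2 ^ s \<le> a i)"
    then have "\<And>i. i \<in> {..<r} \<Longrightarrow> a i \<le> 2 ^ s" by force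
    from sum_bounded_above[of "{..<r}" a, OF this] have "K \<le> r * 2 ^ s" using ab(1) by simp
    also have "\<dots> < 2 ^ r * 2 ^ s" using less_exp[of r] by simp
    also have "\<dots> \<le> 2 ^ k0 * 2 ^ s" by (intro mult_right_mono power_increasing) (auto simp: k0_def)
    finally show False by (simp add: K_def power_add)
  qed
  then obtain i where i: "i < r" "2 ^ s \<le> a i" by blast
  have ylow: "2 * s \<le> length y"
  proof -
    have "(2::nat) ^ s < 2 ^ length (bits (a i))" using le_less_trans[OF i(2) less_power_length_bits] .
    then have "s < length (bits (a i))" by simp
    moreover have "length (nat_code (a i)) \<le> length y"
    proof -
      have "nat_code (a i) \<in> set (map nat_code yl)" using i(1) by (auto simp: yl_def)
      then have "length (nat_code (a i)) \<le> sum_list (map length (map nat_code yl))"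
        by (intro member_le_sum_list) auto
      then show ?thesis by (simp add: y_def length_concat)
    qed
    ultimately show ?thesis by (simp add: length_nat_code)
  qed
  have wlen: "length w \<le> 4 * length y"
  proof -
    have pn: "hi < 2 ^ S0" "lo < 2 ^ S0" using hi lo N(2) by auto
    have st: "Hi < 2 ^ S0" "Lo < 2 ^ S0" "E < 2 ^ S0"
    proof -
      show "Hi < 2 ^ S0" "Lo < 2 ^ S0" using pn gap unfolding Hi_def Lo_def by auto
      have "n < S0" by (simp add: S0_def)
      then show "E < 2 ^ S0" unfolding E_def by (intro power_strict_increasing) auto
    qed
    have big: "x < 2 ^ (k0 + s + 1 + S0)" if "x \<le> K * 2 ^ S0" for x
    proof -
      have "K * 2 ^ S0 < 2 ^ (k0 + s + 1) * 2 ^ S0" using KB by simp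
      then show ?thesis using that unfolding power_add[symmetric] by linarith
    qed
    have "Al \<le> K * 2 ^ S0" unfolding j'(2) As_def ab(1)[symmetric] sum_distrib_right
      by (rule sum_mono, rule mult_left_mono) (use N(2) j'(1) in \<open>auto simp: less_imp_le\<close>)
    then have AlB: "Al < 2 ^ (k0 + s + 1 + S0)" by (rule big)
    have "Be \<le> K * 2 ^ S0" unfolding i'(2) Bs_def ab(2)[symmetric] sum_distrib_right
      by (rule sum_mono, rule mult_left_mono) (use N(2) i'(1) in \<open>auto simp: less_imp_le\<close>)
    then have BeB: "Be < 2 ^ (k0 + s + 1 + S0)" by (rule big)
    have KB': "K < 2 ^ (k0 + s + 1 + S0)" by (rule big) simp
    have lL: "length L1 = c * r" "length L2 = r * c" by (simp_all add: L1_def L2_def)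
    define X1 X2 where "X1 = (c * r) * (2 * S0 + 1)" and "X2 = (r * c) * (2 * S0 + 1)"
    have l1: "length (concat (map nat_code L1)) \<le> X1" unfolding X1_def lL(1)[symmetric]
      by (rule length_codes_bound) (use N(2) rc in \<open>auto simp: L1_def less_mult_imp_div_less\<close>)
    have l2: "length (concat (map nat_code L2)) \<le> X2" unfolding X2_def lL(2)[symmetric]
      by (rule length_codes_bound) (use N(2) rc in \<open>auto simp: L2_def less_mult_imp_div_less\<close>)
    have "length w = length (nat_code D) + length (nat_code C) + length (nat_code Hi) + length (nat_code Lo) + length (nat_code Al)
        + length (nat_code Be) + length (nat_code E) + length (nat_code K) + length (concat (map nat_code L1)) + length (concat (map nat_code L2))"
      by (simp add: w_def wl_def)
    also have "\<dots> \<le> 5 * (2 * S0 + 1) + 3 * (2 * (k0 + s + 1 + S0) + 1) + X1 + X2"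
      using length_nat_code_bound[OF DCN(2)] length_nat_code_bound[OF DCN(3)] length_nat_code_bound[OF st(1)]
        length_nat_code_bound[OF st(2)] length_nat_code_bound[OF st(3)] length_nat_code_bound[OF AlB]
        length_nat_code_bound[OF BeB] length_nat_code_bound[OF KB'] l1 l2
      by simp
    \<comment> \<open>Only \<open>Al\<close>, \<open>Be\<close> and \<open>K\<close> depend on
      \<open>s\<close>, with \<open>2 * s\<close> letters each; by the choice of \<open>s\<close>
      everything else fits into one more \<open>s\<close>. The \<open>7 * s\<close> letters needed
      thus stay below the \<open>8 * s\<close> that the prefix is sure to contain.\<close>
    also have "\<dots> \<le> 6 * s + (8 + 2 * (r * c)) * (2 * (k0 + S0 + 2) + 1)"
      by (simp add: X1_def X2_def algebra_simps)
    also have "\<dots> = 7 * s" by (simp add: s_def)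
    also have "\<dots> \<le> 4 * length y" using ylow by simp
    finally show ?thesis .
  qed
  show ?thesis using ylen wlen cert by blast
qed

section \<open>Polynomial bounds\<close>

lemma polybound_pCons: "polybound (pCons a p) x = real a + x * polybound p x"
  by (simp add: polybound_def map_poly_pCons)

lemma polybound_0: "polybound 0 x = 0"
  by (simp add: polybound_def)

lemma polybound_add: "polybound (p + q) x = polybound p x + polybound q x"
  by (induction p q rule: poly_induct2) (simp_all add: polybound_pCons polybound_0 algebra_simps)

lemma polybound_of_nat: "polybound p (real n) = real (poly p n)"
  by (induction p) (simp_all add: polybound_pCons polybound_0)

lemma polybound_nonneg: "0 \<le> x \<Longrightarrow> 0 \<le> polybound p x"
  by (induction p) (simp_all add: polybound_pCons polybound_0)

lemma polybound_mono: "0 \<le> x \<Longrightarrow> x \<le> y \<Longrightarrow> polybound p x \<le> polybound p y"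
  by (induction p) (simp_all add: polybound_pCons polybound_0 mult_mono polybound_nonneg)

text \<open>The argument \<open>1 + x\<close> dominates the rounded-up \<open>x\<close>, so a
  polynomial bound at the rounded size becomes a polynomial bound at the real size.\<close>

lemma polybound_shift: "\<exists>q. \<forall>x. polybound q x = polybound p (1 + x)"
proof (induction p)
  case 0
  show ?case by (rule exI[of _ 0]) (simp add: polybound_0)
next
  case (pCons a p)
  then obtain q where q: "\<And>x. polybound q x = polybound p (1 + x)" by blast
  show ?case
    by (rule exI[of _ "[:a:] + (q + pCons 0 q)"])
      (simp add: polybound_add polybound_pCons polybound_0 q algebra_simps)
qed

lemma poly_nat_mono: "m \<le> n \<Longrightarrow> poly p m \<le> poly p n" for p :: "nat poly"
  by (induction p) (simp_all add: mult_le_mono)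

definition poly_fun :: "(nat \<Rightarrow> nat) \<Rightarrow> bool" where
  "poly_fun f \<longleftrightarrow> (\<exists>p. \<forall>n. f n = poly p n)"

lemma poly_fun_const: "poly_fun (\<lambda>_. k)"
  unfolding poly_fun_def by (rule exI[of _ "[:k:]"]) simp

lemma poly_fun_id: "poly_fun (\<lambda>n. n)"
  unfolding poly_fun_def by (rule exI[of _ "[:0, 1:]"]) simp

lemma poly_fun_add: "poly_fun f \<Longrightarrow> poly_fun g \<Longrightarrow> poly_fun (\<lambda>n. f n + g n)"
  unfolding poly_fun_def by (metis poly_add)

lemma poly_fun_mult: "poly_fun f \<Longrightarrow> poly_fun g \<Longrightarrow> poly_fun (\<lambda>n. f n * g n)"
  unfolding poly_fun_def by (metis poly_mult)

lemma poly_fun_power: "poly_fun f \<Longrightarrow> poly_fun (\<lambda>n. f n ^ k)"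
  unfolding poly_fun_def by (metis poly_power)

lemma poly_fun_poly: "poly_fun f \<Longrightarrow> poly_fun (\<lambda>n. poly q (f n))"
  unfolding poly_fun_def by (metis poly_pcompose)

lemma poly_fun_Suc: "poly_fun f \<Longrightarrow> poly_fun (\<lambda>n. Suc (f n))"
  using poly_fun_add[OF _ poly_fun_const[of 1]] by simp

lemmas poly_fun_intros = poly_fun_const poly_fun_id poly_fun_add poly_fun_mult poly_fun_power poly_fun_poly poly_fun_Suc

lemma poly_fun_polybound:
  assumes "poly_fun f"
  shows "\<exists>T. \<forall>x\<ge>0. real (f (nat \<lceil>x\<rceil>)) \<le> polybound T x \<and> polybound T x \<le> real (f (nat \<lceil>x\<rceil> + 1))"
proof -
  obtain p where p: "\<And>n. f n = poly p n" using assms unfolding poly_fun_def by blast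
  obtain T where T: "\<And>x. polybound T x = polybound p (1 + x)" using polybound_shift[of p] by blast
  have "real (f (nat \<lceil>x\<rceil>)) \<le> polybound T x \<and> polybound T x \<le> real (f (nat \<lceil>x\<rceil> + 1))" if x: "0 \<le> x" for x
  proof
    have n: "real (nat \<lceil>x\<rceil>) \<le> 1 + x" "x \<le> real (nat \<lceil>x\<rceil>)" using x by linarith+
    show "real (f (nat \<lceil>x\<rceil>)) \<le> polybound T x"
      unfolding p polybound_of_nat[symmetric] T using n by (intro polybound_mono) auto
    show "polybound T x \<le> real (f (nat \<lceil>x\<rceil> + 1))"
      unfolding p polybound_of_nat[symmetric] T using n x by (intro polybound_mono) auto
  qed
  then show ?thesis by blast
qed

section \<open>Payoff codes are short\<close>

text \<open>A step pushes at most one letter, and the trivial oracle only erases. Computation time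
  therefore bounds the length of the result, which is how the polynomial-time oracle limits the
  digits of the payoffs.\<close>

lemma exec_length:
  "exec (\<lambda>_. []) P s t s' \<Longrightarrow> length (s' k) \<le> length (s k) + t"
  by (induction arbitrary: k rule: exec.induct) (fastforce intro: le_trans)+

section \<open>The size parameter\<close>

definition game_size :: "game_instance \<Rightarrow> real" where
  "game_size g = real (rows g) + real (cols g) + log 2 (real (rows g * cols g)) / real_of_rat (eps g)"

definition game_order :: "game_instance \<Rightarrow> nat" where
  "game_order g = nat \<lceil>game_size g\<rceil>"

text \<open>\<open>4 * n + 2\<close> bounds the length of a query, which consists of two codes of
  indices below \<open>n\<close>; the second summand is the time, during which each step can add one
  letter.\<close>

definition code_bound :: "nat poly \<Rightarrow> nat \<Rightarrow> nat" where
  "code_bound q n = (4 * n + 2) + poly q (4 * n + 2)"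

text \<open>The precision \<open>4 * n + 2\<close> comes from
  \<open>2 ^ m \<le> 2 + 4 / \<epsilon>\<close> together with \<open>1 / \<epsilon> \<le> n\<close>
  and \<open>m < 2 ^ m\<close>.\<close>

definition output_bound :: "nat poly \<Rightarrow> nat \<Rightarrow> nat" where
  "output_bound q n = (n + n) * (2 * (cert_scale n n (code_bound q n) (4 * n + 2) + 1) + 1)"

definition time_bound :: "nat poly \<Rightarrow> nat \<Rightarrow> nat" where
  "time_bound q n = 4 * output_bound q n + (52 * (n * n) + 44 * n + 68) *
     (100 * (9 * output_bound q (n + 1) + code_bound q n + 4 * n + 8 + 1) ^ 2)"

lemma poly_fun_code_bound: "poly_fun f \<Longrightarrow> poly_fun (\<lambda>n. code_bound q (f n))"
  unfolding code_bound_def by (intro poly_fun_intros)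

lemma poly_fun_output_bound: "poly_fun f \<Longrightarrow> poly_fun (\<lambda>n. output_bound q (f n))"
  unfolding output_bound_def cert_scale_def by (intro poly_fun_intros poly_fun_code_bound)

lemma poly_fun_time_bound: "poly_fun (time_bound q)"
  unfolding time_bound_def[abs_def] by (intro poly_fun_intros poly_fun_code_bound poly_fun_output_bound)

lemma cert_scale_mono:
  "r \<le> r' \<Longrightarrow> c \<le> c' \<Longrightarrow> l \<le> l' \<Longrightarrow> n \<le> n' \<Longrightarrow> cert_scale r c l n \<le> cert_scale r' c' l' n'"
  unfolding cert_scale_def by (intro add_mono mult_le_mono order.refl)

lemma accepts_iff:
  assumes "runs Or P ws t out"
  shows "accepts Or P ws \<longleftrightarrow> out = [True]"
proof
  assume "accepts Or P ws"
  then obtain t' where "runs Or P ws t' [True]" unfolding accepts_def by blast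
  then show "out = [True]" using assms exec_deterministic unfolding runs_def by blast
qed (use assms in \<open>auto simp: accepts_def\<close>)

locale valid_game =
  fixes q :: "nat poly" and g :: game_instance
  assumes valid: "valid_instance q g"
begin

lemma basics:
  "0 < eps g" "0 < rows g" "0 < cols g"
  "\<And>i j. i < rows g \<Longrightarrow> j < cols g \<Longrightarrow> payoff_oracle g (nat_code i @ nat_code j) = rat_code (payoff g i j)"
  using valid by (auto simp: valid_instance_def)

lemma log_nonneg: "0 \<le> log 2 (real (rows g * cols g)) / real_of_rat (eps g)"
proof -
  have "1 \<le> rows g * cols g" using basics by (simp add: Suc_leI)
  then have "1 \<le> real (rows g * cols g)" by (simp only: of_nat_1[symmetric, where 'a = real] of_nat_le_iff)
  then show ?thesis using basics(1) by (simp del: of_nat_mult)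
qed

lemma size_bounds: "0 \<le> game_size g" "rows g \<le> game_order g" "cols g \<le> game_order g"
  "rows g * cols g \<noteq> 1 \<Longrightarrow> 1 / real_of_rat (eps g) \<le> real (game_order g)"
proof -
  have s: "real (rows g) + real (cols g) \<le> game_size g" using log_nonneg by (simp add: game_size_def)
  then show 0: "0 \<le> game_size g" by linarith
  have o: "game_size g \<le> real (game_order g)" unfolding game_order_def by linarith
  have "real (rows g) \<le> real (game_order g)" "real (cols g) \<le> real (game_order g)" using s o by linarith+
  then show "rows g \<le> game_order g" "cols g \<le> game_order g" by simp_all
  assume n1: "rows g * cols g \<noteq> 1"
  have "0 < rows g * cols g" using basics by simp
  \<comment> \<open>With at least two entries the logarithm is at least 1, so the size dominates
    \<open>1 / \<epsilon>\<close>.\<close>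
  then have "2 \<le> rows g * cols g" using n1 by linarith
  then have "real 2 \<le> real (rows g * cols g)" by (simp only: of_nat_le_iff)
  then have "log 2 2 \<le> log 2 (real (rows g * cols g))" by (subst log_le_cancel_iff) auto
  then have "1 / real_of_rat (eps g) \<le> log 2 (real (rows g * cols g)) / real_of_rat (eps g)"
    using basics(1) by (intro divide_right_mono) auto
  also have "\<dots> \<le> game_size g" by (simp add: game_size_def)
  finally show "1 / real_of_rat (eps g) \<le> real (game_order g)" using o by linarith
qed

lemma payoff_code_length:
  assumes "i < rows g" "j < cols g"
  shows "length (rat_code (payoff g i j)) \<le> code_bound q (game_order g)"
proof -
  let ?w = "nat_code i @ nat_code j"
  have w: "length ?w \<le> 4 * game_order g + 2"
    using length_nat_code_le[of i] length_nat_code_le[of j] assms size_bounds(2,3) by simp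
  obtain G t where t: "t \<le> poly q (length ?w)" "runs (\<lambda>_. []) G [?w] t (payoff_oracle g ?w)"
    using valid assms unfolding valid_instance_def Let_def by blast
  then obtain s where "exec (\<lambda>_. []) G (\<lambda>k. if k < length [?w] then [?w] ! k else []) t s" "s 0 = payoff_oracle g ?w"
    unfolding runs_def by blast
  from exec_length[OF this(1), of 0] this(2) have "length (payoff_oracle g ?w) \<le> length ?w + t" by simp
  also have "\<dots> \<le> (4 * game_order g + 2) + poly q (4 * game_order g + 2)"
    using w t(1) poly_nat_mono[OF w, of q] by linarith
  finally show ?thesis using basics(4)[OF assms] by (simp add: code_bound_def)
qed

lemma verifier_time:
  assumes "length y \<le> output_bound q (game_order g + 1)"
  shows "\<exists>t out. runs (payoff_oracle g) verifier (game_input g @ [y] @ [u, v]) t out \<and> t \<le> time_bound q (game_order g)"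
    "accepts (payoff_oracle g) verifier (game_input g @ [y] @ [u, v]) \<longleftrightarrow>
       cert_ok (rows g) (cols g) (payoff g) (rat_code (eps g)) y (take (4 * length y) u)"
proof -
  let ?n = "game_order g" and ?r = "rows g" and ?c = "cols g" and ?l = "code_bound q (game_order g)"
  let ?B = "9 * output_bound q (?n + 1) + ?l + 4 * ?n + 8"
  have inp: "game_input g @ [y] @ [u, v] = [nat_code ?r, nat_code ?c, rat_code (eps g), y, u, v]"
    by (simp add: game_input_def)
  have "9 * length y + ?l + 2 * ?r + 2 * ?c + 8 \<le> ?B" using assms size_bounds(2,3) by linarith
  then obtain t out where t: "runs (payoff_oracle g) verifier [nat_code ?r, nat_code ?c, rat_code (eps g), y, u, v] t out"
     "t \<le> (52 * (?r * ?c) + 22 * (?r + ?c) + 68) * unit_time ?B"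
     "out = [True] \<longleftrightarrow> cert_ok ?r ?c (payoff g) (rat_code (eps g)) y (take (4 * length y) u)"
    using verifier_runs[of ?r ?c "payoff_oracle g" "payoff g" ?l y ?B "rat_code (eps g)" u v,
        OF basics(2,3) basics(4) payoff_code_length] by blast
  have "?r * ?c \<le> ?n * ?n" using size_bounds(2,3) by (rule mult_le_mono)
  then have "52 * (?r * ?c) + 22 * (?r + ?c) + 68 \<le> 52 * (?n * ?n) + 44 * ?n + 68"
    using size_bounds(2,3) by simp
  then have "(52 * (?r * ?c) + 22 * (?r + ?c) + 68) * unit_time ?B \<le> (52 * (?n * ?n) + 44 * ?n + 68) * unit_time ?B"
    by (rule mult_right_mono) simp
  then have "t \<le> time_bound q ?n" using t(2) unfolding time_bound_def by linarith
  then show "\<exists>t out. runs (payoff_oracle g) verifier (game_input g @ [y] @ [u, v]) t out \<and> t \<le> time_bound q ?n"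
    using t(1) unfolding inp by blast
  have "accepts (payoff_oracle g) verifier [nat_code ?r, nat_code ?c, rat_code (eps g), y, u, v] \<longleftrightarrow> out = [True]"
    by (rule accepts_iff[OF t(1)])
  then show "accepts (payoff_oracle g) verifier (game_input g @ [y] @ [u, v]) \<longleftrightarrow>
       cert_ok ?r ?c (payoff g) (rat_code (eps g)) y (take (4 * length y) u)" unfolding inp using t(3) by simp
qed

lemma certificate_exists:
  "\<exists>y u. length y \<le> output_bound q (game_order g) \<and> length u \<le> 4 * output_bound q (game_order g) \<and>
     cert_ok (rows g) (cols g) (payoff g) (rat_code (eps g)) y (take (4 * length y) u)"
proof -
  let ?n = "game_order g" and ?r = "rows g" and ?c = "cols g" and ?l = "code_bound q (game_order g)"
  \<comment> \<open>A one-entry game is constant, so \<open>m = 0\<close> serves however small the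
    precision is. In all other cases the size bounds \<open>1 / \<epsilon>\<close> and hence the
    number of digit pairs to be inspected.\<close>
  have "\<exists>m\<le>4 * ?n + 2. num_digit_within m (tl (rat_code (eps g))) \<or> (\<forall>i<?r. \<forall>j<?c. payoff g i j = payoff g 0 0)"
  proof (cases "?r * ?c = 1")
    case True
    then have "?r = 1" "?c = 1" by simp_all
    then show ?thesis by (intro exI[of _ 0]) auto
  next
    case False
    obtain m where m: "num_digit_within m (tl (rat_code (eps g)))" "2 ^ m \<le> 2 + 4 / real_of_rat (eps g)"
      using num_digit_within_complete[OF basics(1)] by blast
    have "real m < real (2 ^ m)" using less_exp[of m] by (simp only: of_nat_less_iff)
    also have "\<dots> \<le> 2 + 4 * (1 / real_of_rat (eps g))" using m(2) by simp
    also have "\<dots> \<le> 2 + 4 * real ?n" using size_bounds(4)[OF False] by linarith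
    finally have "m \<le> 4 * ?n + 2" by linarith
    then show ?thesis using m(1) by blast
  qed
  then obtain m where m: "m \<le> 4 * ?n + 2"
    "num_digit_within m (tl (rat_code (eps g))) \<or> (\<forall>i<?r. \<forall>j<?c. payoff g i j = payoff g 0 0)" by blast
  obtain y w where yw: "length y \<le> (?r + ?c) * (2 * (cert_scale ?r ?c ?l m + 1) + 1)" "length w \<le> 4 * length y"
    "cert_ok ?r ?c (payoff g) (rat_code (eps g)) y w"
    using cert_complete[of ?r ?c "payoff g" ?l m "rat_code (eps g)", OF basics(2,3) payoff_code_length m(2)] by blast
  have "(?r + ?c) * (2 * (cert_scale ?r ?c ?l m + 1) + 1) \<le> output_bound q ?n"
    unfolding output_bound_def using m(1) size_bounds(2,3)
    by (intro mult_le_mono add_mono cert_scale_mono order.refl)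
  then have "length y \<le> output_bound q ?n" using yw(1) by linarith
  then show ?thesis using yw(2,3) by (intro exI[of _ y] exI[of _ w]) simp
qed

lemma near_optimal_if_cert:
  assumes "cert_ok (rows g) (cols g) (payoff g) (rat_code (eps g)) y w"
  shows "near_optimal_pair g y"
  using cert_sound[OF basics(2,3,1) assms] unfolding near_optimal_pair_def Let_def by blast

end

theorem theorem6:
  fixes q :: "nat poly"
  shows "search_Sigma2 payoff_oracle game_input
           (\<lambda>g. real (rows g) + real (cols g)
                  + log 2 (real (rows g * cols g)) / real_of_rat (eps g))
           {g. valid_instance q g} near_optimal_pair"
proof -
  obtain T0 where T0: "\<And>x. 0 \<le> x \<Longrightarrow> real (output_bound q (nat \<lceil>x\<rceil>)) \<le> polybound T0 x \<and>
      polybound T0 x \<le> real (output_bound q (nat \<lceil>x\<rceil> + 1))"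
    using poly_fun_polybound[OF poly_fun_output_bound[OF poly_fun_id]] by blast
  obtain T where T: "\<And>x. 0 \<le> x \<Longrightarrow> real (time_bound q (nat \<lceil>x\<rceil>)) \<le> polybound T x"
    using poly_fun_polybound[OF poly_fun_time_bound] by blast
  define W where "W = (\<lambda>g. {w :: word. real (length w) \<le> polybound T (game_size g)})"
  \<comment> \<open>The relation consists of what the verifier accepts, cut off at the output bound.
    Its membership in the class then follows from the running time; totality and soundness are the
    remaining obligations.\<close>
  define S where "S = (\<lambda>g y. real (length y) \<le> polybound T0 (game_size g) \<and>
     (\<exists>u\<in>W g. \<forall>v\<in>W g. accepts (payoff_oracle g) verifier (game_input g @ [y] @ [u, v])))"
  have y_bound: "length y \<le> output_bound q (game_order g + 1)"
    if "valid_instance q g" "real (length y) \<le> polybound T0 (game_size g)" for g y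
    using T0[of "game_size g"] valid_game.size_bounds(1)[OF valid_game.intro[OF that(1)]] that(2)
    by (simp add: game_order_def)
  have time_le: "real (time_bound q (game_order g)) \<le> polybound T (game_size g)" if "valid_instance q g" for g
    using T[of "game_size g"] valid_game.size_bounds(1)[OF valid_game.intro[OF that]] by (simp add: game_order_def)
  \<comment> \<open>The range of the universal word is inhabited, so that acceptance for all such
    words yields an actual accepting run.\<close>
  have Nil_W: "[] \<in> W g" if "valid_instance q g" for g
    using time_le[OF that] by (simp add: W_def)
  have total: "\<exists>y. S g y" if g: "valid_instance q g" for g
  proof -
    interpret valid_game q g by (rule valid_game.intro[OF g])
    obtain y u where yu: "length y \<le> output_bound q (game_order g)" "length u \<le> 4 * output_bound q (game_order g)"
      "cert_ok (rows g) (cols g) (payoff g) (rat_code (eps g)) y (take (4 * length y) u)"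
      using certificate_exists by blast
    have y: "real (length y) \<le> polybound T0 (game_size g)"
      using yu(1) T0[OF size_bounds(1)] by (simp add: game_order_def)
    have "length u \<le> time_bound q (game_order g)" using yu(2) by (simp add: time_bound_def)
    then have "u \<in> W g" using time_le[OF g] by (simp add: W_def)
    then have "S g y" unfolding S_def using y yu(3) verifier_time(2)[OF y_bound[OF g y]] by blast
    then show ?thesis by blast
  qed
  have sound: "near_optimal_pair g y" if g: "valid_instance q g" and S: "S g y" for g y
  proof -
    interpret valid_game q g by (rule valid_game.intro[OF g])
    have y: "real (length y) \<le> polybound T0 (game_size g)" using S by (simp add: S_def)
    obtain u where "accepts (payoff_oracle g) verifier (game_input g @ [y] @ [u, []])"
      using S Nil_W[OF g] unfolding S_def by blast
    then show ?thesis using verifier_time(2)[OF y_bound[OF g y]] near_optimal_if_cert by blast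
  qed
  have "Sigma2 (\<lambda>(x, y). payoff_oracle x) (\<lambda>(x, y). game_input x @ [y]) (\<lambda>(x, y). game_size x)
          {(x, y). x \<in> {g. valid_instance q g} \<and> real (length y) \<le> polybound T0 (game_size x)} {(x, y). S x y}"
    unfolding Sigma2_def
  proof (rule exI[of _ verifier], rule exI[of _ T], intro ballI)
    fix xy :: "game_instance \<times> word"
    assume "xy \<in> {(x, y). x \<in> {g. valid_instance q g} \<and> real (length y) \<le> polybound T0 (game_size x)}"
    then obtain g y where xy: "xy = (g, y)" "valid_instance q g" "real (length y) \<le> polybound T0 (game_size g)" by auto
    interpret valid_game q g by (rule valid_game.intro[OF xy(2)])
    have "\<exists>t out. runs (payoff_oracle g) verifier ((game_input g @ [y]) @ [u, v]) t out \<and> real t \<le> polybound T (game_size g)" for u v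
    proof -
      obtain t out where t: "runs (payoff_oracle g) verifier (game_input g @ [y] @ [u, v]) t out" "t \<le> time_bound q (game_order g)"
        using verifier_time(1)[OF y_bound[OF xy(2,3)]] by blast
      have "real t \<le> polybound T (game_size g)" using t(2) time_le[OF xy(2)] by linarith
      then show ?thesis using t(1) by auto
    qed
    moreover have "S g y \<longleftrightarrow> (\<exists>u\<in>W g. \<forall>v\<in>W g. accepts (payoff_oracle g) verifier ((game_input g @ [y]) @ [u, v]))"
      using xy(3) by (simp add: S_def)
    ultimately show "let B = {w. real (length w) \<le> polybound T (case xy of (x, y) \<Rightarrow> game_size x)}
         in (\<forall>u\<in>B. \<forall>v\<in>B. \<exists>t out. runs (case xy of (x, y) \<Rightarrow> payoff_oracle x) verifier
                ((case xy of (x, y) \<Rightarrow> game_input x @ [y]) @ [u, v]) t out \<and>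
               real t \<le> polybound T (case xy of (x, y) \<Rightarrow> game_size x)) \<and>
            (xy \<in> {(x, y). S x y}) =
            (\<exists>u\<in>B. \<forall>v\<in>B. accepts (case xy of (x, y) \<Rightarrow> payoff_oracle x) verifier
                ((case xy of (x, y) \<Rightarrow> game_input x @ [y]) @ [u, v]))"
      unfolding Let_def xy(1) prod.case W_def by blast
  qed
  moreover have "\<forall>x\<in>{g. valid_instance q g}. (\<exists>y. S x y) \<and>
      (\<forall>y. S x y \<longrightarrow> real (length y) \<le> polybound T0 (game_size x) \<and> near_optimal_pair x y)"
    using total sound unfolding S_def by blast
  ultimately have "search_Sigma2 payoff_oracle game_input game_size {g. valid_instance q g} near_optimal_pair"
    unfolding search_Sigma2_def by blast
  then show ?thesis unfolding game_size_def[abs_def] .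
qed

end
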